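(* A $\mathbb{Z}_2$-symmetric graph $G$ is $(2,2)$-$C_i$-tight if and only if $G$ can be generated from $F_1$ or $F_2$ (with their involutions as described) by a finite sequence of the following operations: symmetrised 0-extensions, symmetrised 1-extensions, symmetrised vertex-to-$K_4$ operations, symmetrised vertex-to-$C_4$ operations at non-fixed vertices, and joining two graphs already so generated by two new edges $xy,x'y'$ (with $x$ in the first graph and $y$ in the second).
   Context: A $\mathbb{Z}_2$-symmetric graph is a finite simple graph $G=(V,E)$ with an automorphism $\theta$, $\theta^2=\mathrm{id}$; write $v'=\theta(v)$; graphs are considered up to isomorphisms commuting with the involutions. A vertex is fixed if $v'=v$; an edge $uv$ is fixed if $\{u',v'\}=\{u,v\}$. $G$ is $(2,2)$-sparse if every subgraph $(V',E')$ with $V'\ne\emptyset$ has $|E'|\le2|V'|-2$, $(2,2)$-tight if also $|E|=2|V|-2$; $(2,2)$-$C_i$-tight if $(2,2)$-tight and $\theta$ fixes no vertex and no edge. Base graphs: $F_1$ has vertices $a,b,c,d,e,f$, edges all pairs between $\{c,d\}$ and $\{a,b,e,f\}$ plus $ab,ef$, involution $a\leftrightarrow f$, $b\leftrightarrow e$, $c\leftrightarrow d$. $F_2$ consists of two disjoint copies of $K_4$ on $\{a_1,a_2,a_3,a_4\}$ and $\{b_1,b_2,b_3,b_4\}$ plus edges $a_3b_3$, $a_4b_4$, with involution $a_1\leftrightarrow b_1$, $a_2\leftrightarrow b_2$, $a_3\leftrightarrow b_4$, $a_4\leftrightarrow b_3$. Operations (new vertices always come in pairs $s,s'$ swapped by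 the extended involution, and the result is required to be simple): - symmetrised 0-extension: add $v,v'$, $v$ adjacent to distinct $a,b$, $v'$ adjacent to $a',b'$; - symmetrised 1-extension: for a non-fixed edge $ab$ and a vertex $c\notin\{a,b\}$, delete $ab,a'b'$, add $v$ adjacent to $a,b,c$ and $v'$ adjacent to $a',b',c'$; - symmetrised vertex-to-$K_4$: at a non-fixed vertex $w$, add $a,b,c,a',b',c'$ making $\{w,a,b,c\}$ and $\{w',a',b',c'\}$ cliques, and for each former neighbour $u$ of $w$ replace the edge $wu$ by $d_uu$ for a chosen $d_u\in\{w,a,b,c\}$, doing the image choice at $w'$; - symmetrised vertex-to-$C_4$ at a non-fixed vertex $w$: choose distinct neighbours $v_1,v_2$ of $w$, add $u$ adjacent to $v_1,v_2$ (keeping $wv_1,wv_2$), move any subset of the remaining edges $wv_i$ to $uv_i$, and do the image operation at $w'$ with $u'$; - joining: disjoint union of two such graphs plus edges $xy,x'y'$. *)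

theory Defs
  imports Main
begin

text \<open>A Z2-symmetric graph on natural-number vertices: vertex set, edge set
  (edges are 2-element sets) and the involution theta (relevant on verts only).\<close>

record zgraph =
  verts :: "nat set"
  edges :: "nat set set"
  invol :: "nat \<Rightarrow> nat"

definition z2_graph :: "zgraph \<Rightarrow> bool" where
  "z2_graph G \<longleftrightarrow> finite (verts G)
     \<and> (\<forall>e\<in>edges G. \<exists>u v. e = {u, v} \<and> u \<noteq> v \<and> u \<in> verts G \<and> v \<in> verts G)
     \<and> (\<forall>v\<in>verts G. invol G v \<in> verts G \<and> invol G (invol G v) = v)
     \<and> (\<forall>u v. {u, v} \<in> edges G \<longrightarrow> {invol G u, invol G v} \<in> edges G)"

definition nbrs :: "zgraph \<Rightarrow> nat \<Rightarrow> nat set" where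
  "nbrs G w = {u. {w, u} \<in> edges G}"

definition clique :: "nat set \<Rightarrow> nat set set" where
  "clique S = {{x, y} | x y. x \<in> S \<and> y \<in> S \<and> x \<noteq> y}"

definition sparse22 :: "zgraph \<Rightarrow> bool" where
  "sparse22 G \<longleftrightarrow> (\<forall>V' E'. V' \<noteq> {} \<and> V' \<subseteq> verts G \<and> E' \<subseteq> edges G \<and> (\<forall>e\<in>E'. e \<subseteq> V')
      \<longrightarrow> int (card E') \<le> 2 * int (card V') - 2)"

definition tight22 :: "zgraph \<Rightarrow> bool" where
  "tight22 G \<longleftrightarrow> sparse22 G \<and> int (card (edges G)) = 2 * int (card (verts G)) - 2"

definition ci_tight :: "zgraph \<Rightarrow> bool" where
  "ci_tight G \<longleftrightarrow> tight22 G
     \<and> (\<forall>v\<in>verts G. invol G v \<noteq> v)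
     \<and> (\<forall>u v. {u, v} \<in> edges G \<longrightarrow> {invol G u, invol G v} \<noteq> {u, v})"

definition z2_iso :: "zgraph \<Rightarrow> zgraph \<Rightarrow> bool" where
  "z2_iso G H \<longleftrightarrow> (\<exists>f. bij_betw f (verts G) (verts H)
     \<and> (\<forall>u\<in>verts G. \<forall>v\<in>verts G. {u, v} \<in> edges G \<longleftrightarrow> {f u, f v} \<in> edges H)
     \<and> (\<forall>v\<in>verts G. f (invol G v) = invol H (f v)))"

text \<open>F1: a,b,c,d,e,f = 0,1,2,3,4,5; involution v \<mapsto> 5 - v.\<close>
definition F1 :: zgraph where
  "F1 = \<lparr> verts = {0..5},
          edges = {{x, y} | x y. x \<in> {2, 3} \<and> y \<in> {0, 1, 4, 5}} \<union> {{0, 1}, {4, 5}},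
          invol = (\<lambda>v. if v \<le> 5 then 5 - v else v) \<rparr>"

text \<open>F2: a1..a4 = 0..3, b1..b4 = 4..7.\<close>
definition F2 :: zgraph where
  "F2 = \<lparr> verts = {0..7},
          edges = clique {0, 1, 2, 3} \<union> clique {4, 5, 6, 7} \<union> {{2, 6}, {3, 7}},
          invol = (\<lambda>v. if v = 0 then 4 else if v = 4 then 0
                      else if v = 1 then 5 else if v = 5 then 1
                      else if v = 2 then 7 else if v = 7 then 2
                      else if v = 3 then 6 else if v = 6 then 3 else v) \<rparr>"

definition sym_0ext :: "zgraph \<Rightarrow> zgraph \<Rightarrow> bool" where
  "sym_0ext G H \<longleftrightarrow> (\<exists>a b v v'. a \<in> verts G \<and> b \<in> verts G \<and> a \<noteq> b
     \<and> v \<notin> verts G \<and> v' \<notin> verts G \<and> v \<noteq> v'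
     \<and> H = \<lparr> verts = verts G \<union> {v, v'},
             edges = edges G \<union> {{v, a}, {v, b}, {v', invol G a}, {v', invol G b}},
             invol = (invol G)(v := v', v' := v) \<rparr>)"

definition sym_1ext :: "zgraph \<Rightarrow> zgraph \<Rightarrow> bool" where
  "sym_1ext G H \<longleftrightarrow> (\<exists>a b c v v'. {a, b} \<in> edges G \<and> {invol G a, invol G b} \<noteq> {a, b}
     \<and> c \<in> verts G \<and> c \<notin> {a, b}
     \<and> v \<notin> verts G \<and> v' \<notin> verts G \<and> v \<noteq> v'
     \<and> H = \<lparr> verts = verts G \<union> {v, v'},
             edges = (edges G - {{a, b}, {invol G a, invol G b}})
                     \<union> {{v, a}, {v, b}, {v, c}, {v', invol G a}, {v', invol G b}, {v', invol G c}},
             invol = (invol G)(v := v', v' := v) \<rparr>)"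

definition sym_K4 :: "zgraph \<Rightarrow> zgraph \<Rightarrow> bool" where
  "sym_K4 G H \<longleftrightarrow> (\<exists>w a b c a' b' c' d. w \<in> verts G \<and> invol G w \<noteq> w
     \<and> distinct [a, b, c, a', b', c'] \<and> {a, b, c, a', b', c'} \<inter> verts G = {}
     \<and> (\<forall>u\<in>nbrs G w. d u \<in> {w, a, b, c})
     \<and> (let t = (invol G)(a := a', b := b', c := c', a' := a, b' := b, c' := c) in
        H = \<lparr> verts = verts G \<union> {a, b, c, a', b', c'},
              edges = {e \<in> edges G. w \<notin> e \<and> invol G w \<notin> e}
                      \<union> clique {w, a, b, c} \<union> clique {invol G w, a', b', c'}
                      \<union> {{d u, u} | u. u \<in> nbrs G w}
                      \<union> {{t (d u), invol G u} | u. u \<in> nbrs G w},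
              invol = t \<rparr>))"

definition sym_C4 :: "zgraph \<Rightarrow> zgraph \<Rightarrow> bool" where
  "sym_C4 G H \<longleftrightarrow> (\<exists>w v1 v2 S u u'. w \<in> verts G \<and> invol G w \<noteq> w
     \<and> v1 \<in> nbrs G w \<and> v2 \<in> nbrs G w \<and> v1 \<noteq> v2 \<and> S \<subseteq> nbrs G w - {v1, v2}
     \<and> u \<notin> verts G \<and> u' \<notin> verts G \<and> u \<noteq> u'
     \<and> H = \<lparr> verts = verts G \<union> {u, u'},
             edges = (edges G - {{w, x} | x. x \<in> S} - {{invol G w, invol G x} | x. x \<in> S})
                     \<union> {{u, x} | x. x \<in> S \<union> {v1, v2}}
                     \<union> {{u', invol G x} | x. x \<in> S \<union> {v1, v2}},
             invol = (invol G)(u := u', u' := u) \<rparr>)"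

definition sym_join :: "zgraph \<Rightarrow> zgraph \<Rightarrow> zgraph \<Rightarrow> bool" where
  "sym_join G1 G2 H \<longleftrightarrow> (\<exists>x y. verts G1 \<inter> verts G2 = {} \<and> x \<in> verts G1 \<and> y \<in> verts G2
     \<and> H = \<lparr> verts = verts G1 \<union> verts G2,
             edges = edges G1 \<union> edges G2 \<union> {{x, y}, {invol G1 x, invol G2 y}},
             invol = (\<lambda>v. if v \<in> verts G1 then invol G1 v else invol G2 v) \<rparr>)"

inductive generated :: "zgraph \<Rightarrow> bool" where
  base1: "generated F1"
| base2: "generated F2"
| iso: "generated G \<Longrightarrow> z2_graph H \<Longrightarrow> z2_iso G H \<Longrightarrow> generated H"
| ext0: "generated G \<Longrightarrow> sym_0ext G H \<Longrightarrow> generated H"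
| ext1: "generated G \<Longrightarrow> sym_1ext G H \<Longrightarrow> generated H"
| k4: "generated G \<Longrightarrow> sym_K4 G H \<Longrightarrow> generated H"
| c4: "generated G \<Longrightarrow> sym_C4 G H \<Longrightarrow> generated H"
| join: "generated G1 \<Longrightarrow> generated G2 \<Longrightarrow> sym_join G1 G2 H \<Longrightarrow> generated H"

end

theory Submission
  imports Defs
begin

text \<open>
  Let the slack of a vertex set be twice its size minus the number of edges it induces. Sparsity means
  that nonempty sets have slack at least 2, and a set is called tight if its slack is 2. The slack is
  submodular, so tight sets that meet have tight union and intersection. As the involution acts freely
  on vertices and edges, invariant sets have even slack.

  For the decomposition of a tight graph, parity makes symmetric reductions as easy as ordinary ones:
  deleting a degree 3 vertex \<open>v\<close> with its image and inserting an edge \<open>pq\<close> with its image can only fail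
  through a single tight set containing \<open>p\<close> and \<open>q\<close>. Hence a degree 3 vertex that admits no inverse
  1-extension lies in a \<open>K\<^sub>4\<close> or in an invariant copy of \<open>F\<^sub>1\<close>. A \<open>K\<^sub>4\<close> can be contracted unless a
  further vertex has two neighbours in it, when an inverse vertex-to-\<open>C\<^sub>4\<close> move applies, or it is joined
  to its image, when the two span a copy of \<open>F\<^sub>2\<close>. The invariant copies of \<open>F\<^sub>1\<close> and \<open>F\<^sub>2\<close> are pairwise
  disjoint, and if each of them had at least four outgoing edges, the sum of degree minus 4 over all
  vertices would be nonnegative, whereas it is \<open>-4\<close>. So either some copy has exactly two outgoing edges
  and the graph is a join, or some degree 3 vertex lies in no proper copy.
\<close>

section \<open>Slack and unsymmetric moves\<close>

text \<open>Slack turns every move into arithmetic: a vertex brings 2 and an edge costs 1.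
  Preservation of tightness is proved without symmetry; a symmetric move is then the ordinary move
  at a vertex followed by the one at its image. Since no edge is fixed, the first move leaves the
  data of the second intact. Parity is what removes the obstacle in the reductions. Removing a
  degree 3 vertex and its image leaves slack 4, room for exactly two edges. The sets endangered
  although they are not tight are those of slack 3 containing both new edges; the union and the
  intersection of such a set with its image are invariant, and evenness makes one of them tight. The
  total -4 is \<open>2 * card E - 4 * card V\<close> for a tight graph. A tight set with k outgoing
  edges contributes k - 4 to it. For a proper invariant set k is even and at least 2, which is why
  the alternatives are exactly two or at least four outgoing edges. Reduced graphs keep the same
  involution, so each move gives back the original graph itself; isomorphisms enter only to
  recognise the base graphs.\<close>

definition ind :: "nat set set \<Rightarrow> nat set \<Rightarrow> nat set set" where
  "ind E X = {e \<in> E. e \<subseteq> X}"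

definition slack :: "nat set set \<Rightarrow> nat set \<Rightarrow> int" where
  "slack E X = 2 * int (card X) - int (card (ind E X))"

definition star :: "nat \<Rightarrow> nat set \<Rightarrow> nat set set" where
  "star v N = {{v, x} | x. x \<in> N}"

definition graph_on :: "nat set \<Rightarrow> nat set set \<Rightarrow> bool" where
  "graph_on V E \<longleftrightarrow> finite V \<and> (\<forall>e\<in>E. \<exists>u v. e = {u, v} \<and> u \<noteq> v \<and> u \<in> V \<and> v \<in> V)"

definition tight_on :: "nat set \<Rightarrow> nat set set \<Rightarrow> bool" where
  "tight_on V E \<longleftrightarrow> graph_on V E \<and> (\<forall>X\<subseteq>V. X \<noteq> {} \<longrightarrow> 2 \<le> slack E X) \<and> slack E V = 2"

lemma graph_onD: "graph_on V E \<Longrightarrow> e \<in> E \<Longrightarrow> \<exists>u v. e = {u, v} \<and> u \<noteq> v \<and> u \<in> V \<and> v \<in> V"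
  by (simp add: graph_on_def)

lemma graph_on_subset: "graph_on V E \<Longrightarrow> e \<in> E \<Longrightarrow> e \<subseteq> V"
  by (auto dest: graph_onD)

lemma graph_on_finite:
  assumes "graph_on V E" shows "finite V" "finite E"
proof -
  show "finite V" using assms by (simp add: graph_on_def)
  moreover have "E \<subseteq> Pow V" using graph_on_subset[OF assms] by auto
  ultimately show "finite E" by (meson finite_Pow_iff finite_subset)
qed

lemma graph_on_mono: "graph_on V E \<Longrightarrow> V \<subseteq> V' \<Longrightarrow> finite V' \<Longrightarrow> E' \<subseteq> E \<Longrightarrow> graph_on V' E'"
  unfolding graph_on_def by (meson subsetD)

lemma graph_on_Un: "graph_on V E \<Longrightarrow> graph_on V E' \<Longrightarrow> graph_on V (E \<union> E')"
  unfolding graph_on_def by auto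

lemma graph_on_star: "finite V \<Longrightarrow> v \<in> V \<Longrightarrow> N \<subseteq> V \<Longrightarrow> v \<notin> N \<Longrightarrow> graph_on V (star v N)"
  unfolding graph_on_def star_def by auto

lemma finite_ind: "finite E \<Longrightarrow> finite (ind E X)"
  by (simp add: ind_def)

lemma ind_all: "graph_on V E \<Longrightarrow> ind E V = E"
  using graph_on_subset by (auto simp: ind_def)

lemma slack_empty: "graph_on V E \<Longrightarrow> slack E {} = 0"
proof -
  assume "graph_on V E"
  hence "ind E {} = {}" by (auto simp: ind_def dest: graph_onD)
  thus ?thesis by (simp add: slack_def)
qed

lemma slack_all: "graph_on V E \<Longrightarrow> slack E V = 2 * int (card V) - int (card E)"
  by (simp add: slack_def ind_all)

lemma tight_onD:
  assumes "tight_on V E"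
  shows "graph_on V E" "X \<subseteq> V \<Longrightarrow> X \<noteq> {} \<Longrightarrow> 2 \<le> slack E X" "slack E V = 2"
  using assms by (auto simp: tight_on_def)

lemma z2_graph_on: "z2_graph G \<Longrightarrow> graph_on (verts G) (edges G)"
  by (auto simp: z2_graph_def graph_on_def)

text \<open>Among all edge sets inside a given vertex set the induced one is the largest, so
  sparsity only has to be tested on induced edge sets.\<close>

lemma tight22_iff:
  assumes "graph_on (verts G) (edges G)"
  shows "tight22 G \<longleftrightarrow> tight_on (verts G) (edges G)"
proof -
  have fin: "finite (edges G)" using graph_on_finite[OF assms] by simp
  have "sparse22 G \<longleftrightarrow> (\<forall>X\<subseteq>verts G. X \<noteq> {} \<longrightarrow> 2 \<le> slack (edges G) X)"
  proof
    assume s: "sparse22 G"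
    show "\<forall>X\<subseteq>verts G. X \<noteq> {} \<longrightarrow> 2 \<le> slack (edges G) X"
    proof (intro allI impI)
      fix X assume X: "X \<subseteq> verts G" "X \<noteq> {}"
      have "int (card (ind (edges G) X)) \<le> 2 * int (card X) - 2"
        using s X unfolding sparse22_def by (simp add: ind_def)
      thus "2 \<le> slack (edges G) X" by (simp add: slack_def)
    qed
  next
    assume s: "\<forall>X\<subseteq>verts G. X \<noteq> {} \<longrightarrow> 2 \<le> slack (edges G) X"
    show "sparse22 G" unfolding sparse22_def
    proof (intro allI impI, elim conjE)
      fix X E' assume X: "X \<noteq> {}" "X \<subseteq> verts G" "E' \<subseteq> edges G" "\<forall>e\<in>E'. e \<subseteq> X"
      have "E' \<subseteq> ind (edges G) X" using X by (auto simp: ind_def)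
      hence "card E' \<le> card (ind (edges G) X)" by (simp add: card_mono finite_ind fin)
      moreover have "2 \<le> slack (edges G) X" using s X by simp
      ultimately show "int (card E') \<le> 2 * int (card X) - 2" by (simp add: slack_def)
    qed
  qed
  moreover have "int (card (edges G)) = 2 * int (card (verts G)) - 2 \<longleftrightarrow> slack (edges G) (verts G) = 2"
    using slack_all[OF assms] by auto
  ultimately show ?thesis using assms unfolding tight22_def tight_on_def by argo
qed

section \<open>Slack under attaching a star or deleting an edge\<close>

lemma card_star: "card (star v N) = card N"
proof -
  have "star v N = (\<lambda>x. {v, x}) ` N" by (auto simp: star_def)
  moreover have "inj_on (\<lambda>x. {v, x}) N" by (auto simp: inj_on_def doubleton_eq_iff)
  ultimately show ?thesis by (simp add: card_image)
qed

lemma finite_star: "finite N \<Longrightarrow> finite (star v N)"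
  by (simp add: star_def)

lemma slack_star_avoid: "v \<notin> X \<Longrightarrow> slack (E \<union> star v N) X = slack E X"
proof -
  assume "v \<notin> X"
  hence "ind (E \<union> star v N) X = ind E X" by (auto simp: ind_def star_def)
  thus ?thesis by (simp add: slack_def)
qed

lemma slack_star:
  assumes "graph_on V E" "v \<notin> V" "N \<subseteq> V" "X \<subseteq> V"
  shows "slack (E \<union> star v N) (insert v X) = slack E X + 2 - int (card (N \<inter> X))"
proof -
  have fin: "finite V" "finite E" using graph_on_finite[OF assms(1)] by auto
  have *: "ind (E \<union> star v N) (insert v X) = ind E X \<union> star v (N \<inter> X)"
    using assms graph_on_subset[OF assms(1)] by (fastforce simp: ind_def star_def)
  have "ind E X \<inter> star v (N \<inter> X) = {}"
    using assms graph_on_subset[OF assms(1)] by (fastforce simp: ind_def star_def)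
  hence "card (ind (E \<union> star v N) (insert v X)) = card (ind E X) + card (N \<inter> X)"
    unfolding * using fin assms
    by (subst card_Un_disjoint) (auto simp: finite_ind card_star finite_star finite_subset)
  moreover have "card (insert v X) = Suc (card X)"
    using fin assms by (meson card_insert_disjoint finite_subset subsetD)
  ultimately show ?thesis by (simp add: slack_def)
qed

text \<open>\<open>A\<close> collects only the known neighbours of \<open>v\<close> in
  \<open>X\<close>; any further edges lower the slack even more, hence an inequality.\<close>

lemma slack_insert_le:
  assumes "finite E" "finite X" "v \<notin> X" "A \<subseteq> X" "\<And>a. a \<in> A \<Longrightarrow> {v, a} \<in> E"
  shows "slack E (insert v X) \<le> slack E X + 2 - int (card A)"
proof -
  have "ind E X \<union> star v A \<subseteq> ind E (insert v X)"
    using assms by (auto simp: ind_def star_def)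
  hence "card (ind E X \<union> star v A) \<le> card (ind E (insert v X))"
    by (simp add: card_mono finite_ind assms)
  moreover have "card (ind E X \<union> star v A) = card (ind E X) + card A"
    using assms by (subst card_Un_disjoint)
      (auto simp: finite_ind card_star finite_star finite_subset, auto simp: ind_def star_def)
  ultimately show ?thesis using assms by (simp add: slack_def)
qed

lemma slack_antimono: "finite E \<Longrightarrow> E' \<subseteq> E \<Longrightarrow> slack E X \<le> slack E' X"
  unfolding slack_def ind_def using card_mono[of "{e \<in> E. e \<subseteq> X}" "{e \<in> E'. e \<subseteq> X}"]
  by fastforce

text \<open>The common core of 0-extension, 1-extension, vertex-to-C4 and K4 contraction.
  \<open>E\<close> is what survives of the old edges after a deletion. Adding \<open>v\<close> to
  \<open>X\<close> changes the slack by \<open>2 - card (N \<inter> X)\<close>, so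
  \<open>meet\<close> is exactly the condition that keeps the enlarged sets sparse.\<close>

lemma tight_on_add_vertex:
  assumes g: "graph_on V E" and v: "v \<notin> V" and N: "N \<subseteq> V"
    and avoid: "\<And>X. X \<subseteq> V \<Longrightarrow> X \<noteq> {} \<Longrightarrow> 2 \<le> slack E X"
    and meet: "\<And>X. X \<subseteq> V \<Longrightarrow> X \<noteq> {} \<Longrightarrow> int (card (N \<inter> X)) \<le> slack E X"
    and all: "slack E V = int (card N)"
  shows "tight_on (insert v V) (E \<union> star v N)"
  unfolding tight_on_def
proof (intro conjI allI impI)
  have fin: "finite V" using graph_on_finite[OF g] by simp
  show "graph_on (insert v V) (E \<union> star v N)"
    using graph_on_mono[OF g, of "insert v V" E] graph_on_star[of "insert v V" v N] fin v N
    by (intro graph_on_Un) auto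
  show "slack (E \<union> star v N) (insert v V) = 2"
    using slack_star[OF g v N order.refl] all N by (simp add: Int_absorb2)
  fix X assume X: "X \<subseteq> insert v V" "X \<noteq> {}"
  show "2 \<le> slack (E \<union> star v N) X"
  proof (cases "v \<in> X")
    case False
    thus ?thesis using X avoid[of X] by (auto simp: slack_star_avoid)
  next
    case True
    define Y where "Y = X - {v}"
    have Y: "X = insert v Y" "Y \<subseteq> V" using True X by (auto simp: Y_def)
    \<comment> \<open>\<open>meet\<close> is silent about the empty set; there
      \<open>insert v Y\<close> is a single vertex, of slack 2.\<close>
    have "int (card (N \<inter> Y)) \<le> slack E Y"
      using meet[OF Y(2)] slack_empty[OF g] by (cases "Y = {}") auto
    thus ?thesis using slack_star[OF g v N Y(2)] Y(1) by simp
  qed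
qed

lemma tight_on_ext0:
  assumes t: "tight_on V E" and "v \<notin> V" "a \<in> V" "b \<in> V" "a \<noteq> b"
  shows "tight_on (insert v V) (E \<union> star v {a, b})"
proof (rule tight_on_add_vertex)
  show "int (card ({a, b} \<inter> X)) \<le> slack E X" if "X \<subseteq> V" "X \<noteq> {}" for X
  proof -
    have "card ({a, b} \<inter> X) \<le> card {a, b}" by (rule card_mono) auto
    thus ?thesis using tight_onD(2)[OF t that] assms by simp
  qed
qed (use assms tight_onD[OF t] in auto)

lemma slack_Diff_edge:
  assumes "finite E" "e \<in> E"
  shows "slack (E - {e}) X = slack E X + (if e \<subseteq> X then 1 else 0)"
proof -
  have *: "ind (E - {e}) X = (if e \<subseteq> X then ind E X - {e} else ind E X)"
    by (auto simp: ind_def)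
  show ?thesis
  proof (cases "e \<subseteq> X")
    case True
    hence "e \<in> ind E X" using assms by (simp add: ind_def)
    hence "card (ind E X) = Suc (card (ind E X - {e}))"
      by (metis assms(1) card_Suc_Diff1 finite_ind)
    thus ?thesis using True * by (simp add: slack_def)
  qed (simp add: slack_def *)
qed

text \<open>Sets containing both \<open>a\<close> and \<open>b\<close> gain one from the deleted
  edge, so their slack of at least 3 pays for three edges at \<open>v\<close>. All other sets meet
  \<open>{a, b, c}\<close> in at most two vertices, and slack 2 suffices.\<close>

lemma tight_on_ext1:
  assumes t: "tight_on V E" and "v \<notin> V" "{a, b} \<in> E" "c \<in> V" "c \<notin> {a, b}"
  shows "tight_on (insert v V) (E - {{a, b}} \<union> star v {a, b, c})"
proof (rule tight_on_add_vertex)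
  note g = tight_onD(1)[OF t]
  have fin: "finite E" using graph_on_finite[OF g] by simp
  have ab: "a \<in> V" "b \<in> V" "a \<noteq> b"
    using graph_onD[OF g assms(3)] by (auto simp: doubleton_eq_iff)
  note sl = slack_Diff_edge[OF fin assms(3)]
  show "graph_on V (E - {{a, b}})"
    using graph_on_mono[OF g] graph_on_finite[OF g] by blast
  show "2 \<le> slack (E - {{a, b}}) X" if "X \<subseteq> V" "X \<noteq> {}" for X
    using tight_onD(2)[OF t that] sl by simp
  show "{a, b, c} \<subseteq> V" using ab assms by auto
  show "slack (E - {{a, b}}) V = int (card {a, b, c})"
    using sl[of V] tight_onD(3)[OF t] ab assms by simp
  show "int (card ({a, b, c} \<inter> X)) \<le> slack (E - {{a, b}}) X" if X: "X \<subseteq> V" "X \<noteq> {}" for X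
  proof (cases "{a, b} \<subseteq> X")
    case True
    have "card ({a, b, c} \<inter> X) \<le> card {a, b, c}" by (rule card_mono) auto
    thus ?thesis using True sl[of X] tight_onD(2)[OF t X] ab assms by simp
  next
    case False
    then obtain z where z: "z \<in> {a, b}" "z \<notin> X" by auto
    have "card ({a, b, c} \<inter> X) \<le> card ({a, b, c} - {z})" using z by (intro card_mono) auto
    also have "\<dots> \<le> 2" using z ab assms by auto
    finally have "card ({a, b, c} \<inter> X) \<le> 2" .
    moreover have "2 \<le> slack (E - {{a, b}}) X" using sl[of X] tight_onD(2)[OF t X] by simp
    ultimately show ?thesis by linarith
  qed
qed (use assms in auto)

text \<open>If \<open>X\<close> contains \<open>w\<close>, the deleted edges raise its slack by
  \<open>card (S \<inter> X)\<close>, and \<open>v1\<close>, \<open>v2\<close> cost at most the 2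
  that is there anyway. If \<open>X\<close> misses \<open>w\<close>, every neighbour of
  \<open>u\<close> in \<open>X\<close> was a neighbour of \<open>w\<close>, and sparsity of
  \<open>insert w X\<close> in the old graph gives the bound.\<close>

lemma tight_on_C4:
  assumes t: "tight_on V E" and u: "u \<notin> V" and v12: "{w, v1} \<in> E" "{w, v2} \<in> E" "v1 \<noteq> v2"
    and S: "star w S \<subseteq> E" "S \<inter> {v1, v2} = {}"
  shows "tight_on (insert u V) (E - star w S \<union> star u (S \<union> {v1, v2}))"
proof (rule tight_on_add_vertex)
  note g = tight_onD(1)[OF t]
  have fin: "finite E" "finite V" using graph_on_finite[OF g] by auto
  have nb: "x \<in> V \<and> x \<noteq> w \<and> w \<in> V" if "{w, x} \<in> E" for x
    using graph_onD[OF g that] by (auto simp: doubleton_eq_iff)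
  have SE: "{w, x} \<in> E" if "x \<in> S" for x using S that by (auto simp: star_def)
  have SV: "S \<subseteq> V" using nb SE by auto
  have wV: "w \<in> V" "w \<notin> S" using nb v12 SE by auto
  have sl: "slack (E - star w S) X = slack E X + (if w \<in> X then int (card (S \<inter> X)) else 0)" for X
  proof -
    have "ind (E - star w S) X = ind E X - (if w \<in> X then star w (S \<inter> X) else {})"
      by (auto simp: ind_def star_def)
    moreover have "w \<in> X \<Longrightarrow> star w (S \<inter> X) \<subseteq> ind E X"
      using S by (auto simp: ind_def star_def)
    ultimately show ?thesis
      using finite_ind[OF fin(1), of X] card_mono[of "ind E X" "star w (S \<inter> X)"]
      by (auto simp: slack_def card_Diff_subset card_star finite_subset)
  qed
  show "graph_on V (E - star w S)"
    using graph_on_mono[OF g] fin by blast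
  show "2 \<le> slack (E - star w S) X" if "X \<subseteq> V" "X \<noteq> {}" for X
    using tight_onD(2)[OF t that] sl[of X] by simp
  show "S \<union> {v1, v2} \<subseteq> V" using SV nb v12 by auto
  have "card (S \<union> {v1, v2}) = card S + 2"
    using S v12(3) fin SV by (subst card_Un_disjoint) (auto simp: finite_subset)
  thus "slack (E - star w S) V = int (card (S \<union> {v1, v2}))"
    using sl[of V] wV SV tight_onD(3)[OF t] by (simp add: Int_absorb2)
  show "int (card ((S \<union> {v1, v2}) \<inter> X)) \<le> slack (E - star w S) X" if X: "X \<subseteq> V" "X \<noteq> {}" for X
  proof (cases "w \<in> X")
    case True
    have "(S \<union> {v1, v2}) \<inter> X = (S \<inter> X) \<union> ({v1, v2} \<inter> X)" by auto
    hence "card ((S \<union> {v1, v2}) \<inter> X) \<le> card (S \<inter> X) + card ({v1, v2} \<inter> X)"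
      by (metis card_Un_le)
    moreover have "card ({v1, v2} \<inter> X) \<le> card {v1, v2}" by (rule card_mono) auto
    ultimately show ?thesis using True sl[of X] tight_onD(2)[OF t X] v12(3) by simp
  next
    case False
    have "slack E (insert w X) \<le> slack E X + 2 - int (card ((S \<union> {v1, v2}) \<inter> X))"
      using fin X False v12 SE by (intro slack_insert_le) (auto intro: finite_subset)
    moreover have "2 \<le> slack E (insert w X)" using X wV by (intro tight_onD(2)[OF t]) auto
    ultimately show ?thesis using sl[of X] False by simp
  qed
qed (use u in auto)

section \<open>Four-vertex cliques and joins\<close>

lemma card_clique: "finite P \<Longrightarrow> card (clique P) = card P choose 2"
proof -
  assume f: "finite P"
  have "clique P = {e. e \<subseteq> P \<and> card e = 2}"
    by (auto simp: clique_def card_2_iff)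
  thus ?thesis using n_subsets[OF f] by simp
qed

text \<open>For p vertices the inequality is equivalent to (p - 1)(p - 4) \<le> 0.\<close>

lemma card_clique_le:
  assumes "finite P" "P \<noteq> {}" "card P \<le> 4"
  shows "card (clique P) + 2 \<le> 2 * card P"
proof -
  have "card P \<noteq> 0" using assms by simp
  hence "card P \<in> {1, 2, 3, 4}" using assms(3) by auto
  thus ?thesis using assms by (auto simp: card_clique choose_two)
qed

lemma ind_clique: "X \<subseteq> P \<Longrightarrow> ind (clique P) X = clique X"
  by (fastforce simp: ind_def clique_def)

lemma graph_on_clique: "finite P \<Longrightarrow> graph_on P (clique P)"
  by (auto simp: graph_on_def clique_def)

lemma tight_on_clique:
  assumes "card P = 4"
  shows "tight_on P (clique P)"
proof -
  have fin: "finite P" using assms by (simp add: card_ge_0_finite)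
  have "2 \<le> slack (clique P) X" if "X \<subseteq> P" "X \<noteq> {}" for X
  proof -
    have "finite X" "card X \<le> 4" using that fin assms card_mono[OF fin, of X] by (auto simp: finite_subset)
    thus ?thesis using that card_clique_le[of X] by (simp add: slack_def ind_clique)
  qed
  moreover have "slack (clique P) P = 2"
    using assms fin by (simp add: slack_def ind_clique card_clique choose_two)
  ultimately show ?thesis using graph_on_clique[OF fin] by (auto simp: tight_on_def)
qed

text \<open>A set meeting both sides has slack at least 2 + 2 before the connecting edges are
  counted, and a set on one side contains neither of them. By \<open>ne\<close> there really are two
  such edges; a repeated edge would leave the union with slack 3.\<close>

lemma tight_on_join:
  assumes t: "tight_on V1 E1" "tight_on V2 E2" and disj: "V1 \<inter> V2 = {}"
    and x: "x1 \<in> V1" "x2 \<in> V1" "y1 \<in> V2" "y2 \<in> V2" and ne: "{x1, y1} \<noteq> {x2, y2}"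
  shows "tight_on (V1 \<union> V2) (E1 \<union> E2 \<union> {{x1, y1}, {x2, y2}})" (is "tight_on _ ?E")
  unfolding tight_on_def
proof (intro conjI allI impI)
  note g = tight_onD(1)[OF t(1)] tight_onD(1)[OF t(2)]
  have fin: "finite V1" "finite V2" "finite E1" "finite E2"
    using graph_on_finite[OF g(1)] graph_on_finite[OF g(2)] by auto
  have "x1 \<noteq> y1" "x2 \<noteq> y2" using disj x by auto
  hence "graph_on (V1 \<union> V2) {{x1, y1}, {x2, y2}}"
    using x fin by (auto simp: graph_on_def)
  moreover have "graph_on (V1 \<union> V2) E1" "graph_on (V1 \<union> V2) E2"
    using graph_on_mono[OF g(1), of "V1 \<union> V2" E1] graph_on_mono[OF g(2), of "V1 \<union> V2" E2] fin by auto
  ultimately show gr: "graph_on (V1 \<union> V2) ?E" by (intro graph_on_Un)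
  have E12: "E1 \<inter> E2 = {}"
  proof (intro equals0I)
    fix e assume "e \<in> E1 \<inter> E2"
    thus False using graph_onD[OF g(1), of e] graph_on_subset[OF g(2), of e] disj by auto
  qed
  have "{x1, y1} \<notin> E1 \<union> E2" "{x2, y2} \<notin> E1 \<union> E2"
    using graph_on_subset[OF g(1)] graph_on_subset[OF g(2)] disj x by blast+
  hence "card ?E = card E1 + card E2 + 2"
    using fin E12 ne by (subst card_Un_disjoint) (auto simp: card_Un_disjoint)
  thus "slack ?E (V1 \<union> V2) = 2"
    using slack_all[OF gr] slack_all[OF g(1)] slack_all[OF g(2)] tight_onD(3)[OF t(1)]
      tight_onD(3)[OF t(2)] fin disj by (simp add: card_Un_disjoint)
  fix X assume X: "X \<subseteq> V1 \<union> V2" "X \<noteq> {}"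
  have "ind ?E X \<subseteq> (ind E1 (X \<inter> V1) \<union> ind E2 (X \<inter> V2)) \<union> ind {{x1, y1}, {x2, y2}} X"
    using graph_on_subset[OF g(1)] graph_on_subset[OF g(2)] by (auto simp: ind_def)
  hence "card (ind ?E X)
      \<le> card ((ind E1 (X \<inter> V1) \<union> ind E2 (X \<inter> V2)) \<union> ind {{x1, y1}, {x2, y2}} X)"
    by (intro card_mono) (auto simp: finite_ind fin)
  also have "\<dots> \<le> card (ind E1 (X \<inter> V1)) + card (ind E2 (X \<inter> V2)) + card (ind {{x1, y1}, {x2, y2}} X)"
    by (meson add_le_mono1 card_Un_le order_trans)
  finally have le: "card (ind ?E X) \<le> card (ind E1 (X \<inter> V1)) + card (ind E2 (X \<inter> V2))
      + card (ind {{x1, y1}, {x2, y2}} X)" .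
  have cX: "card X = card (X \<inter> V1) + card (X \<inter> V2)"
    using X fin disj by (subst card_Un_disjoint[symmetric]) (auto intro!: arg_cong[of _ _ card])
  have sl: "slack ?E X \<ge> slack E1 (X \<inter> V1) + slack E2 (X \<inter> V2) - int (card (ind {{x1, y1}, {x2, y2}} X))"
    using le cX by (simp add: slack_def)
  show "2 \<le> slack ?E X"
  proof (cases "X \<inter> V1 = {} \<or> X \<inter> V2 = {}")
    case True
    hence "ind {{x1, y1}, {x2, y2}} X = {}" using x by (auto simp: ind_def)
    moreover have "slack E1 (X \<inter> V1) \<ge> 2 \<and> X \<inter> V2 = {} \<or> slack E2 (X \<inter> V2) \<ge> 2 \<and> X \<inter> V1 = {}"
      using True X tight_onD(2)[OF t(1), of "X \<inter> V1"] tight_onD(2)[OF t(2), of "X \<inter> V2"] by blast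
    ultimately show ?thesis using sl slack_empty[OF g(1)] slack_empty[OF g(2)] by auto
  next
    case False
    have "card (ind {{x1, y1}, {x2, y2}} X) \<le> card {{x1, y1}, {x2, y2}}"
      by (intro card_mono) (auto simp: ind_def)
    also have "\<dots> = 2" using ne by simp
    finally show ?thesis
      using sl False tight_onD(2)[OF t(1), of "X \<inter> V1"] tight_onD(2)[OF t(2), of "X \<inter> V2"] by auto
  qed
qed

text \<open>Shrink the part \<open>P\<close> of \<open>X\<close> inside the new clique to
  \<open>w\<close>. A nonempty \<open>P\<close> has at most four vertices and contributes at least
  the 2 of a single vertex, while the reattached edges inside \<open>X\<close> come from edges
  between \<open>w\<close> and the rest of \<open>X\<close>. So the slack is at least that of the
  shrunken set in the old graph.\<close>

lemma tight_on_K4_expand: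
  assumes t: "tight_on V E" and w: "w \<in> V" and A: "card A = 3" "A \<inter> V = {}"
    and d: "\<And>u. {w, u} \<in> E \<Longrightarrow> d u \<in> insert w A"
  shows "tight_on (V \<union> A) ({e \<in> E. w \<notin> e} \<union> clique (insert w A) \<union> {{d u, u} | u. {w, u} \<in> E})"
    (is "tight_on _ ?E")
proof -
  define K where "K = insert w A"
  define E0 where "E0 = {e \<in> E. w \<notin> e}"
  define V0 where "V0 = V - {w}"
  define N where "N = {u. {w, u} \<in> E}"
  define F where "F = (\<lambda>M. (\<lambda>u. {d u, u}) ` M)"
  note g = tight_onD(1)[OF t]
  have finA: "finite A" using A by (simp add: card_ge_0_finite)
  have fin: "finite V" "finite E" "finite K" "finite E0"
    using graph_on_finite[OF g] finA by (auto simp: K_def E0_def)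
  have "w \<notin> A" using A w by auto
  hence cK: "card K = 4" using A finA by (simp add: K_def)
  have NV: "N \<subseteq> V0" using graph_onD[OF g] by (fastforce simp: N_def V0_def doubleton_eq_iff)
  have finN: "finite N" using NV fin by (auto simp: V0_def intro: finite_subset)
  have g0: "graph_on V0 E0" unfolding graph_on_def
  proof (intro conjI ballI)
    fix e assume "e \<in> E0"
    thus "\<exists>u v. e = {u, v} \<and> u \<noteq> v \<and> u \<in> V0 \<and> v \<in> V0"
      using graph_onD[OF g, of e] by (auto simp: E0_def V0_def)
  qed (use fin in \<open>simp add: V0_def\<close>)
  have KV: "K \<inter> V0 = {}" "V \<union> A = V0 \<union> K" using A w by (auto simp: K_def V0_def)
  have E: "E = E0 \<union> star w N"
  proof (intro equalityI subsetI)
    fix e assume e: "e \<in> E"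
    show "e \<in> E0 \<union> star w N"
    proof (cases "w \<in> e")
      case True
      then obtain x where "e = {w, x}" using graph_onD[OF g e] by (auto simp: insert_commute)
      thus ?thesis using e by (auto simp: star_def N_def)
    qed (use e in \<open>simp add: E0_def\<close>)
  qed (auto simp: E0_def star_def N_def)
  have sl: "slack E (insert w X) = slack E0 X + 2 - int (card (N \<inter> X))" if "X \<subseteq> V0" for X
    unfolding E using slack_star[OF g0 _ NV that] by (simp add: V0_def)
  have dK: "d u \<in> K" if "u \<in> N" for u using d that by (simp add: K_def N_def)
  have H: "?E = E0 \<union> clique K \<union> F N" by (auto simp: E0_def K_def F_def N_def)
  have clK: "e \<subseteq> K \<and> e \<noteq> {}" if "e \<in> clique K" for e using that by (auto simp: clique_def)
  have gr: "graph_on (V \<union> A) ?E" unfolding H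
  proof (intro graph_on_Un)
    show "graph_on (V \<union> A) E0" using graph_on_mono[OF g0, of "V \<union> A" E0] fin finA by (auto simp: V0_def)
    show "graph_on (V \<union> A) (clique K)"
      using graph_on_mono[OF graph_on_clique[OF fin(3)], of "V \<union> A" "clique K"] fin finA
      by (simp add: KV(2) V0_def)
    show "graph_on (V \<union> A) (F N)" unfolding graph_on_def
    proof (intro conjI ballI)
      fix e assume "e \<in> F N"
      then obtain u where u: "u \<in> N" "e = {d u, u}" by (auto simp: F_def)
      have "d u \<noteq> u" "d u \<in> V \<union> A" "u \<in> V \<union> A" using dK[OF u(1)] NV u KV by auto
      thus "\<exists>u v. e = {u, v} \<and> u \<noteq> v \<and> u \<in> V \<union> A \<and> v \<in> V \<union> A" using u by blast
    qed (use fin finA in auto)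
  qed
  have Fx: "card (F N) = card N"
    unfolding F_def using dK NV KV by (intro card_image) (fastforce simp: inj_on_def doubleton_eq_iff)
  have "E0 \<inter> clique K = {}" using clK graph_on_subset[OF g0] KV by blast
  moreover have "(E0 \<union> clique K) \<inter> F N = {}"
  proof (intro equals0I)
    fix e assume e: "e \<in> (E0 \<union> clique K) \<inter> F N"
    then obtain u where u: "u \<in> N" "e = {d u, u}" by (auto simp: F_def)
    hence "d u \<in> e" "u \<in> e" "d u \<in> K" "u \<in> V0" using dK NV by auto
    thus False using e clK graph_on_subset[OF g0] KV by blast
  qed
  moreover have "finite (clique K)" using graph_on_finite[OF graph_on_clique[OF fin(3)]] by simp
  ultimately have cH: "card ?E = card E0 + 6 + card N"
    unfolding H using fin finN Fx cK
    by (subst card_Un_disjoint) (auto simp: F_def card_Un_disjoint card_clique choose_two)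
  have "slack E V = slack E0 V0 + 2 - int (card N)"
    using sl[of V0] w NV by (simp add: V0_def insert_absorb Int_absorb2)
  hence tight: "slack ?E (V \<union> A) = 2"
    using slack_all[OF gr] slack_all[OF g0] cH tight_onD(3)[OF t] KV fin cK
    by (simp add: card_Un_disjoint V0_def Int_commute)
  have "2 \<le> slack ?E X" if X: "X \<subseteq> V \<union> A" "X \<noteq> {}" for X
  proof -
    define X0 where "X0 = X \<inter> V0"
    define P where "P = X \<inter> K"
    \<comment> \<open>The reattached edges inside \<open>X\<close>, recorded by their ends outside
      the clique. A neighbour of \<open>w\<close> in \<open>X0\<close> drops out if its new partner
      in the clique is not in \<open>X\<close>.\<close>
    define M where "M = {u \<in> N \<inter> X0. d u \<in> P}"
    have finX: "finite X0" "finite P" "finite M" using fin finN by (auto simp: X0_def P_def M_def V0_def)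
    have XP: "X = X0 \<union> P" "X0 \<inter> P = {}" using X KV by (auto simp: X0_def P_def)
    have X0V: "X0 \<subseteq> V0" by (auto simp: X0_def)
    have "ind ?E X \<subseteq> ind E0 X0 \<union> clique P \<union> F M"
    proof
      fix e assume "e \<in> ind ?E X"
      hence e: "e \<in> E0 \<union> clique K \<union> F N" "e \<subseteq> X" unfolding H by (auto simp: ind_def)
      from e(1) show "e \<in> ind E0 X0 \<union> clique P \<union> F M"
      proof (elim UnE)
        assume "e \<in> E0" thus ?thesis using e(2) graph_on_subset[OF g0] by (auto simp: ind_def X0_def)
      next
        assume "e \<in> clique K" thus ?thesis using e(2) by (auto simp: clique_def P_def)
      next
        assume "e \<in> F N"
        then obtain u where u: "u \<in> N" "e = {d u, u}" by (auto simp: F_def)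
        hence "u \<in> M" using e(2) dK NV by (auto simp: M_def X0_def P_def)
        thus ?thesis using u by (auto simp: F_def)
      qed
    qed
    moreover have fcl: "finite (clique P)" using graph_on_finite[OF graph_on_clique[OF finX(2)]] by simp
    ultimately have "card (ind ?E X) \<le> card (ind E0 X0 \<union> clique P \<union> F M)"
      using finX fin by (intro card_mono) (auto simp: finite_ind F_def)
    also have "\<dots> \<le> card (ind E0 X0) + card (clique P) + card (F M)"
      by (meson add_le_mono1 card_Un_le order_trans)
    also have "card (F M) \<le> card M" using finX by (auto simp: F_def card_image_le)
    finally have le: "card (ind ?E X) \<le> card (ind E0 X0) + card (clique P) + card M" by simp
    have cX: "card X = card X0 + card P" using XP finX by (simp add: card_Un_disjoint)
    show ?thesis
    proof (cases "P = {}")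
      case True
      hence "M = {}" "clique P = {}" "X = X0" using XP by (auto simp: M_def clique_def)
      hence "slack ?E X \<ge> slack E0 X0" using le by (simp add: slack_def)
      moreover have "slack E0 X0 \<ge> slack E X0" using fin by (intro slack_antimono) (auto simp: E0_def)
      moreover have "slack E X0 \<ge> 2" using X0V \<open>X = X0\<close> X by (intro tight_onD(2)[OF t]) (auto simp: V0_def)
      ultimately show ?thesis by simp
    next
      case False
      have "card P \<le> 4" using cK fin by (metis P_def card_mono inf_le2)
      hence "card (clique P) + 2 \<le> 2 * card P" using False finX by (intro card_clique_le)
      moreover have "card M \<le> card (N \<inter> X0)" using finN by (intro card_mono) (auto simp: M_def)
      moreover have "2 \<le> slack E (insert w X0)" using X0V w by (intro tight_onD(2)[OF t]) (auto simp: V0_def)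
      ultimately show ?thesis using sl[OF X0V] le cX by (simp add: slack_def)
    qed
  qed
  thus ?thesis using gr tight by (simp add: tight_on_def)
qed

text \<open>A K4 has slack 8 - 6 = 2, the same as a single vertex, so contraction preserves slack
  provided no two edges merge into one; \<open>uniq\<close> is that proviso. The contracted vertex
  reuses the name \<open>v\<close>.\<close>

lemma tight_on_K4_contract:
  assumes t: "tight_on V E" and K: "K \<subseteq> V" "card K = 4" "clique K \<subseteq> E" and v: "v \<in> K"
    and uniq: "\<And>u k k'. u \<in> V - K \<Longrightarrow> k \<in> K \<Longrightarrow> k' \<in> K \<Longrightarrow> {k, u} \<in> E \<Longrightarrow> {k', u} \<in> E \<Longrightarrow> k = k'"
  shows "tight_on (insert v (V - K))
    ({e \<in> E. e \<inter> K = {}} \<union> star v {u \<in> V - K. \<exists>k\<in>K. {k, u} \<in> E})"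
proof -
  define E0 where "E0 = {e \<in> E. e \<inter> K = {}}"
  define N where "N = {u \<in> V - K. \<exists>k\<in>K. {k, u} \<in> E}"
  define d where "d = (\<lambda>u. SOME k. k \<in> K \<and> {k, u} \<in> E)"
  note g = tight_onD(1)[OF t]
  have fin: "finite V" "finite E" "finite K" "finite N"
    using graph_on_finite[OF g] K by (auto simp: N_def intro: finite_subset)
  have d: "d u \<in> K \<and> {d u, u} \<in> E" if "u \<in> N" for u
    unfolding d_def using that by (intro someI_ex[of "\<lambda>k. k \<in> K \<and> {k, u} \<in> E"]) (auto simp: N_def)
  have g0: "graph_on (V - K) E0" unfolding graph_on_def
  proof (intro conjI ballI)
    fix e assume "e \<in> E0"
    thus "\<exists>u v. e = {u, v} \<and> u \<noteq> v \<and> u \<in> V - K \<and> v \<in> V - K"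
      using graph_onD[OF g, of e] by (auto simp: E0_def)
  qed (use fin in simp)
  have fcl: "finite (clique K)" using graph_on_finite[OF graph_on_clique[OF fin(3)]] by simp
  \<comment> \<open>The right-hand side is the slack of \<open>insert v X\<close> after
    contraction.\<close>
  have main: "slack E (X \<union> K) = slack E0 X + 2 - int (card (N \<inter> X))" if X: "X \<subseteq> V - K" for X
  proof -
    define F where "F = (\<lambda>u. {d u, u}) ` (N \<inter> X)"
    have "ind E (X \<union> K) = ind E0 X \<union> clique K \<union> F"
    proof (intro equalityI subsetI)
      fix e assume "e \<in> ind E (X \<union> K)"
      hence e: "e \<in> E" "e \<subseteq> X \<union> K" by (auto simp: ind_def)
      obtain p q where pq: "e = {p, q}" "p \<noteq> q" "p \<in> V" "q \<in> V" using graph_onD[OF g e(1)] by blast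
      have cross: "e \<in> F" if "e = {k, u}" "k \<in> K" "u \<notin> K" for k u
      proof -
        have "{k, u} \<in> E" "u \<in> V" using that e graph_on_subset[OF g e(1)] by auto
        hence "u \<in> N \<inter> X" using that e by (auto simp: N_def)
        moreover from this have "d u = k" using uniq[of u "d u" k] d[of u] that e by (auto simp: N_def)
        ultimately show ?thesis using that by (auto simp: F_def)
      qed
      consider "p \<in> K" "q \<in> K" | "p \<in> K" "q \<notin> K" | "q \<in> K" "p \<notin> K" | "p \<notin> K" "q \<notin> K" by blast
      thus "e \<in> ind E0 X \<union> clique K \<union> F"
      proof cases
        case 1 thus ?thesis using pq by (auto simp: clique_def)
      next
        case 2 thus ?thesis using cross pq by blast
      next
        case 3 thus ?thesis using cross[of q p] pq by (auto simp: insert_commute)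
      next
        case 4 thus ?thesis using e pq by (auto simp: ind_def E0_def)
      qed
    next
      fix e assume "e \<in> ind E0 X \<union> clique K \<union> F"
      thus "e \<in> ind E (X \<union> K)" using K d by (auto simp: ind_def E0_def F_def clique_def)
    qed
    moreover have "ind E0 X \<inter> clique K = {}" by (auto simp: ind_def E0_def clique_def)
    moreover have "(ind E0 X \<union> clique K) \<inter> F = {}"
    proof (intro equals0I)
      fix e assume e: "e \<in> (ind E0 X \<union> clique K) \<inter> F"
      then obtain u where u: "u \<in> N" "e = {d u, u}" by (auto simp: F_def)
      hence "d u \<in> K" "u \<notin> K" using d by (auto simp: N_def)
      thus False using e u(2) by (auto simp: ind_def E0_def clique_def doubleton_eq_iff)
    qed
    moreover have "card F = card (N \<inter> X)"
      unfolding F_def using d by (intro card_image) (fastforce simp: inj_on_def doubleton_eq_iff N_def)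
    moreover have "finite E0" "finite F" using fin by (auto simp: E0_def F_def)
    ultimately have "card (ind E (X \<union> K)) = card (ind E0 X) + 6 + card (N \<inter> X)"
      using fin fcl K by (simp add: card_Un_disjoint finite_ind card_clique choose_two)
    moreover have "card (X \<union> K) = card X + 4"
      using X K fin by (subst card_Un_disjoint) (auto intro: finite_subset)
    ultimately show ?thesis by (simp add: slack_def)
  qed
  have "tight_on (insert v (V - K)) (E0 \<union> star v N)"
  proof (rule tight_on_add_vertex[OF g0])
    show "N \<subseteq> V - K" by (auto simp: N_def)
    show "2 \<le> slack E0 X" if "X \<subseteq> V - K" "X \<noteq> {}" for X
    proof -
      have "slack E0 X \<ge> slack E X" using fin by (intro slack_antimono) (auto simp: E0_def)
      moreover have "slack E X \<ge> 2" using that by (intro tight_onD(2)[OF t]) auto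
      ultimately show ?thesis by simp
    qed
    show "int (card (N \<inter> X)) \<le> slack E0 X" if "X \<subseteq> V - K" "X \<noteq> {}" for X
    proof -
      have "slack E (X \<union> K) \<ge> 2" using that K by (intro tight_onD(2)[OF t]) auto
      thus ?thesis using main[OF that(1)] by simp
    qed
    have "V - K \<union> K = V" "N \<inter> (V - K) = N" using K by (auto simp: N_def)
    thus "slack E0 (V - K) = int (card N)"
      using main[of "V - K"] tight_onD(3)[OF t] by simp
  qed (use v in simp)
  thus ?thesis by (simp add: E0_def N_def)
qed

section \<open>The symmetric moves preserve tightness\<close>

text \<open>For an involution without fixed vertices, an edge that meets its image has the form
  \<open>{u, \<theta> u}\<close> and is therefore fixed. Disjointness of each edge from its image
  thus expresses that no edge is fixed.\<close>

definition ci_on :: "nat set \<Rightarrow> nat set set \<Rightarrow> (nat \<Rightarrow> nat) \<Rightarrow> bool" where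
  "ci_on V E \<theta> \<longleftrightarrow> tight_on V E \<and> (\<forall>v\<in>V. \<theta> v \<in> V \<and> \<theta> (\<theta> v) = v \<and> \<theta> v \<noteq> v)
     \<and> (\<forall>e\<in>E. \<theta> ` e \<in> E \<and> \<theta> ` e \<inter> e = {})"

lemma ci_onD:
  assumes "ci_on V E \<theta>"
  shows "tight_on V E" "graph_on V E" "finite V" "finite E"
    "v \<in> V \<Longrightarrow> \<theta> v \<in> V" "v \<in> V \<Longrightarrow> \<theta> (\<theta> v) = v" "v \<in> V \<Longrightarrow> \<theta> v \<noteq> v"
    "e \<in> E \<Longrightarrow> \<theta> ` e \<in> E" "e \<in> E \<Longrightarrow> \<theta> ` e \<inter> e = {}"
    "e \<in> E \<Longrightarrow> e \<subseteq> V"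
proof -
  show "tight_on V E" using assms by (simp add: ci_on_def)
  from tight_onD(1)[OF this] show g: "graph_on V E" .
  show "finite V" "finite E" using graph_on_finite[OF g] by auto
  show "e \<in> E \<Longrightarrow> e \<subseteq> V" using graph_on_subset[OF g] .
qed (use assms in \<open>auto simp: ci_on_def\<close>)

lemma ci_on_edgeD:
  assumes "ci_on V E \<theta>" "{u, v} \<in> E"
  shows "{\<theta> u, \<theta> v} \<in> E" "u \<in> V" "v \<in> V" "u \<noteq> v" "\<theta> u \<noteq> v" "\<theta> v \<noteq> u"
  using ci_onD(8,9,10)[OF assms] graph_onD[OF ci_onD(2)[OF assms(1)] assms(2)]
  by (auto simp: doubleton_eq_iff)

lemma image_image_invol:
  assumes "\<And>v. v \<in> V \<Longrightarrow> \<theta> (\<theta> v) = v" "e \<subseteq> V" shows "\<theta> ` \<theta> ` e = (e :: nat set)"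
  using assms by (force simp: image_image)

lemma ci_on_iff:
  "ci_on (verts G) (edges G) (invol G) \<longleftrightarrow> z2_graph G \<and> ci_tight G"
proof
  assume ci: "ci_on (verts G) (edges G) (invol G)"
  note D = ci_onD[OF ci]
  have "z2_graph G" unfolding z2_graph_def
    using D(3,5,6) graph_onD[OF D(2)] ci_on_edgeD(1)[OF ci] by blast
  moreover have "ci_tight G" unfolding ci_tight_def
    using D(1,7) tight22_iff[OF D(2)] ci_on_edgeD(2,5)[OF ci] by (auto simp: doubleton_eq_iff)
  ultimately show "z2_graph G \<and> ci_tight G" by simp
next
  assume G: "z2_graph G \<and> ci_tight G"
  hence g: "graph_on (verts G) (edges G)" by (simp add: z2_graph_on)
  have t: "tight_on (verts G) (edges G)" using G tight22_iff[OF g] by (simp add: ci_tight_def)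
  have inv: "\<forall>v\<in>verts G. invol G v \<in> verts G \<and> invol G (invol G v) = v \<and> invol G v \<noteq> v"
    using G by (auto simp: z2_graph_def ci_tight_def)
  have "invol G ` e \<in> edges G \<and> invol G ` e \<inter> e = {}" if e: "e \<in> edges G" for e
  proof -
    obtain u v where uv: "e = {u, v}" "u \<in> verts G" "v \<in> verts G" using graph_onD[OF g e] by blast
    have "{invol G u, invol G v} \<in> edges G" "{invol G u, invol G v} \<noteq> {u, v}"
      using G e uv by (auto simp: z2_graph_def ci_tight_def)
    thus ?thesis using uv inv by (auto simp: doubleton_eq_iff)
  qed
  thus "ci_on (verts G) (edges G) (invol G)" using t inv by (simp add: ci_on_def)
qed

text \<open>Two ordinary 0-extensions, at \<open>a\<close>, \<open>b\<close> and at their images. On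
  old edges the updated map agrees with \<open>\<theta>\<close>, because \<open>v\<close> and
  \<open>v'\<close> lie outside \<open>V\<close>; only the four new edges have to be
  inspected.\<close>

lemma ci_on_ext0:
  assumes ci: "ci_on V E \<theta>" and v: "v \<notin> V" "v' \<notin> V" "v \<noteq> v'" and ab: "a \<in> V" "b \<in> V" "a \<noteq> b"
  shows "ci_on (V \<union> {v, v'}) (E \<union> {{v, a}, {v, b}, {v', \<theta> a}, {v', \<theta> b}}) (\<theta>(v := v', v' := v))"
    (is "ci_on ?V ?E ?t")
  unfolding ci_on_def
proof (intro conjI)
  note D = ci_onD[OF ci]
  have ab': "\<theta> a \<in> V" "\<theta> b \<in> V" "\<theta> a \<noteq> \<theta> b" using D(5,6) ab by metis+
  have "tight_on (insert v' (insert v V)) (E \<union> star v {a, b} \<union> star v' {\<theta> a, \<theta> b})"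
    using tight_on_ext0[OF tight_on_ext0[OF D(1) v(1) ab], of v' "\<theta> a" "\<theta> b"] v ab' by auto
  moreover have "insert v' (insert v V) = ?V" "E \<union> star v {a, b} \<union> star v' {\<theta> a, \<theta> b} = ?E"
    by (auto simp: star_def)
  ultimately show "tight_on ?V ?E" by simp
  show "\<forall>x\<in>?V. ?t x \<in> ?V \<and> ?t (?t x) = x \<and> ?t x \<noteq> x" using D(5,6,7) v by auto
  show "\<forall>e\<in>?E. ?t ` e \<in> ?E \<and> ?t ` e \<inter> e = {}"
  proof
    fix e assume e: "e \<in> ?E"
    show "?t ` e \<in> ?E \<and> ?t ` e \<inter> e = {}"
    proof (cases "e \<in> E")
      case True
      hence "?t ` e = \<theta> ` e" using D(10)[OF True] v by (intro image_cong) auto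
      thus ?thesis using D(8,9)[OF True] by auto
    next
      case False
      hence "e \<in> {{v, a}, {v, b}, {v', \<theta> a}, {v', \<theta> b}}" using e by (metis UnE)
      moreover have "v \<noteq> a" "v \<noteq> b" "v' \<noteq> a" "v' \<noteq> b" "v \<noteq> \<theta> a" "v \<noteq> \<theta> b" "v' \<noteq> \<theta> a" "v' \<noteq> \<theta> b"
        using v ab ab' by auto
      ultimately show ?thesis using D(6,7)[OF ab(1)] D(6,7)[OF ab(2)] v by (elim insertE) auto
    qed
  qed
qed

text \<open>Merges two consecutive edge replacements into one simultaneous replacement. The second
  deleted edge must not be among those just added.\<close>

lemma replace_two:
  "q \<notin> {x, y, z} \<Longrightarrow> A - {p} \<union> {x, y, z} - {q} \<union> {x', y', z'} = A - {p, q} \<union> {x, y, z, x', y', z'}"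
  by auto

lemma ci_on_ext1:
  assumes ci: "ci_on V E \<theta>" and v: "v \<notin> V" "v' \<notin> V" "v \<noteq> v'"
    and ab: "{a, b} \<in> E" and c: "c \<in> V" "c \<notin> {a, b}"
  shows "ci_on (V \<union> {v, v'}) ((E - {{a, b}, {\<theta> a, \<theta> b}})
    \<union> {{v, a}, {v, b}, {v, c}, {v', \<theta> a}, {v', \<theta> b}, {v', \<theta> c}}) (\<theta>(v := v', v' := v))"
    (is "ci_on ?V (?E0 \<union> ?N) ?t")
  unfolding ci_on_def
proof (intro conjI)
  note D = ci_onD[OF ci]
  note ab2 = ci_on_edgeD[OF ci ab]
  have V': "\<theta> a \<in> V" "\<theta> b \<in> V" "\<theta> c \<in> V" "\<theta> c \<notin> {\<theta> a, \<theta> b}" using D(5,6) ab2 c by (auto, metis+)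
  \<comment> \<open>The image edge has to survive the first 1-extension, because the second one is
    performed on it.\<close>
  have ne: "{a, b} \<noteq> {\<theta> a, \<theta> b}" using ab2 D(7)[of a] by (auto simp: doubleton_eq_iff)
  have "tight_on (insert v' (insert v V))
      (E - {{a, b}} \<union> star v {a, b, c} - {{\<theta> a, \<theta> b}} \<union> star v' {\<theta> a, \<theta> b, \<theta> c})"
    using tight_on_ext1[OF tight_on_ext1[OF D(1) v(1) ab c], of v' "\<theta> a" "\<theta> b" "\<theta> c"] v ab2 V' ne by auto
  moreover have "insert v' (insert v V) = ?V" by auto
  moreover have st: "star x {p, q, r} = {{x, p}, {x, q}, {x, r}}" for x p q r by (auto simp: star_def)
  have "{\<theta> a, \<theta> b} \<notin> {{v, a}, {v, b}, {v, c}}" using v V' by (auto simp: doubleton_eq_iff)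
  hence "E - {{a, b}} \<union> star v {a, b, c} - {{\<theta> a, \<theta> b}} \<union> star v' {\<theta> a, \<theta> b, \<theta> c} = ?E0 \<union> ?N"
    unfolding st by (rule replace_two)
  ultimately show "tight_on ?V (?E0 \<union> ?N)" by simp
  show "\<forall>x\<in>?V. ?t x \<in> ?V \<and> ?t (?t x) = x \<and> ?t x \<noteq> x" using D(5,6,7) v by auto
  show "\<forall>e\<in>?E0 \<union> ?N. ?t ` e \<in> ?E0 \<union> ?N \<and> ?t ` e \<inter> e = {}"
  proof
    fix e assume e: "e \<in> ?E0 \<union> ?N"
    show "?t ` e \<in> ?E0 \<union> ?N \<and> ?t ` e \<inter> e = {}"
    proof (cases "e \<in> E - {{a, b}, {\<theta> a, \<theta> b}}")
      case True
      hence eE: "e \<in> E" by simp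
      have te: "?t ` e = \<theta> ` e" using D(10)[OF eE] v by (intro image_cong) auto
      have "\<theta> ` \<theta> ` e = e" using D(6) D(10)[OF eE] by (rule image_image_invol)
      hence "\<theta> ` e \<notin> {{a, b}, {\<theta> a, \<theta> b}}" using True D(6)[OF ab2(2)] D(6)[OF ab2(3)] by auto
      thus ?thesis using te D(8,9)[OF eE] by auto
    next
      case False
      then obtain x where x: "x \<in> {a, b, c}" "e = {v, x} \<or> e = {v', \<theta> x}" using e by blast
      hence "x \<in> V" using ab2 c by auto
      hence x': "x \<noteq> v" "x \<noteq> v'" "\<theta> x \<noteq> v" "\<theta> x \<noteq> v'" "\<theta> (\<theta> x) = x" "\<theta> x \<noteq> x"
        using v D(5,6,7) by auto
      hence "?t v = v'" "?t v' = v" "?t x = \<theta> x" "?t (\<theta> x) = x" using v(3) by simp_all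
      hence "?t ` e = {v', \<theta> x} \<and> e = {v, x} \<or> ?t ` e = {v, x} \<and> e = {v', \<theta> x}"
        using x(2) by (auto simp del: fun_upd_apply)
      moreover have "{v', \<theta> x} \<inter> {v, x} = {}" using x' v(3) by auto
      moreover have "{v, x} \<in> ?N \<and> {v', \<theta> x} \<in> ?N" using x(1) by (elim insertE emptyE) simp_all
      ultimately show ?thesis by (metis Int_commute UnI2)
    qed
  qed
qed

lemma image_star: "t ` e \<in> star (t v) (t ` N)" if "e \<in> star v N"
  using that by (auto simp: star_def)

lemma ci_on_C4:
  assumes ci: "ci_on V E \<theta>" and v: "u \<notin> V" "u' \<notin> V" "u \<noteq> u'"
    and v12: "{w, v1} \<in> E" "{w, v2} \<in> E" "v1 \<noteq> v2"
    and S: "star w S \<subseteq> E" "S \<inter> {v1, v2} = {}"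
  shows "ci_on (V \<union> {u, u'}) (E - star w S - star (\<theta> w) (\<theta> ` S)
    \<union> star u (S \<union> {v1, v2}) \<union> star u' (\<theta> ` (S \<union> {v1, v2}))) (\<theta>(u := u', u' := u))"
    (is "ci_on ?V ?E ?t")
  unfolding ci_on_def
proof (intro conjI)
  note D = ci_onD[OF ci]
  define N where "N = S \<union> {v1, v2}"
  have N: "x \<in> V \<and> \<theta> x \<in> V \<and> {w, x} \<in> E" if "x \<in> N" for x
  proof -
    have "{w, x} \<in> E" using that S v12 by (auto simp: N_def star_def)
    thus ?thesis using ci_on_edgeD[OF ci] D(5) by blast
  qed
  have w: "w \<in> V" "\<theta> w \<in> V" using ci_on_edgeD(2)[OF ci v12(1)] D(5) by auto
  \<comment> \<open>An edge in both stars would join \<open>w\<close> to its image and be fixed. So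
    moving edges away from \<open>w\<close> leaves those at \<open>\<theta> w\<close> in place for
    the second move.\<close>
  have disj: "star w M \<inter> star (\<theta> w) (\<theta> ` M') = {}" if "M \<subseteq> N" "M' \<subseteq> N" for M M'
  proof (intro equals0I)
    fix e assume "e \<in> star w M \<inter> star (\<theta> w) (\<theta> ` M')"
    hence "\<theta> w \<in> e" "\<exists>x\<in>N. e = {w, x}" using that(1) by (auto simp: star_def)
    then obtain x where x: "e = {w, x}" "\<theta> w \<in> e" "x \<in> N" by blast
    hence "\<theta> w = x" using D(7)[OF w(1)] by auto
    thus False using ci_on_edgeD(5)[OF ci, of w x] N[OF x(3)] by simp
  qed
  have img: "star (\<theta> w) (\<theta> ` N) \<subseteq> E"
    using N ci_on_edgeD(1)[OF ci] by (auto simp: star_def)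
  have star_N: "{\<theta> w, \<theta> v1} \<in> star (\<theta> w) (\<theta> ` N)" "{\<theta> w, \<theta> v2} \<in> star (\<theta> w) (\<theta> ` N)"
    "star (\<theta> w) (\<theta> ` S) \<subseteq> star (\<theta> w) (\<theta> ` N)" "S \<subseteq> N" "N \<subseteq> N"
    by (auto simp: star_def N_def)
  have "tight_on (insert u' (insert u V))
    (E - star w S \<union> star u (S \<union> {v1, v2}) - star (\<theta> w) (\<theta> ` S) \<union> star u' (\<theta> ` S \<union> {\<theta> v1, \<theta> v2}))"
  proof (rule tight_on_C4)
    show "tight_on (insert u V) (E - star w S \<union> star u (S \<union> {v1, v2}))"
      using D(1) v(1) v12 S by (rule tight_on_C4)
    show "{\<theta> w, \<theta> v1} \<in> E - star w S \<union> star u (S \<union> {v1, v2})"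
      "{\<theta> w, \<theta> v2} \<in> E - star w S \<union> star u (S \<union> {v1, v2})"
      "star (\<theta> w) (\<theta> ` S) \<subseteq> E - star w S \<union> star u (S \<union> {v1, v2})"
      using img disj[of S N] star_N by auto
    show "\<theta> v1 \<noteq> \<theta> v2" using v12 N D(6) by (metis N_def UnI2 insertI1 insertI2)
    show "\<theta> ` S \<inter> {\<theta> v1, \<theta> v2} = {}"
    proof (intro equals0I)
      fix y assume "y \<in> \<theta> ` S \<inter> {\<theta> v1, \<theta> v2}"
      then obtain x z where "x \<in> S" "z \<in> {v1, v2}" "\<theta> x = \<theta> z" by auto
      hence "x = z" using N D(6) by (metis N_def UnI1 UnI2)
      thus False using S \<open>x \<in> S\<close> \<open>z \<in> {v1, v2}\<close> by blast
    qed
  qed (use v in auto)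
  moreover have "insert u' (insert u V) = ?V" by auto
  moreover have "star u (S \<union> {v1, v2}) \<inter> star (\<theta> w) (\<theta> ` S) = {}"
    using v w N by (auto simp: star_def N_def doubleton_eq_iff)
  hence "E - star w S \<union> star u (S \<union> {v1, v2}) - star (\<theta> w) (\<theta> ` S) \<union> star u' (\<theta> ` S \<union> {\<theta> v1, \<theta> v2}) = ?E"
    by (simp add: image_Un) blast
  ultimately show "tight_on ?V ?E" by simp
  show "\<forall>x\<in>?V. ?t x \<in> ?V \<and> ?t (?t x) = x \<and> ?t x \<noteq> x" using D(5,6,7) v by auto
  have E: "?E = E - star w S - star (\<theta> w) (\<theta> ` S) \<union> star u N \<union> star u' (\<theta> ` N)"
    by (simp add: N_def)
  have tt: "\<theta> ` \<theta> ` S = S" using D(6) N by (force simp: image_image N_def)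
  show "\<forall>e\<in>?E. ?t ` e \<in> ?E \<and> ?t ` e \<inter> e = {}" unfolding E
  proof
    fix e assume e: "e \<in> E - star w S - star (\<theta> w) (\<theta> ` S) \<union> star u N \<union> star u' (\<theta> ` N)"
    show "?t ` e \<in> E - star w S - star (\<theta> w) (\<theta> ` S) \<union> star u N \<union> star u' (\<theta> ` N) \<and> ?t ` e \<inter> e = {}"
    proof (cases "e \<in> E - star w S - star (\<theta> w) (\<theta> ` S)")
      case True
      hence eE: "e \<in> E" by simp
      have te: "?t ` e = \<theta> ` e" using D(10)[OF eE] v by (intro image_cong) auto
      have "\<theta> ` \<theta> ` e = e" using D(6) D(10)[OF eE] by (rule image_image_invol)
      hence "\<theta> ` e \<notin> star w S \<union> star (\<theta> w) (\<theta> ` S)"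
        using image_star[of "\<theta> ` e" w S \<theta>] image_star[of "\<theta> ` e" "\<theta> w" "\<theta> ` S" \<theta>] True tt D(6)[OF w(1)]
        by auto
      thus ?thesis using te D(8,9)[OF eE] by auto
    next
      case False
      then obtain x where x: "x \<in> N" "e = {u, x} \<or> e = {u', \<theta> x}" using e by (auto simp: star_def)
      have "x \<noteq> u" "x \<noteq> u'" "\<theta> x \<noteq> u" "\<theta> x \<noteq> u'" "\<theta> (\<theta> x) = x" "\<theta> x \<noteq> x" using N[OF x(1)] v D(6,7) by auto
      moreover from this have "?t u = u'" "?t u' = u" "?t x = \<theta> x" "?t (\<theta> x) = x" using v(3) by simp_all
      hence "?t ` e = {u', \<theta> x} \<and> e = {u, x} \<or> ?t ` e = {u, x} \<and> e = {u', \<theta> x}"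
        using x(2) by (auto simp del: fun_upd_apply)
      moreover have "{u', \<theta> x} \<inter> {u, x} = {}" using calculation(1-6) v(3) by auto
      moreover have "{u, x} \<in> star u N" "{u', \<theta> x} \<in> star u' (\<theta> ` N)" using x(1) by (auto simp: star_def)
      ultimately show ?thesis by (metis Int_commute UnI1 UnI2)
    qed
  qed
qed

text \<open>As \<open>w\<close> and its image are not adjacent, expanding at \<open>w\<close> does
  not change the neighbours of \<open>\<theta> w\<close>, and the second expansion can follow. Its
  choice function is \<open>d\<close> conjugated by the involution:
  \<open>t (d (\<theta> u))\<close>.\<close>

lemma ci_on_K4:
  assumes ci: "ci_on V E \<theta>" and w: "w \<in> V" and dis: "distinct [a, b, c, a', b', c']"
    and new: "{a, b, c, a', b', c'} \<inter> V = {}"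
    and d: "\<And>u. {w, u} \<in> E \<Longrightarrow> d u \<in> {w, a, b, c}"
    and t: "t = \<theta>(a := a', b := b', c := c', a' := a, b' := b, c' := c)"
  shows "ci_on (V \<union> {a, b, c, a', b', c'})
    ({e \<in> E. w \<notin> e \<and> \<theta> w \<notin> e} \<union> clique {w, a, b, c} \<union> clique {\<theta> w, a', b', c'}
       \<union> {{d u, u} | u. {w, u} \<in> E} \<union> {{t (d u), \<theta> u} | u. {w, u} \<in> E}) t"
    (is "ci_on ?V ?E t")
  unfolding ci_on_def
proof (intro conjI)
  note D = ci_onD[OF ci]
  define K where "K = {w, a, b, c}"
  define K' where "K' = {\<theta> w, a', b', c'}"
  define F where "F = {{d u, u} | u. {w, u} \<in> E}"
  define F' where "F' = {{t (d u), \<theta> u} | u. {w, u} \<in> E}"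
  define E1 where "E1 = {e \<in> E. w \<notin> e} \<union> clique K \<union> F"
  have w': "\<theta> w \<in> V" "\<theta> (\<theta> w) = w" "\<theta> w \<noteq> w" using D(5,6,7) w by auto
  have wt: "w \<notin> {a, b, c, a', b', c'}" "\<theta> w \<notin> {a, b, c, a', b', c'}" using new w w' by auto
  have tV: "t x = \<theta> x" if "x \<in> V" for x using that new by (auto simp: t)
  have ta: "t a = a'" "t b = b'" "t c = c'" "t a' = a" "t b' = b" "t c' = c" using dis by (auto simp: t)
  have tinv: "\<forall>x\<in>?V. t x \<in> ?V \<and> t (t x) = x \<and> t x \<noteq> x"
    using tV ta D(5,6,7) dis by auto
  thus "\<forall>x\<in>?V. t x \<in> ?V \<and> t (t x) = x \<and> t x \<noteq> x" .
  have tK: "t ` K = K'" "t ` K' = K" using ta tV[OF w] tV[OF w'(1)] w'(2) by (auto simp: K_def K'_def)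
  have KK': "K \<inter> K' = {}" using wt dis w'(3) by (auto simp: K_def K'_def)
  have KV: "K \<subseteq> ?V" "K' \<subseteq> ?V" using w w' by (auto simp: K_def K'_def)
  have edge: "u \<in> V" "\<theta> u \<in> V" "d u \<in> K" "t (d u) \<in> K'" "u \<notin> K" "u \<notin> K'" "\<theta> u \<notin> K" "\<theta> u \<notin> K'"
    "{\<theta> w, \<theta> u} \<in> E" if "{w, u} \<in> E" for u
  proof -
    note ed = ci_on_edgeD[OF ci that]
    show "u \<in> V" "\<theta> u \<in> V" using ed D(5) by auto
    show "d u \<in> K" using d[OF that] by (simp add: K_def)
    thus "t (d u) \<in> K'" using tK by blast
    have "u \<notin> {a, b, c, a', b', c'}" "\<theta> u \<notin> {a, b, c, a', b', c'}" using new \<open>u \<in> V\<close> \<open>\<theta> u \<in> V\<close> by auto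
    moreover have "\<theta> u \<noteq> \<theta> w" using ed(4) D(6)[OF w] D(6)[OF ed(3)] by metis
    ultimately show "u \<notin> K" "u \<notin> K'" "\<theta> u \<notin> K" "\<theta> u \<notin> K'"
      using ed by (auto simp: K_def K'_def)
    show "{\<theta> w, \<theta> u} \<in> E" using ed by simp
  qed
  have E: "?E = {e \<in> E. w \<notin> e \<and> \<theta> w \<notin> e} \<union> clique K \<union> clique K' \<union> F \<union> F'"
    by (simp add: K_def K'_def F_def F'_def)
  have N1: "{\<theta> w, u} \<in> E1 \<longleftrightarrow> {\<theta> w, u} \<in> E" for u
  proof
    assume "{\<theta> w, u} \<in> E1"
    moreover have "{\<theta> w, u} \<notin> clique K" using KK' by (auto simp: clique_def K'_def doubleton_eq_iff)
    moreover have "{\<theta> w, u} \<notin> F"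
    proof
      assume "{\<theta> w, u} \<in> F"
      then obtain x where x: "{\<theta> w, u} = {d x, x}" "{w, x} \<in> E" by (auto simp: F_def)
      hence "\<theta> w \<in> {d x, x}" by blast
      moreover have "\<theta> w \<in> K'" by (simp add: K'_def)
      ultimately show False using edge(3,6)[OF x(2)] KK' by auto
    qed
    ultimately show "{\<theta> w, u} \<in> E" by (auto simp: E1_def)
  next
    assume u: "{\<theta> w, u} \<in> E"
    have "w \<noteq> u" using ci_on_edgeD(5)[OF ci u] w' by auto
    thus "{\<theta> w, u} \<in> E1" using u w' by (auto simp: E1_def)
  qed
  have N2: "{\<theta> w, u} \<in> E \<Longrightarrow> {w, \<theta> u} \<in> E \<and> \<theta> (\<theta> u) = u" for u
    using ci_on_edgeD(1,3)[OF ci, of "\<theta> w" u] w' D(6) by auto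
  have t1: "tight_on (V \<union> {a, b, c}) E1"
    unfolding E1_def F_def K_def using tight_on_K4_expand[OF D(1) w, of "{a, b, c}" d] dis new d by auto
  have t2: "tight_on (V \<union> {a, b, c} \<union> {a', b', c'})
    ({e \<in> E1. \<theta> w \<notin> e} \<union> clique (insert (\<theta> w) {a', b', c'}) \<union> {{t (d (\<theta> u)), u} | u. {\<theta> w, u} \<in> E1})"
  proof (rule tight_on_K4_expand[OF t1])
    show "t (d (\<theta> u)) \<in> insert (\<theta> w) {a', b', c'}" if "{\<theta> w, u} \<in> E1" for u
      using edge(4)[of "\<theta> u"] N2[of u] that N1 by (simp add: K'_def)
  qed (use w' dis new in auto)
  \<comment> \<open>Reindexing by the involution, which carries the neighbours of
    \<open>\<theta> w\<close> to those of \<open>w\<close>.\<close>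
  have "{{t (d (\<theta> u)), u} | u. {\<theta> w, u} \<in> E1} = F'"
  proof (intro equalityI subsetI)
    fix e assume "e \<in> {{t (d (\<theta> u)), u} | u. {\<theta> w, u} \<in> E1}"
    then obtain u where "e = {t (d (\<theta> u)), u}" "{\<theta> w, u} \<in> E" using N1 by auto
    thus "e \<in> F'" using N2[of u] unfolding F'_def by (intro CollectI exI[of _ "\<theta> u"]) auto
  next
    fix e assume "e \<in> F'"
    then obtain u where u: "e = {t (d u), \<theta> u}" "{w, u} \<in> E" by (auto simp: F'_def)
    moreover have "{\<theta> w, \<theta> u} \<in> E1" using N1 edge u by auto
    moreover have "\<theta> (\<theta> u) = u" using D(6) edge u by auto
    ultimately show "e \<in> {{t (d (\<theta> u)), u} | u. {\<theta> w, u} \<in> E1}"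
      by (intro CollectI exI[of _ "\<theta> u"]) auto
  qed
  moreover have "{e \<in> E1. \<theta> w \<notin> e} = {e \<in> E. w \<notin> e \<and> \<theta> w \<notin> e} \<union> clique K \<union> F"
  proof -
    have "\<theta> w \<notin> e" if "e \<in> clique K" for e using that KK' by (auto simp: clique_def K'_def)
    moreover have "\<theta> w \<notin> e" if "e \<in> F" for e
      using that edge KK' by (fastforce simp: F_def K'_def)
    ultimately show ?thesis by (auto simp: E1_def)
  qed
  moreover have "V \<union> {a, b, c} \<union> {a', b', c'} = ?V" by auto
  moreover have "insert (\<theta> w) {a', b', c'} = K'" by (simp add: K'_def)
  ultimately have "tight_on ?V (({e \<in> E. w \<notin> e \<and> \<theta> w \<notin> e} \<union> clique K \<union> F) \<union> clique K' \<union> F')" using t2 by simp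
  moreover have "({e \<in> E. w \<notin> e \<and> \<theta> w \<notin> e} \<union> clique K \<union> F) \<union> clique K' \<union> F' = ?E" unfolding E by blast
  ultimately show "tight_on ?V ?E" by simp
  show "\<forall>e\<in>?E. t ` e \<in> ?E \<and> t ` e \<inter> e = {}" unfolding E
  proof
    fix e assume e: "e \<in> {e \<in> E. w \<notin> e \<and> \<theta> w \<notin> e} \<union> clique K \<union> clique K' \<union> F \<union> F'"
    let ?E' = "{e \<in> E. w \<notin> e \<and> \<theta> w \<notin> e} \<union> clique K \<union> clique K' \<union> F \<union> F'"
    from e show "t ` e \<in> ?E' \<and> t ` e \<inter> e = {}"
    proof (elim UnE)
      assume "e \<in> {e \<in> E. w \<notin> e \<and> \<theta> w \<notin> e}"
      hence eE: "e \<in> E" "w \<notin> e" "\<theta> w \<notin> e" by auto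
      have te: "t ` e = \<theta> ` e" using D(10)[OF eE(1)] tV by (intro image_cong) auto
      have "\<theta> ` \<theta> ` e = e" using D(6) D(10)[OF eE(1)] by (rule image_image_invol)
      hence "w \<notin> \<theta> ` e" "\<theta> w \<notin> \<theta> ` e" using eE w'(2) by (metis imageI)+
      thus ?thesis using te D(8,9)[OF eE(1)] by auto
    next
      assume "e \<in> clique K"
      then obtain x y where xy: "e = {x, y}" "x \<in> K" "y \<in> K" "x \<noteq> y" by (auto simp: clique_def)
      hence "t x \<in> K'" "t y \<in> K'" "t x \<noteq> t y" using tK tinv KV by (blast, blast, metis subsetD)
      thus ?thesis using xy KK' by (auto simp: clique_def)
    next
      assume "e \<in> clique K'"
      then obtain x y where xy: "e = {x, y}" "x \<in> K'" "y \<in> K'" "x \<noteq> y" by (auto simp: clique_def)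
      hence "t x \<in> K" "t y \<in> K" "t x \<noteq> t y" using tK tinv KV by (blast, blast, metis subsetD)
      thus ?thesis using xy KK' by (auto simp: clique_def)
    next
      assume "e \<in> F"
      then obtain u where u: "e = {d u, u}" "{w, u} \<in> E" by (auto simp: F_def)
      note ed = edge[OF u(2)]
      have "t ` e = {t (d u), \<theta> u}" using u tV[OF ed(1)] by simp
      moreover have "t (d u) \<noteq> d u" "t (d u) \<noteq> u" "\<theta> u \<noteq> d u" "\<theta> u \<noteq> u"
        using ed(3,4,5,6,7,8) D(7)[OF ed(1)] KK' by (metis IntI empty_iff)+
      ultimately show ?thesis using u by (auto simp: F'_def)
    next
      assume "e \<in> F'"
      then obtain u where u: "e = {t (d u), \<theta> u}" "{w, u} \<in> E" by (auto simp: F'_def)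
      note ed = edge[OF u(2)]
      have "t (t (d u)) = d u" using tinv ed KV by blast
      moreover have "t (\<theta> u) = u" using tV[OF ed(2)] D(6)[OF ed(1)] by simp
      ultimately have "t ` e = {d u, u}" using u by simp
      moreover have "t (d u) \<noteq> d u" "t (d u) \<noteq> u" "\<theta> u \<noteq> d u" "\<theta> u \<noteq> u"
        using ed(3,4,5,6,7,8) D(7)[OF ed(1)] KK' by (metis IntI empty_iff)+
      ultimately show ?thesis using u by (auto simp: F_def)
    qed
  qed
qed

text \<open>\<open>t\<close> is prescribed only on the two vertex sets, so that the piecewise
  involution of \<open>sym_join\<close> fits.\<close>

lemma ci_on_join:
  assumes ci: "ci_on V1 E1 \<theta>1" "ci_on V2 E2 \<theta>2" and disj: "V1 \<inter> V2 = {}" and xy: "x \<in> V1" "y \<in> V2"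
    and t1: "\<And>v. v \<in> V1 \<Longrightarrow> t v = \<theta>1 v" and t2: "\<And>v. v \<in> V2 \<Longrightarrow> t v = \<theta>2 v"
  shows "ci_on (V1 \<union> V2) (E1 \<union> E2 \<union> {{x, y}, {\<theta>1 x, \<theta>2 y}}) t" (is "ci_on ?V ?E t")
  unfolding ci_on_def
proof (intro conjI)
  note D1 = ci_onD[OF ci(1)] and D2 = ci_onD[OF ci(2)]
  have x': "\<theta>1 x \<in> V1" "\<theta>2 y \<in> V2" "\<theta>1 x \<noteq> x" "\<theta>2 y \<noteq> y" "\<theta>1 (\<theta>1 x) = x" "\<theta>2 (\<theta>2 y) = y"
    using D1(5,6,7) D2(5,6,7) xy by auto
  have ne: "x \<noteq> y" "\<theta>1 x \<noteq> y" "x \<noteq> \<theta>2 y" "\<theta>1 x \<noteq> \<theta>2 y" using xy x' disj by auto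
  show "tight_on ?V ?E"
    using D1(1) D2(1) disj xy(1) x'(1) xy(2) x'(2)
    by (rule tight_on_join) (use ne x' in \<open>auto simp: doubleton_eq_iff\<close>)
  show "\<forall>v\<in>?V. t v \<in> ?V \<and> t (t v) = v \<and> t v \<noteq> v"
    using t1 t2 D1(5,6,7) D2(5,6,7) by auto
  show "\<forall>e\<in>?E. t ` e \<in> ?E \<and> t ` e \<inter> e = {}"
  proof
    fix e assume "e \<in> ?E"
    then consider "e \<in> E1" | "e \<in> E2" | "e = {x, y} \<or> e = {\<theta>1 x, \<theta>2 y}" by blast
    thus "t ` e \<in> ?E \<and> t ` e \<inter> e = {}"
    proof cases
      case 1
      hence "t ` e = \<theta>1 ` e" using D1(10)[OF 1] t1 by (intro image_cong) auto
      thus ?thesis using D1(8,9)[OF 1] by auto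
    next
      case 2
      hence "t ` e = \<theta>2 ` e" using D2(10)[OF 2] t2 by (intro image_cong) auto
      thus ?thesis using D2(8,9)[OF 2] by auto
    next
      case 3
      have "t x = \<theta>1 x" "t y = \<theta>2 y" "t (\<theta>1 x) = x" "t (\<theta>2 y) = y" using t1 t2 xy x' by auto
      thus ?thesis using 3 ne x' by (elim disjE) auto
    qed
  qed
qed

text \<open>\<open>edge\<close> compares only pairs of vertices; with \<open>g\<close> excluding
  other members of \<open>E'\<close>, the edge set \<open>E'\<close> is exactly the image of
  \<open>E\<close>, and slacks are carried over by the bijection.\<close>

lemma ci_on_iso:
  assumes ci: "ci_on V E \<theta>" and g: "graph_on V' E'" and bij: "bij_betw f V V'"
    and edge: "\<And>u v. u \<in> V \<Longrightarrow> v \<in> V \<Longrightarrow> {u, v} \<in> E \<longleftrightarrow> {f u, f v} \<in> E'"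
    and inv: "\<And>v. v \<in> V \<Longrightarrow> f (\<theta> v) = \<theta>' (f v)"
  shows "ci_on V' E' \<theta>'"
  unfolding ci_on_def
proof (intro conjI)
  note D = ci_onD[OF ci]
  have fV: "f ` V = V'" and inj: "inj_on f V" using bij by (auto simp: bij_betw_def)
  have E': "E' = (\<lambda>e. f ` e) ` E"
  proof (intro equalityI subsetI)
    fix e assume e: "e \<in> E'"
    then obtain u v where "e = {u, v}" "u \<in> V'" "v \<in> V'" using graph_onD[OF g] by blast
    then obtain p q where "p \<in> V" "q \<in> V" "e = f ` {p, q}" using fV by auto
    moreover from this have "{p, q} \<in> E" using edge[of p q] e by auto
    ultimately show "e \<in> (\<lambda>e. f ` e) ` E" by blast
  next
    fix e assume "e \<in> (\<lambda>e. f ` e) ` E"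
    then obtain e0 where e0: "e0 \<in> E" "e = f ` e0" by auto
    then obtain u v where "e0 = {u, v}" "u \<in> V" "v \<in> V" using graph_onD[OF D(2)] by blast
    thus "e \<in> E'" using e0 edge[of u v] by auto
  qed
  have sub: "f ` e \<subseteq> f ` X \<longleftrightarrow> e \<subseteq> X" if "e \<subseteq> V" "X \<subseteq> V" for e X
    using inj_on_image_mem_iff[OF inj _ that(2)] that(1) by blast
  have sl: "slack E' (f ` X) = slack E X" if X: "X \<subseteq> V" for X
  proof -
    have "ind E' (f ` X) = (\<lambda>e. f ` e) ` ind E X"
      unfolding E' ind_def using sub[OF D(10) X] by auto
    moreover have "inj_on (\<lambda>e. f ` e) (ind E X)"
      using inj D(10) by (intro inj_onI) (metis (no_types, lifting) ind_def inj_on_image_eq_iff mem_Collect_eq)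
    moreover have "card (f ` X) = card X" using inj X by (meson card_image inj_on_subset)
    ultimately show ?thesis by (simp add: slack_def card_image)
  qed
  show "tight_on V' E'" unfolding tight_on_def
  proof (intro conjI allI impI)
    show "slack E' V' = 2" using sl[of V] fV tight_onD(3)[OF D(1)] by simp
    fix Y assume Y: "Y \<subseteq> V'" "Y \<noteq> {}"
    then obtain X where "X \<subseteq> V" "Y = f ` X" using fV by (metis subset_imageE)
    thus "2 \<le> slack E' Y" using sl[of X] tight_onD(2)[OF D(1), of X] Y by auto
  qed (rule g)
  show "\<forall>v\<in>V'. \<theta>' v \<in> V' \<and> \<theta>' (\<theta>' v) = v \<and> \<theta>' v \<noteq> v"
  proof
    fix y assume "y \<in> V'"
    then obtain v where v: "v \<in> V" "y = f v" using fV by auto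
    have "\<theta>' y = f (\<theta> v)" "\<theta>' (f (\<theta> v)) = f v" using inv[of v] inv[of "\<theta> v"] D(5,6)[OF v(1)] v by auto
    moreover have "f (\<theta> v) \<noteq> f v" using D(5,7)[OF v(1)] inj v by (metis inj_onD)
    ultimately show "\<theta>' y \<in> V' \<and> \<theta>' (\<theta>' y) = y \<and> \<theta>' y \<noteq> y" using v D(5) fV by auto
  qed
  show "\<forall>e\<in>E'. \<theta>' ` e \<in> E' \<and> \<theta>' ` e \<inter> e = {}"
  proof
    fix e assume "e \<in> E'"
    then obtain e0 where e0: "e0 \<in> E" "e = f ` e0" using E' by auto
    have "\<theta>' ` e = f ` \<theta> ` e0"
      unfolding e0(2) image_image using inv D(10)[OF e0(1)] by (intro image_cong refl) (simp add: subset_iff)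
    moreover have "f ` \<theta> ` e0 \<inter> f ` e0 = f ` (\<theta> ` e0 \<inter> e0)"
      using inj D(8)[OF e0(1)] D(10) e0(1) by (metis inj_on_image_Int)
    ultimately show "\<theta>' ` e \<in> E' \<and> \<theta>' ` e \<inter> e = {}" using e0 D(8,9)[OF e0(1)] E' by auto
  qed
qed

section \<open>The base graphs\<close>

lemma star_insert: "star v (insert x N) = insert {v, x} (star v N)" "star v {} = {}"
  by (auto simp: star_def)

lemma clique4: "clique {p, q, r, s} = {{p, q}, {p, r}, {p, s}, {q, r}, {q, s}, {r, s}}"
  if "distinct [p, q, r, s]"
proof -
  have "clique (insert x A) = star x A \<union> clique A" if "x \<notin> A" for x A
    using that by (auto simp: clique_def star_def)
  moreover have "clique {} = {}" by (simp add: clique_def)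
  ultimately show ?thesis using that by (simp add: star_insert insert_commute)
qed

lemma F1_edges: "edges F1 = {{2, 0}, {2, 1}, {2, 4}, {2, 5}, {3, 0}, {3, 1}, {3, 4}, {3, 5}, {0, 1}, {4, 5}}"
proof -
  have "{{x, y} | x y. x \<in> {p, q} \<and> y \<in> Y} = star p Y \<union> star q Y" for p q Y by (auto simp: star_def)
  hence "edges F1 = star 2 {0, 1, 4, 5} \<union> star 3 {0, 1, 4, 5} \<union> {{0, 1}, {4, 5}}"
    by (simp only: F1_def zgraph.simps)
  thus ?thesis by (simp add: star_insert insert_commute)
qed

lemma F1_verts: "verts F1 = {0, 1, 2, 3, 4, 5}"
  by (auto simp: F1_def)

lemma F2_edges: "edges F2 = {{0, 1}, {0, 2}, {0, 3}, {1, 2}, {1, 3}, {2, 3},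
    {4, 5}, {4, 6}, {4, 7}, {5, 6}, {5, 7}, {6, 7}, {2, 6}, {3, 7}}"
  by (simp add: F2_def clique4 insert_commute)

lemma F2_verts: "verts F2 = {0, 1, 2, 3, 4, 5, 6, 7}"
  by (auto simp: F2_def)

lemma tight_on_F1: "tight_on (verts F1) (edges F1)"
proof -
  txt \<open>Forgetting the symmetry, \<open>F\<^sub>1\<close> is a 0-extension of \<open>K\<^sub>4\<close> followed by a 1-extension on the edge
    \<open>cd\<close>.\<close>
  have "tight_on {2, 3, 4, 5} (clique {2, 3, 4, 5::nat})" by (rule tight_on_clique) simp
  note step = tight_on_ext1[OF tight_on_ext0[OF this, of 0 2 3], of 1 2 3 0]
  have "tight_on (insert 1 (insert 0 {2, 3, 4, 5}))
      (clique {2, 3, 4, 5} \<union> star 0 {2, 3} - {{2, 3}} \<union> star 1 {2, 3, 0})"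
    by (rule step) (simp_all add: clique4)
  moreover have "insert 1 (insert 0 {2, 3, 4, 5}) = verts F1" by (auto simp: F1_verts)
  moreover have "clique {2, 3, 4, 5} \<union> star 0 {2, 3} - {{2, 3}} \<union> star 1 {2, 3, 0} =
      {{2, 4}, {2, 5}, {3, 4}, {3, 5}, {4, 5}, {0, 2}, {0, 3}, {1, 2}, {1, 3}, {1, 0}}"
    by (simp add: clique4 star_insert insert_Diff_if doubleton_eq_iff) (simp add: insert_commute)
  moreover have "\<dots> = edges F1"
    unfolding F1_edges by (simp add: insert_commute)
  ultimately show ?thesis by simp
qed

text \<open>Without its symmetry F2 is a join of two copies of K4.\<close>

lemma tight_on_F2: "tight_on (verts F2) (edges F2)"
proof -
  have "tight_on {0, 1, 2, 3} (clique {0, 1, 2, 3::nat})" "tight_on {4, 5, 6, 7} (clique {4, 5, 6, 7::nat})"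
    by (auto intro: tight_on_clique)
  hence "tight_on ({0, 1, 2, 3} \<union> {4, 5, 6, 7}) (clique {0, 1, 2, 3} \<union> clique {4, 5, 6, 7} \<union> {{2, 6}, {3, 7}})"
    by (rule tight_on_join) (simp_all add: doubleton_eq_iff)
  moreover have "{0, 1, 2, 3} \<union> {4, 5, 6, 7} = verts F2" by (auto simp: F2_verts)
  moreover have "clique {0, 1, 2, 3} \<union> clique {4, 5, 6, 7} \<union> {{2, 6}, {3, 7}} = edges F2" by (simp only: F2_def zgraph.simps)
  ultimately show ?thesis by (simp only:)
qed

section \<open>Tight sets in a symmetric tight graph\<close>

text \<open>The sharp form of submodularity. In a graph the correction term counts the edges between
  \<open>X - Y\<close> and \<open>Y - X\<close>; it is needed for cuts, for disjoint tight sets, and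
  to exclude crossing edges between overlapping ones.\<close>

lemma slack_Un_Int:
  assumes "finite E" "finite X" "finite Y"
  shows "slack E (X \<union> Y) + slack E (X \<inter> Y) + int (card {e \<in> E. e \<subseteq> X \<union> Y \<and> \<not> e \<subseteq> X \<and> \<not> e \<subseteq> Y})
    = slack E X + slack E Y"
proof -
  let ?D = "{e \<in> E. e \<subseteq> X \<union> Y \<and> \<not> e \<subseteq> X \<and> \<not> e \<subseteq> Y}"
  have "ind E (X \<union> Y) = (ind E X \<union> ind E Y) \<union> ?D" by (auto simp: ind_def)
  moreover have "(ind E X \<union> ind E Y) \<inter> ?D = {}" by (auto simp: ind_def)
  ultimately have "card (ind E (X \<union> Y)) = card (ind E X \<union> ind E Y) + card ?D"
    using assms by (simp add: card_Un_disjoint finite_ind)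
  moreover have "ind E (X \<inter> Y) = ind E X \<inter> ind E Y" by (auto simp: ind_def)
  hence "card (ind E X) + card (ind E Y) = card (ind E X \<union> ind E Y) + card (ind E (X \<inter> Y))"
    using card_Un_Int[of "ind E X" "ind E Y"] assms by (simp add: finite_ind)
  ultimately show ?thesis using card_Un_Int[OF assms(2,3)] by (simp add: slack_def)
qed

lemma even_card_involution:
  assumes "finite S" "\<And>x. x \<in> S \<Longrightarrow> g x \<in> S \<and> g (g x) = x \<and> g x \<noteq> x"
  shows "even (card S)"
  using assms
proof (induction S rule: finite_psubset_induct)
  case (psubset S)
  show ?case
  proof (cases "S = {}")
    case False
    then obtain s where s: "s \<in> S" by auto
    let ?T = "S - {s, g s}"
    have gs: "g s \<in> S" "g s \<noteq> s" "g (g s) = s" using psubset.prems[OF s] by auto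
    have "even (card ?T)"
    proof (rule psubset.IH)
      show "?T \<subset> S" using s by auto
      fix x assume x: "x \<in> ?T"
      have "g x \<noteq> s" using x psubset.prems[of x] by auto
      moreover have "g x \<noteq> g s" using x psubset.prems[of x] gs by auto
      ultimately show "g x \<in> ?T \<and> g (g x) = x \<and> g x \<noteq> x" using x psubset.prems[of x] by auto
    qed
    moreover have "card S = card ?T + 2"
      using s gs psubset.hyps(1) card_Diff_subset[of "{s, g s}" S] card_mono[of S "{s, g s}"] by auto
    ultimately show ?thesis by simp
  qed simp
qed

section \<open>Neighbourhoods, tight sets and invariant sets\<close>

locale ci_graph =
  fixes V :: "nat set" and E :: "nat set set" and \<theta> :: "nat \<Rightarrow> nat"
  assumes ci: "ci_on V E \<theta>"
begin

lemmas D = ci_onD[OF ci]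
lemmas ED = ci_on_edgeD[OF ci]

definition N :: "nat \<Rightarrow> nat set" where "N v = {u. {v, u} \<in> E}"

definition tset :: "nat set \<Rightarrow> bool" where
  "tset X \<longleftrightarrow> X \<subseteq> V \<and> X \<noteq> {} \<and> slack E X = 2"

definition sset :: "nat set \<Rightarrow> bool" where
  "sset X \<longleftrightarrow> X \<subseteq> V \<and> (\<forall>x\<in>X. \<theta> x \<in> X)"

lemma slack_ge: "X \<subseteq> V \<Longrightarrow> X \<noteq> {} \<Longrightarrow> 2 \<le> slack E X"
  using tight_onD(2)[OF D(1)] by blast

lemma slack_V: "slack E V = 2" using tight_onD(3)[OF D(1)] .

lemma finite_sub: "X \<subseteq> V \<Longrightarrow> finite X" using D(3) finite_subset by blast

lemma NV: "N v \<subseteq> V" "v \<notin> N v" "\<theta> v \<notin> N v" "finite (N v)"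
proof -
  show "N v \<subseteq> V" "v \<notin> N v" "\<theta> v \<notin> N v"
    using ED(3)[of v] ED(4)[of v v] ED(5)[of v "\<theta> v"] by (auto simp: N_def)
  thus "finite (N v)" using finite_sub by blast
qed

lemma N_sym: "u \<in> N v \<longleftrightarrow> v \<in> N u"
  by (simp add: N_def insert_commute)

lemma N_E: "u \<in> N v \<longleftrightarrow> {v, u} \<in> E" by (simp add: N_def)

lemma N_\<theta>: "v \<in> V \<Longrightarrow> N (\<theta> v) = \<theta> ` N v"
proof (intro equalityI subsetI)
  fix u assume v: "v \<in> V" "u \<in> N (\<theta> v)"
  hence "{\<theta> (\<theta> v), \<theta> u} \<in> E" "u \<in> V" using ED by (auto simp: N_def)
  hence "\<theta> u \<in> N v" "\<theta> (\<theta> u) = u" using v D(6) by (auto simp: N_def)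
  thus "u \<in> \<theta> ` N v" by (metis imageI)
next
  fix u assume "u \<in> \<theta> ` N v"
  thus "u \<in> N (\<theta> v)" using ED(1) by (auto simp: N_def)
qed

lemma inj_\<theta>: "inj_on \<theta> V" by (rule inj_on_inverseI[of _ \<theta>]) (rule D(6))

lemma card_N_\<theta>: "v \<in> V \<Longrightarrow> card (N (\<theta> v)) = card (N v)"
  using NV(1) inj_\<theta> by (metis N_\<theta> card_image inj_on_subset)

lemma edge_star: "{e \<in> E. v \<in> e} = star v (N v)"
proof (intro equalityI subsetI)
  fix e assume e: "e \<in> {e \<in> E. v \<in> e}"
  then obtain p q where "e = {p, q}" using graph_onD[OF D(2)] by blast
  hence "\<exists>u. e = {v, u}" using e by auto
  thus "e \<in> star v (N v)" using e by (auto simp: star_def N_def)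
qed (auto simp: star_def N_def)

lemma slack_insert:
  assumes "X \<subseteq> V" "v \<in> V" "v \<notin> X"
  shows "slack E (insert v X) = slack E X + 2 - int (card (N v \<inter> X))"
proof -
  have "ind E (insert v X) = ind E X \<union> star v (N v \<inter> X)"
  proof -
    have "e \<in> star v (N v \<inter> X)" if e: "e \<in> E" "e \<subseteq> insert v X" "v \<in> e" for e
    proof -
      have "e \<in> star v (N v)" using e edge_star[of v] by blast
      then obtain u where u: "e = {v, u}" "u \<in> N v" unfolding star_def by blast
      hence "u \<in> X" using e NV(2) by auto
      thus ?thesis using u by (auto simp: star_def)
    qed
    thus ?thesis by (auto simp: ind_def star_def N_def)
  qed
  moreover have "ind E X \<inter> star v (N v \<inter> X) = {}" using assms by (auto simp: ind_def star_def)
  ultimately have "card (ind E (insert v X)) = card (ind E X) + card (N v \<inter> X)"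
    using D(4) NV(4) by (simp add: card_Un_disjoint finite_ind finite_star card_star)
  thus ?thesis using assms finite_sub by (simp add: slack_def)
qed

lemma slack_insert_bound:
  assumes "X \<subseteq> V" "v \<in> V" "v \<notin> X" "A \<subseteq> N v \<inter> X"
  shows "slack E (insert v X) \<le> slack E X + 2 - int (card A)"
  using slack_insert[OF assms(1-3)] card_mono[OF _ assms(4)] NV(4) by simp

text \<open>Two slacks of at least 2 and the number of crossing edges sum to 4, so no edge crosses
  either. This last conclusion later pulls vertices of a K4 into a tight set that overlaps
  it.\<close>

lemma tset_Un_Int:
  assumes "tset X" "tset Y" "X \<inter> Y \<noteq> {}"
  shows "tset (X \<union> Y)" "tset (X \<inter> Y)" "\<And>x y. x \<in> X - Y \<Longrightarrow> y \<in> Y - X \<Longrightarrow> {x, y} \<notin> E"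
proof -
  let ?D = "{e \<in> E. e \<subseteq> X \<union> Y \<and> \<not> e \<subseteq> X \<and> \<not> e \<subseteq> Y}"
  have XY: "X \<subseteq> V" "Y \<subseteq> V" "slack E X = 2" "slack E Y = 2" using assms by (auto simp: tset_def)
  have "2 \<le> slack E (X \<union> Y)" "2 \<le> slack E (X \<inter> Y)" using XY assms(3) by (auto intro!: slack_ge)
  moreover have "slack E (X \<union> Y) + slack E (X \<inter> Y) + int (card ?D) = 4"
    using slack_Un_Int[OF D(4) finite_sub finite_sub, of X Y] XY by simp
  ultimately have *: "slack E (X \<union> Y) = 2" "slack E (X \<inter> Y) = 2" "card ?D = 0" by linarith+
  thus "tset (X \<union> Y)" "tset (X \<inter> Y)" using assms XY by (auto simp: tset_def)
  have "?D = {}" using *(3) D(4) by simp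
  thus "\<And>x y. x \<in> X - Y \<Longrightarrow> y \<in> Y - X \<Longrightarrow> {x, y} \<notin> E" by blast
qed

lemma tsetI: "X \<subseteq> V \<Longrightarrow> X \<noteq> {} \<Longrightarrow> slack E X \<le> 2 \<Longrightarrow> tset X"
  using slack_ge[of X] by (auto simp: tset_def)

text \<open>\<open>C\<close> may be any collection of known edges between the two sets: two of them
  make the union tight, three are impossible.\<close>

lemma slack_disjoint:
  assumes "tset X" "tset Y" "X \<inter> Y = {}"
    and "C \<subseteq> E" "\<And>e. e \<in> C \<Longrightarrow> e \<subseteq> X \<union> Y \<and> \<not> e \<subseteq> X \<and> \<not> e \<subseteq> Y"
  shows "slack E (X \<union> Y) \<le> 4 - int (card C)"
proof -
  let ?D = "{e \<in> E. e \<subseteq> X \<union> Y \<and> \<not> e \<subseteq> X \<and> \<not> e \<subseteq> Y}"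
  have "card C \<le> card ?D" using assms(4,5) D(4) by (intro card_mono) auto
  thus ?thesis
    using slack_Un_Int[OF D(4) finite_sub finite_sub, of X Y] assms(1-3) slack_empty[OF D(2)]
    by (simp add: tset_def)
qed

lemma \<theta>_ind: "X \<subseteq> V \<Longrightarrow> e \<in> ind E X \<Longrightarrow> \<theta> ` e \<in> ind E (\<theta> ` X) \<and> \<theta> ` \<theta> ` e = e"
  using D(6,8,10) image_image_invol[of V \<theta> e] by (auto simp: ind_def)

lemma \<theta>_\<theta>_set: "X \<subseteq> V \<Longrightarrow> \<theta> ` \<theta> ` X = X"
  using image_image_invol[of V \<theta> X] D(6) by auto

lemma slack_image:
  assumes X: "X \<subseteq> V" shows "slack E (\<theta> ` X) = slack E X"
proof -
  have X': "\<theta> ` X \<subseteq> V" using X D(5) by auto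
  have "bij_betw ((`) \<theta>) (ind E X) (ind E (\<theta> ` X))"
    using \<theta>_ind[OF X] \<theta>_ind[OF X'] \<theta>_\<theta>_set[OF X]
    by (intro bij_betw_byWitness[where f' = "(`) \<theta>"]) auto
  moreover have "card (\<theta> ` X) = card X" using X inj_\<theta> by (meson card_image inj_on_subset)
  ultimately show ?thesis by (simp add: slack_def bij_betw_same_card)
qed

lemma tset_image: "tset X \<Longrightarrow> tset (\<theta> ` X)"
  using slack_image[of X] D(5) by (auto simp: tset_def)

lemma in_image: "X \<subseteq> V \<Longrightarrow> x \<in> V \<Longrightarrow> x \<in> \<theta> ` X \<longleftrightarrow> \<theta> x \<in> X"
  using D(6) by (metis imageE imageI subsetD)

lemma sset_even:
  assumes X: "sset X" shows "even (card X)" "even (slack E X)"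
proof -
  have XV: "X \<subseteq> V" "\<theta> ` X \<subseteq> X" using X by (auto simp: sset_def)
  show "even (card X)"
    using X D(6,7) finite_sub[OF XV(1)] by (intro even_card_involution[of X \<theta>]) (auto simp: sset_def)
  have "even (card (ind E X))"
  proof (rule even_card_involution[of _ "(`) \<theta>"])
    fix e assume e: "e \<in> ind E X"
    hence "e \<in> E" by (simp add: ind_def)
    hence "\<theta> ` e \<noteq> e" using D(9)[of e] graph_onD[OF D(2), of e] by auto
    thus "\<theta> ` e \<in> ind E X \<and> \<theta> ` \<theta> ` e = e \<and> \<theta> ` e \<noteq> e"
      using \<theta>_ind[OF XV(1) e] XV(2) unfolding ind_def by blast
  qed (simp add: finite_ind D(4))
  thus "even (slack E X)" by (simp add: slack_def)
qed

text \<open>Through these two sets parity becomes available for sets that are not themselves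
  invariant.\<close>

lemma sset_Un_Int_image:
  assumes "X \<subseteq> V" shows "sset (X \<union> \<theta> ` X)" "sset (X \<inter> \<theta> ` X)"
proof -
  have "\<theta> x \<in> \<theta> ` X \<and> (x \<in> \<theta> ` X \<longleftrightarrow> \<theta> x \<in> X)" if "x \<in> X" for x using that assms in_image by auto
  moreover have "\<theta> x \<in> X \<and> x \<in> V" if "x \<in> \<theta> ` X" for x using that assms D(5,6) by auto
  ultimately show "sset (X \<union> \<theta> ` X)" "sset (X \<inter> \<theta> ` X)" using assms unfolding sset_def by blast+
qed

lemma sset_Int: "sset X \<Longrightarrow> sset Y \<Longrightarrow> sset (X \<inter> Y)"
  by (auto simp: sset_def)

lemma sset_Compl:
  assumes "sset X" shows "sset (V - X)"
proof -
  have "\<theta> x \<in> V - X" if "x \<in> V - X" for x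
  proof -
    have "\<theta> x \<in> V" "\<theta> (\<theta> x) = x" using that D(5,6) by auto
    thus ?thesis using that assms by (auto simp: sset_def)
  qed
  thus ?thesis by (simp add: sset_def)
qed

text \<open>Undoing a 0-extension or a join leaves induced subgraphs; their slacks are those of the
  whole graph.\<close>

lemma restrict:
  assumes "sset Y" "tset Y" shows "ci_on Y (ind E Y) \<theta>"
proof -
  have Y: "Y \<subseteq> V" using assms by (simp add: sset_def)
  have sl: "slack (ind E Y) X = slack E X" if "X \<subseteq> Y" for X
  proof -
    have "ind (ind E Y) X = ind E X" using that by (auto simp: ind_def)
    thus ?thesis by (simp add: slack_def)
  qed
  have "graph_on Y (ind E Y)" unfolding graph_on_def
  proof (intro conjI ballI)
    fix e assume e: "e \<in> ind E Y"
    then obtain u v where "e = {u, v}" "u \<noteq> v" using graph_onD[OF D(2), of e] by (auto simp: ind_def)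
    thus "\<exists>u v. e = {u, v} \<and> u \<noteq> v \<and> u \<in> Y \<and> v \<in> Y" using e by (auto simp: ind_def)
  qed (rule finite_sub[OF Y])
  hence "tight_on Y (ind E Y)"
    using sl slack_ge Y assms(2) by (auto simp: tight_on_def tset_def)
  moreover have "\<theta> ` Y \<subseteq> Y" using assms by (auto simp: sset_def)
  ultimately show ?thesis
    unfolding ci_on_def
  proof (intro conjI ballI)
    fix v assume v: "v \<in> Y"
    hence "v \<in> V" using Y by blast
    thus "\<theta> v \<in> Y" "\<theta> (\<theta> v) = v" "\<theta> v \<noteq> v" using v assms(1) D(6,7) by (auto simp: sset_def)
  next
    fix e assume e: "e \<in> ind E Y"
    show "\<theta> ` e \<in> ind E Y" using \<theta>_ind[OF Y e] \<open>\<theta> ` Y \<subseteq> Y\<close> unfolding ind_def by blast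
    show "\<theta> ` e \<inter> e = {}" using e D(9) by (simp add: ind_def)
  qed
qed

section \<open>Removing a vertex together with its image\<close>

lemma remove_pair:
  assumes v: "v \<in> V"
  shows "slack E (V - {v, \<theta> v}) = 2 * int (card (N v)) - 2" "sset (V - {v, \<theta> v})"
    "N v \<subseteq> V - {v, \<theta> v}" "N (\<theta> v) \<subseteq> V - {v, \<theta> v}"
proof -
  let ?V = "V - {v, \<theta> v}"
  have v': "\<theta> v \<in> V" "\<theta> v \<noteq> v" "\<theta> (\<theta> v) = v" using D(5,6,7) v by auto
  show N: "N v \<subseteq> ?V" "N (\<theta> v) \<subseteq> ?V" using NV[of v] NV[of "\<theta> v"] v' by auto
  \<comment> \<open>\<open>v\<close> and \<open>\<theta> v\<close> are not adjacent, so putting them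
    back costs the full degree twice: 2 equals the remaining slack plus 4 minus twice the degree.
    Degree 2 thus leaves slack 2 and degree 3 leaves slack 4.\<close>
  have "slack E (insert (\<theta> v) ?V) = slack E ?V + 2 - int (card (N (\<theta> v)))"
    using slack_insert[of ?V "\<theta> v"] v' N by (simp add: Int_absorb2)
  moreover have "N v \<inter> insert (\<theta> v) ?V = N v" using N by auto
  hence "slack E (insert v (insert (\<theta> v) ?V)) = slack E (insert (\<theta> v) ?V) + 2 - int (card (N v))"
    using slack_insert[of "insert (\<theta> v) ?V" v] v v' by simp
  moreover have "insert v (insert (\<theta> v) ?V) = V" using v v' by auto
  ultimately show "slack E ?V = 2 * int (card (N v)) - 2" using slack_V card_N_\<theta>[OF v] by simp
  have "sset {v, \<theta> v}" using v v' by (simp add: sset_def)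
  thus "sset ?V" by (rule sset_Compl)
qed

lemma card_N_ge2:
  assumes "v \<in> V" shows "2 \<le> card (N v)"
proof -
  \<comment> \<open>If nothing remained, \<open>v\<close> would have no neighbours, and the formula
    for the remaining slack would give the empty set -2 instead of 0.\<close>
  have "V - {v, \<theta> v} \<noteq> {}"
  proof
    assume e: "V - {v, \<theta> v} = {}"
    have "N v = {}" using remove_pair(3)[OF assms] unfolding e by simp
    moreover have "slack E (V - {v, \<theta> v}) = 0" unfolding e by (rule slack_empty[OF D(2)])
    ultimately have "card (N v) = 0" "slack E (V - {v, \<theta> v}) = 0" by simp_all
    thus False using remove_pair(1)[OF assms] by simp
  qed
  thus ?thesis using remove_pair(1)[OF assms] slack_ge[of "V - {v, \<theta> v}"] by auto
qed

text \<open>Sets of slack 4 or more can take both new edges. A tight set containing one of them is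
  excluded by \<open>nob\<close>, directly or through its image. Slack 3 tolerates one edge, so only
  sets of slack 3 containing both are a problem. The lemma allows \<open>p\<close> and
  \<open>q\<close> outside \<open>N v\<close> because undoing a vertex-to-C4 move inserts an edge at
  a vertex not adjacent to \<open>v\<close>.\<close>

lemma reduce_pair:
  assumes v: "v \<in> V" "card (N v) = 3" and pq: "p \<in> V - {v, \<theta> v}" "q \<in> V - {v, \<theta> v}"
    "p \<noteq> q" "{p, q} \<notin> E" "\<theta> p \<noteq> q"
    and nob: "\<And>X. tset X \<Longrightarrow> v \<notin> X \<Longrightarrow> \<theta> v \<notin> X \<Longrightarrow> p \<in> X \<Longrightarrow> q \<in> X \<Longrightarrow> False"
  shows "ci_on (V - {v, \<theta> v}) ({e \<in> E. v \<notin> e \<and> \<theta> v \<notin> e} \<union> {{p, q}, {\<theta> p, \<theta> q}}) \<theta>"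
    (is "ci_on ?V (?E \<union> ?P) \<theta>")
proof -
  note R = remove_pair[OF v(1)]
  have v': "\<theta> v \<in> V" "\<theta> v \<noteq> v" "\<theta> (\<theta> v) = v" using D(5,6,7) v by auto
  have p: "p \<in> V" "q \<in> V" "\<theta> p \<in> ?V" "\<theta> q \<in> ?V" "\<theta> (\<theta> p) = p" "\<theta> (\<theta> q) = q" "\<theta> p \<noteq> p" "\<theta> q \<noteq> q"
    "\<theta> q \<noteq> p"
    using pq R(2) D(6,7) by (auto simp: sset_def)
  have pq': "\<theta> p \<noteq> \<theta> q" using p pq by metis
  have nE: "{\<theta> p, \<theta> q} \<notin> E" using ED(1)[of "\<theta> p" "\<theta> q"] p pq by auto
  have neP: "{p, q} \<noteq> {\<theta> p, \<theta> q}" using p pq by (auto simp: doubleton_eq_iff)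
  have sl: "slack (?E \<union> ?P) X = slack E X - int (card (ind ?P X))" if X: "X \<subseteq> ?V" for X
  proof -
    have "ind (?E \<union> ?P) X = ind E X \<union> ind ?P X" using X by (auto simp: ind_def)
    moreover have "ind E X \<inter> ind ?P X = {}" using pq nE by (auto simp: ind_def)
    ultimately show ?thesis using D(4) by (simp add: slack_def card_Un_disjoint finite_ind)
  qed
  have gr: "graph_on ?V (?E \<union> ?P)"
  proof (intro graph_on_Un)
    show "graph_on ?V ?E" unfolding graph_on_def
    proof (intro conjI ballI)
      fix e assume "e \<in> ?E"
      thus "\<exists>u w. e = {u, w} \<and> u \<noteq> w \<and> u \<in> ?V \<and> w \<in> ?V" using graph_onD[OF D(2), of e] by auto
    qed (use D(3) in simp)
    show "graph_on ?V ?P" using pq p pq' D(3) by (auto simp: graph_on_def)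
  qed
  have sp: "2 \<le> slack (?E \<union> ?P) X" if X: "X \<subseteq> ?V" "X \<noteq> {}" for X
  proof -
    have XV: "X \<subseteq> V" using X by auto
    have fP: "card (ind ?P X) \<le> 2"
      using card_mono[of ?P "ind ?P X"] neP by (simp add: ind_def subset_iff)
    have vX: "v \<notin> X" "\<theta> v \<notin> X" "v \<notin> \<theta> ` X" "\<theta> v \<notin> \<theta> ` X"
      using X in_image[OF XV v(1)] in_image[OF XV v'(1)] v'(3) by auto
    have blk: "\<not> {p, q} \<subseteq> Y" if "tset Y" "Y \<subseteq> X \<union> \<theta> ` X" for Y
      using nob[OF that(1)] that(2) vX by blast
    have "slack E X \<ge> 2" using slack_ge[OF XV X(2)] .
    then consider "slack E X = 2" | "slack E X = 3" | "slack E X \<ge> 4" by linarith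
    thus ?thesis
    proof cases
      case 1
      hence t: "tset X" using XV X by (simp add: tset_def)
      have "\<not> {p, q} \<subseteq> X" using blk[OF t] by auto
      moreover have "\<not> {\<theta> p, \<theta> q} \<subseteq> X"
        using blk[OF tset_image[OF t]] in_image[OF XV p(1)] in_image[OF XV p(2)] by auto
      ultimately have "ind ?P X = {}" by (auto simp: ind_def)
      thus ?thesis using sl[OF X(1)] 1 by simp
    next
      case 2
      have "\<not> ({p, q} \<subseteq> X \<and> {\<theta> p, \<theta> q} \<subseteq> X)"
      proof
        assume a: "{p, q} \<subseteq> X \<and> {\<theta> p, \<theta> q} \<subseteq> X"
        txt \<open>Union and intersection have even slacks with sum at most 6, so one of the slacks is 2.\<close>
        let ?U = "X \<union> \<theta> ` X" and ?I = "X \<inter> \<theta> ` X"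
        have in': "p \<in> ?I" "q \<in> ?I" using a in_image[OF XV p(1)] in_image[OF XV p(2)] by auto
        have sub: "?U \<subseteq> V" "?I \<subseteq> V" using XV D(5) by auto
        have "slack E ?U + slack E ?I \<le> 6"
          using slack_Un_Int[OF D(4) finite_sub[OF XV] finite_sub, of "\<theta> ` X"] sub slack_image[OF XV] 2 by simp
        moreover have "even (slack E ?U)" "even (slack E ?I)"
          using sset_even(2) sset_Un_Int_image[OF XV] by auto
        moreover have "2 \<le> slack E ?U" "2 \<le> slack E ?I" using slack_ge[OF sub(1)] slack_ge[OF sub(2)] in' by blast+
        ultimately have "slack E ?U = 2 \<or> slack E ?I = 2" by presburger
        moreover have "?U \<noteq> {}" "?I \<noteq> {}" using in' by blast+
        ultimately have "tset ?U \<or> tset ?I" using sub by (metis tset_def)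
        moreover have "{p, q} \<subseteq> ?U" "{p, q} \<subseteq> ?I" "?I \<subseteq> ?U" using in' by blast+
        ultimately show False using blk[OF _ order.refl] blk[of ?I] by metis
      qed
      hence "ind ?P X \<subseteq> {{p, q}} \<or> ind ?P X \<subseteq> {{\<theta> p, \<theta> q}}" unfolding ind_def by blast
      hence "card (ind ?P X) \<le> card {{p, q}} \<or> card (ind ?P X) \<le> card {{\<theta> p, \<theta> q}}"
        using card_mono[OF finite.insertI[OF finite.emptyI]] by metis
      hence "card (ind ?P X) \<le> 1" by simp
      thus ?thesis using sl[OF X(1)] 2 by simp
    next
      case 3
      thus ?thesis using sl[OF X(1)] fP by simp
    qed
  qed
  have "ind ?P ?V = ?P" using p pq by (auto simp: ind_def)
  hence "slack (?E \<union> ?P) ?V = 2" using sl[of ?V] R(1) v neP by simp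
  hence t: "tight_on ?V (?E \<union> ?P)" using gr sp by (simp add: tight_on_def)
  have "\<theta> ` e \<in> ?E \<union> ?P \<and> \<theta> ` e \<inter> e = {}" if e: "e \<in> ?E \<union> ?P" for e
  proof (cases "e \<in> ?E")
    case True
    hence eE: "e \<in> E" by simp
    have "\<theta> ` \<theta> ` e = e" using \<theta>_\<theta>_set[OF D(10)[OF eE]] .
    hence "v \<notin> \<theta> ` e" "\<theta> v \<notin> \<theta> ` e" using True v'(3) by (metis (mono_tags, lifting) imageI mem_Collect_eq)+
    thus ?thesis using D(8,9)[OF eE] by auto
  next
    case False
    hence "e \<in> ?P" using e by blast
    hence "e = {p, q} \<or> e = {\<theta> p, \<theta> q}" by blast
    thus ?thesis using p pq by (elim disjE) auto
  qed
  thus ?thesis using t R(2) D(6,7) by (auto simp: ci_on_def sset_def)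
qed


section \<open>Obstructions at a vertex of degree three\<close>

lemma tset_nbrs:
  assumes "tset X" "v \<in> V" "card (N v) = 3" "v \<notin> X" "N v \<subseteq> X"
  shows False
proof -
  have X: "X \<subseteq> V" "slack E X = 2" using assms(1) by (auto simp: tset_def)
  \<comment> \<open>The value is 2 + 2 - 3. The refutations of blocked pairs below all end in such a
    tight set.\<close>
  have "slack E (insert v X) = 1"
    using slack_insert[OF X(1) assms(2,4)] X assms by (simp add: Int_absorb2)
  thus False using slack_ge[of "insert v X"] X assms(2) by auto
qed

text \<open>Apart from \<open>xy\<close> being an edge or \<open>y = \<theta> x\<close>, this is the only obstruction to replacing \<open>v\<close> and its
  image by the edge \<open>xy\<close> and its image.\<close>
definition blocked :: "nat \<Rightarrow> nat \<Rightarrow> nat \<Rightarrow> bool" where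
  "blocked v x y \<longleftrightarrow> (\<exists>X. tset X \<and> v \<notin> X \<and> \<theta> v \<notin> X \<and> x \<in> X \<and> y \<in> X)"

lemma blocked_sym: "blocked v x y \<longleftrightarrow> blocked v y x"
  by (auto simp: blocked_def)

text \<open>The two blocking sets share \<open>x\<close>, so their union is tight, and it contains
  all neighbours of \<open>v\<close>.\<close>

lemma blocked_two:
  assumes v: "v \<in> V" "card (N v) = 3" "N v = {x, y, z}" and b: "blocked v x y" "blocked v x z"
  shows False
proof -
  obtain X Y where X: "tset X" "v \<notin> X" "x \<in> X" "y \<in> X" and Y: "tset Y" "v \<notin> Y" "x \<in> Y" "z \<in> Y"
    using b by (auto simp: blocked_def)
  have "tset (X \<union> Y)" using X Y by (intro tset_Un_Int) auto
  thus False using v X Y by (intro tset_nbrs[of "X \<union> Y" v]) auto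
qed

text \<open>A set blocking \<open>x\<close> and \<open>y\<close> stays tight when \<open>z\<close>
  is added, since \<open>z\<close> sends two edges into it; it then contains all of
  \<open>N v\<close>.\<close>

lemma blocked_edges:
  assumes v: "v \<in> V" "card (N v) = 3" "N v = {x, y, z}" and b: "blocked v x y"
    and e: "{x, z} \<in> E" "{y, z} \<in> E" and ne: "x \<noteq> y"
  shows False
proof -
  obtain X where X: "tset X" "v \<notin> X" "x \<in> X" "y \<in> X" using b by (auto simp: blocked_def)
  have XV: "X \<subseteq> V" using X by (simp add: tset_def)
  have "z \<notin> X" using tset_nbrs[OF X(1) v(1,2) X(2)] X v by auto
  have "slack E (insert z X) \<le> slack E X + 2 - int (card {x, y})"
    using XV ED e \<open>z \<notin> X\<close> X by (intro slack_insert_bound) (auto simp: N_def insert_commute)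
  hence "tset (insert z X)" using X ne XV ED(3)[OF e(1)] by (intro tsetI) (auto simp: tset_def)
  moreover have "v \<noteq> z" using v(3) NV(2)[of v] by auto
  ultimately show False using v X by (intro tset_nbrs[of "insert z X" v]) auto
qed

text \<open>The blocking set and its image either overlap, or are disjoint and joined by
  \<open>{x, z}\<close> and the image of that edge. Either way their union is tight, and it contains
  \<open>x\<close>, \<open>\<theta> x\<close> and \<open>z\<close>.\<close>

lemma blocked_fixed_edge:
  assumes v: "v \<in> V" "card (N v) = 3" "N v = {x, \<theta> x, z}" and b: "blocked v (\<theta> x) z"
    and e: "{x, z} \<in> E"
  shows False
proof -
  obtain X where X: "tset X" "v \<notin> X" "\<theta> v \<notin> X" "\<theta> x \<in> X" "z \<in> X" using b by (auto simp: blocked_def)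
  note xz = ED[OF e]
  let ?Y = "\<theta> ` X"
  have XV: "X \<subseteq> V" using X by (simp add: tset_def)
  have Y: "tset ?Y" "v \<notin> ?Y" "x \<in> ?Y" "\<theta> z \<in> ?Y"
    using tset_image X in_image[OF XV v(1)] in_image[OF XV xz(2)] by auto
  have "tset (X \<union> ?Y)"
  proof (cases "X \<inter> ?Y = {}")
    case False
    thus ?thesis using X Y by (intro tset_Un_Int)
  next
    case True
    have "slack E (X \<union> ?Y) \<le> 4 - int (card {{x, z}, {\<theta> x, \<theta> z}})"
    proof (rule slack_disjoint[OF X(1) Y(1) True])
      show "{{x, z}, {\<theta> x, \<theta> z}} \<subseteq> E" using e xz by simp
      fix f assume "f \<in> {{x, z}, {\<theta> x, \<theta> z}}"
      moreover have "z \<notin> ?Y" "x \<notin> X" "\<theta> x \<notin> ?Y" "\<theta> z \<notin> X" using True X Y by auto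
      ultimately show "f \<subseteq> X \<union> ?Y \<and> \<not> f \<subseteq> X \<and> \<not> f \<subseteq> ?Y" using X Y by blast
    qed
    moreover have "{x, z} \<noteq> {\<theta> x, \<theta> z}" using xz D(7)[OF xz(2)] by (auto simp: doubleton_eq_iff)
    ultimately have "slack E (X \<union> ?Y) \<le> 2" by simp
    thus ?thesis using X Y by (intro tsetI) (auto simp: tset_def)
  qed
  thus False using v X Y by (intro tset_nbrs[of "X \<union> ?Y" v]) auto
qed

text \<open>If no two neighbours are swapped, at most one pair is blocked, and a blocked pair beside
  two edges is contradictory; so all three pairs are edges. A swapped pair is never an edge, and
  then both other pairs must be: this is the pattern that grows into F1.\<close>

lemma deg3_cases:
  assumes v: "v \<in> V" "card (N v) = 3"
    and irr: "\<And>x y. x \<in> N v \<Longrightarrow> y \<in> N v \<Longrightarrow> x \<noteq> y \<Longrightarrow> {x, y} \<in> E \<or> \<theta> x = y \<or> blocked v x y"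
  shows "(\<forall>x\<in>N v. \<forall>y\<in>N v. x \<noteq> y \<longrightarrow> {x, y} \<in> E) \<or> (\<exists>x z. N v = {x, \<theta> x, z} \<and> {x, z} \<in> E \<and> {\<theta> x, z} \<in> E)"
proof -
  obtain a b c where abc: "N v = {a, b, c}" "a \<noteq> b" "a \<noteq> c" "b \<noteq> c"
    using v(2) by (auto simp: card_3_iff)
  have V: "a \<in> V" "b \<in> V" "c \<in> V" using NV(1)[of v] abc by auto
  \<comment> \<open>\<open>x\<close> and \<open>y\<close> are exchanged by the involution. The mixed
    case, with one of the other pairs an edge and the other blocked, is excluded by reflecting the
    blocking set.\<close>
  have fixed_case: "?thesis" if "N v = {x, y, z}" "x \<noteq> y" "x \<noteq> z" "y \<noteq> z" "\<theta> x = y" for x y z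
  proof -
    have xyz: "x \<in> V" "y \<in> V" "z \<in> V" using that(1) NV(1)[of v] by auto
    have yx: "\<theta> y = x" using D(6)[OF xyz(1)] that by simp
    have N': "N v = {y, \<theta> y, z}" using that yx by auto
    have "\<theta> x \<noteq> z" "\<theta> y \<noteq> z" using that yx by auto
    hence *: "{x, z} \<in> E \<or> blocked v x z" "{y, z} \<in> E \<or> blocked v y z"
      using irr[of x z] irr[of y z] that by auto
    have "\<not> (blocked v x z \<and> blocked v y z)"
      using blocked_two[OF v, of z x y] that by (auto simp: blocked_sym insert_commute)
    moreover have "\<not> ({x, z} \<in> E \<and> blocked v y z)"
      using blocked_fixed_edge[OF v, of x z] that by auto
    moreover have "\<not> ({y, z} \<in> E \<and> blocked v x z)"
      using blocked_fixed_edge[OF v N'] yx by auto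
    ultimately have "{x, z} \<in> E" "{y, z} \<in> E" using * by auto
    thus ?thesis using that by blast
  qed
  show ?thesis
  proof (cases "\<theta> a = b \<or> \<theta> a = c \<or> \<theta> b = c")
    case True
    thus ?thesis
      using fixed_case[of a b c] fixed_case[of a c b] fixed_case[of b c a] abc
      by (auto simp: insert_commute)
  next
    case False
    have *: "{a, b} \<in> E \<or> blocked v a b" "{a, c} \<in> E \<or> blocked v a c" "{b, c} \<in> E \<or> blocked v b c"
      using irr[of a b] irr[of a c] irr[of b c] abc False by auto
    have "\<not> (blocked v a b \<and> blocked v a c)" "\<not> (blocked v a b \<and> blocked v b c)"
      "\<not> (blocked v a c \<and> blocked v b c)"
      using blocked_two[OF v, of a b c] blocked_two[OF v, of b a c] blocked_two[OF v, of c a b] abc(1)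
      by (auto simp: blocked_sym insert_commute)
    moreover have "\<not> (blocked v a b \<and> {a, c} \<in> E \<and> {b, c} \<in> E)"
      "\<not> (blocked v a c \<and> {a, b} \<in> E \<and> {b, c} \<in> E)" "\<not> (blocked v b c \<and> {a, b} \<in> E \<and> {a, c} \<in> E)"
      using blocked_edges[OF v, of a b c] blocked_edges[OF v, of a c b] blocked_edges[OF v, of b c a] abc
      by (auto simp: insert_commute)
    ultimately have "{a, b} \<in> E" "{a, c} \<in> E" "{b, c} \<in> E" using * by blast+
    thus ?thesis using abc by (auto simp: insert_commute)
  qed
qed

text \<open>An invariant set consists of swapped pairs. One pair has slack 4; two pairs span at most
  four edges and have slack at least 8 - 4. So a tight one needs three pairs, and F1 attains
  this.\<close>

lemma sset_tset_card:
  assumes "sset Z" "tset Z" shows "6 \<le> card Z"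
proof -
  have Z: "Z \<subseteq> V" "slack E Z = 2" "finite Z" using assms finite_sub by (auto simp: tset_def)
  have inv: "\<theta> x \<in> Z \<and> \<theta> (\<theta> x) = x \<and> \<theta> x \<noteq> x" if "x \<in> Z" for x
    using that assms(1) Z D(6,7) by (auto simp: sset_def)
  obtain p where p: "p \<in> Z" using assms(2) by (auto simp: tset_def)
  note p' = inv[OF p]
  have NI: "N x \<inter> {y, \<theta> y} \<subseteq> {}" if "x \<in> {y, \<theta> y}" "y \<in> Z" for x y
    using that NV(2,3)[of y] NV(2,3)[of "\<theta> y"] inv[of y] by auto
  have s2: "slack E {p, \<theta> p} = 4"
  proof -
    have "slack E {\<theta> p} = 2" using slack_insert[of "{}" "\<theta> p"] slack_empty[OF D(2)] p' Z by auto
    thus ?thesis using slack_insert[of "{\<theta> p}" p] NI[of p p] p p' Z by auto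
  qed
  have "Z \<noteq> {p, \<theta> p}" using s2 Z(2) by fastforce
  then obtain q where q: "q \<in> Z" "q \<notin> {p, \<theta> p}" using p p' by auto
  note q' = inv[OF q(1)]
  have q'p: "\<theta> q \<notin> {p, \<theta> p}" using p' q q' by auto
  have "slack E {q, \<theta> q, p, \<theta> p} \<ge> 4"
  proof -
    have c2: "card (N x \<inter> Y) \<le> 2" if "Y \<subseteq> insert u {p, \<theta> p}" "u \<notin> N x" for x u Y
    proof -
      have "card (N x \<inter> Y) \<le> card {p, \<theta> p}" using that by (intro card_mono) auto
      thus ?thesis using p' by simp
    qed
    have "slack E {\<theta> q, p, \<theta> p} = slack E {p, \<theta> p} + 2 - int (card (N (\<theta> q) \<inter> {p, \<theta> p}))"
      using slack_insert[of "{p, \<theta> p}" "\<theta> q"] q'p p p' q' Z by auto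
    moreover have "slack E {q, \<theta> q, p, \<theta> p} = slack E {\<theta> q, p, \<theta> p} + 2 - int (card (N q \<inter> {\<theta> q, p, \<theta> p}))"
      using slack_insert[of "{\<theta> q, p, \<theta> p}" q] q p p' q' Z by auto
    moreover have "card (N (\<theta> q) \<inter> {p, \<theta> p}) \<le> 2" "card (N q \<inter> {\<theta> q, p, \<theta> p}) \<le> 2"
      using c2[of "{p, \<theta> p}" "\<theta> q" "\<theta> q"] c2[of "{\<theta> q, p, \<theta> p}" "\<theta> q" q] NV by auto
    ultimately show ?thesis using s2 by linarith
  qed
  hence "Z \<noteq> {q, \<theta> q, p, \<theta> p}" using Z(2) by fastforce
  then obtain r where r: "r \<in> Z" "r \<notin> {q, \<theta> q, p, \<theta> p}" using p p' q q' by auto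
  note r' = inv[OF r(1)]
  have r'p: "\<theta> r \<notin> {q, \<theta> q, p, \<theta> p}"
  proof
    assume "\<theta> r \<in> {q, \<theta> q, p, \<theta> p}"
    hence "\<theta> (\<theta> r) \<in> \<theta> ` {q, \<theta> q, p, \<theta> p}" by (rule imageI)
    thus False using r(2) r' q' p' by simp
  qed
  have "card {r, \<theta> r, q, \<theta> q, p, \<theta> p} = 6" using r r'p r' q q'p q' p' by auto
  moreover have "{r, \<theta> r, q, \<theta> q, p, \<theta> p} \<subseteq> Z" using r r' q q' p p' by auto
  ultimately show ?thesis using card_mono[OF Z(3)] by metis
qed

text \<open>The two properties of copies of \<open>F\<^sub>1\<close> and \<open>F\<^sub>2\<close>, beyond tightness, that make them minimal invariant
  tight sets.\<close>
definition block :: "nat set \<Rightarrow> bool" where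
  "block Y \<longleftrightarrow> sset Y \<and> tset Y \<and> card Y \<le> 8 \<and> (\<forall>y\<in>Y. 3 \<le> card (N y \<inter> Y))"

text \<open>Since \<open>Z\<close> has at least six vertices and \<open>Y\<close> at most eight,
  only one pair \<open>p\<close>, \<open>\<theta> p\<close> can be missing. As these two are not
  adjacent, the three or more neighbours of \<open>p\<close> in \<open>Y\<close> lie in
  \<open>Z\<close>, and \<open>insert p Z\<close> would have slack at most 2 + 2 - 3.\<close>

lemma block_minimal:
  assumes Y: "block Y" and Z: "Z \<subseteq> Y" "sset Z" "tset Z"
  shows "Z = Y"
proof (rule ccontr)
  assume "Z \<noteq> Y"
  then obtain p where p: "p \<in> Y" "p \<notin> Z" using Z by auto
  have YV: "Y \<subseteq> V" "finite Y" "card Y \<le> 8" using Y finite_sub by (auto simp: block_def sset_def)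
  have pV: "p \<in> V" using p YV by auto
  have p': "\<theta> p \<in> Y" "\<theta> p \<noteq> p" "\<theta> p \<notin> Z"
    using p Y Z(2) D(6,7)[OF pV] by (auto simp: block_def sset_def)
  have "finite Z" using Z YV finite_subset by auto
  hence "card (insert p (insert (\<theta> p) Z)) = card Z + 2" using p p' by simp
  hence "card Y \<le> card (insert p (insert (\<theta> p) Z))" using sset_tset_card[OF Z(2,3)] YV by simp
  hence "insert p (insert (\<theta> p) Z) = Y" using Z p p' YV by (intro card_seteq) auto
  hence "N p \<inter> Y = N p \<inter> Z" using NV[of p] by auto
  hence "3 \<le> card (N p \<inter> Z)" using Y p by (auto simp: block_def)
  moreover have "slack E (insert p Z) = slack E Z + 2 - int (card (N p \<inter> Z))"
    using slack_insert[of Z p] Z YV pV p by auto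
  moreover have "2 \<le> slack E (insert p Z)" using Z YV pV by (intro slack_ge) auto
  moreover have "slack E Z = 2" using Z by (simp add: tset_def)
  ultimately show False by linarith
qed

text \<open>The intersection of two meeting blocks is again invariant and tight, so minimality
  identifies it with each of them.\<close>

lemma block_disjoint:
  assumes "block Y" "block Z" "Y \<inter> Z \<noteq> {}" shows "Y = Z"
proof -
  have "tset (Y \<inter> Z)" using assms by (intro tset_Un_Int(2)) (auto simp: block_def)
  moreover have "sset (Y \<inter> Z)" using assms sset_Int by (auto simp: block_def)
  ultimately have "Y \<inter> Z = Y" "Y \<inter> Z = Z" using block_minimal assms by auto
  thus ?thesis by simp
qed

section \<open>Edge cuts and the degree count\<close>

definition cut :: "nat set \<Rightarrow> nat set set" where
  "cut Y = {e \<in> E. \<not> e \<subseteq> Y \<and> e \<inter> Y \<noteq> {}}"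

text \<open>Double counting of incidences: an edge inside \<open>Y\<close> is met twice, an outgoing
  edge once.\<close>

lemma handshake:
  assumes Y: "Y \<subseteq> V"
  shows "(\<Sum>y\<in>Y. card (N y)) = 2 * card (ind E Y) + card (cut Y)"
proof -
  have "(\<Sum>y\<in>Y. card (N y)) = (\<Sum>y\<in>Y. card {e \<in> E. y \<in> e})"
    by (simp add: edge_star card_star)
  also have "\<dots> = (\<Sum>e\<in>E. card {y \<in> Y. y \<in> e})"
    using finite_sub[OF Y] D(4) by (intro sum_multicount_gen) auto
  also have "\<dots> = (\<Sum>e\<in>E. (if e \<subseteq> Y then 2 else 0) + (if \<not> e \<subseteq> Y \<and> e \<inter> Y \<noteq> {} then 1 else 0))"
  proof (rule sum.cong)
    fix e assume "e \<in> E"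
    then obtain p q where pq: "e = {p, q}" "p \<noteq> q" using graph_onD[OF D(2)] by blast
    have "{y \<in> Y. y \<in> e} = (if p \<in> Y then {p} else {}) \<union> (if q \<in> Y then {q} else {})" using pq by auto
    thus "card {y \<in> Y. y \<in> e} = (if e \<subseteq> Y then 2 else 0) + (if \<not> e \<subseteq> Y \<and> e \<inter> Y \<noteq> {} then 1 else 0)"
      using pq by auto
  qed simp
  also have "\<dots> = 2 * card (ind E Y) + card (cut Y)"
    using D(4) by (simp add: sum.distrib sum.If_cases ind_def cut_def Int_def)
  finally show ?thesis .
qed

text \<open>Turns the number of outgoing edges into a slack. For a proper invariant tight set,
  sparsity and parity of the complement then leave only 2 or at least 4.\<close>

lemma cut_slack:
  assumes "tset Y" shows "slack E (V - Y) = int (card (cut Y))"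
proof -
  have Y: "Y \<subseteq> V" "slack E Y = 2" using assms by (auto simp: tset_def)
  have "{e \<in> E. e \<subseteq> Y \<union> (V - Y) \<and> \<not> e \<subseteq> Y \<and> \<not> e \<subseteq> V - Y} = cut Y"
    using D(10) Y by (auto simp: cut_def)
  moreover have "Y \<union> (V - Y) = V" "Y \<inter> (V - Y) = {}" using Y by auto
  ultimately show ?thesis
    using slack_Un_Int[OF D(4) finite_sub[OF Y(1)], of "V - Y"] D(3) Y slack_V slack_empty[OF D(2)] by simp
qed

text \<open>A block equal to \<open>V\<close> is exempt because that is where the base graphs arise.
  Degree 2 has to be excluded since such a vertex would contribute -2 outside all blocks.\<close>

lemma exists_deg3:
  assumes deg: "\<And>v. v \<in> V \<Longrightarrow> card (N v) \<noteq> 2"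
    and nojoin: "\<And>Y. sset Y \<Longrightarrow> tset Y \<Longrightarrow> Y \<noteq> V \<Longrightarrow> card (cut Y) \<noteq> 2"
  shows "\<exists>v\<in>V. card (N v) = 3 \<and> (\<forall>Y. block Y \<longrightarrow> v \<in> Y \<longrightarrow> Y = V)"
proof (rule ccontr)
  assume "\<not> ?thesis"
  hence neg: "\<exists>Y. block Y \<and> v \<in> Y \<and> Y \<noteq> V" if "v \<in> V" "card (N v) = 3" for v using that by blast
  define w where "w = (\<lambda>v. int (card (N v)) - 4)"
  define \<B> where "\<B> = {Y. block Y \<and> Y \<noteq> V}"
  have BV: "Y \<subseteq> V" if "Y \<in> \<B>" for Y using that by (auto simp: \<B>_def block_def sset_def)
  \<comment> \<open>For a tight set this is \<open>card (cut Y) - 4\<close>, and for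
    \<open>V\<close>, whose cut is empty, it is -4.\<close>
  have wsum: "sum w Y = int (card (cut Y)) - 2 * slack E Y" if "Y \<subseteq> V" for Y
  proof -
    have "sum w Y = int (\<Sum>y\<in>Y. card (N y)) - 4 * int (card Y)" by (simp add: w_def sum_subtractf)
    thus ?thesis using handshake[OF that] by (simp add: slack_def)
  qed
  have "cut V = {}" using D(10) by (auto simp: cut_def)
  hence total: "sum w V = - 4" using wsum[of V] slack_V by simp
  have pos: "0 \<le> sum w Y" if Y: "Y \<in> \<B>" for Y
  proof -
    have st: "sset Y" "tset Y" "Y \<noteq> V" using Y by (auto simp: \<B>_def block_def)
    have "V - Y \<noteq> {}" using BV[OF Y] st by auto
    hence "2 \<le> slack E (V - Y)" by (intro slack_ge) auto
    moreover have "even (slack E (V - Y))" using sset_even(2)[OF sset_Compl[OF st(1)]] .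
    moreover have "slack E (V - Y) \<noteq> 2" using nojoin[OF st] cut_slack[OF st(2)] by auto
    ultimately have "4 \<le> slack E (V - Y)" by presburger
    thus ?thesis using wsum[OF BV[OF Y]] cut_slack[OF st(2)] st(2) by (simp add: tset_def)
  qed
  have "sum w (\<Union>\<B>) = sum (sum w) \<B>"
  proof -
    have "\<forall>A\<in>\<B>. finite A" using BV finite_sub by blast
    moreover have "\<forall>A\<in>\<B>. \<forall>B\<in>\<B>. A \<noteq> B \<longrightarrow> A \<inter> B = {}"
    proof (intro ballI impI)
      fix A B assume "A \<in> \<B>" "B \<in> \<B>" "A \<noteq> B"
      thus "A \<inter> B = {}" using block_disjoint[of A B] by (auto simp only: \<B>_def mem_Collect_eq)
    qed
    ultimately have "sum w (\<Union>\<B>) = (sum \<circ> sum) w \<B>" by (rule sum.Union_disjoint)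
    thus ?thesis by simp
  qed
  hence U: "0 \<le> sum w (\<Union>\<B>)" using pos by (simp add: sum_nonneg)
  have "0 \<le> sum w (V - \<Union>\<B>)"
  proof (rule sum_nonneg)
    fix v assume v: "v \<in> V - \<Union>\<B>"
    hence "card (N v) \<noteq> 3" using neg[of v] by (auto simp: \<B>_def)
    thus "0 \<le> w v" using v deg[of v] card_N_ge2[of v] by (auto simp: w_def)
  qed
  moreover have "sum w V = sum w (V - \<Union>\<B>) + sum w (\<Union>\<B>)"
    using BV D(3) by (intro sum.subset_diff) auto
  ultimately show False using U total by simp
qed

end

section \<open>Undoing the moves\<close>

text \<open>Tight graphs on equally many vertices have equally many edges, so a bijection that maps
  edges to edges already reaches every edge; preservation of non-edges comes for free.\<close>

lemma z2_iso_embedding: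
  assumes G: "tight_on (verts G) (edges G)" and H: "tight_on (verts H) (edges H)"
    and bij: "bij_betw f (verts G) (verts H)"
    and edge: "\<And>e. e \<in> edges G \<Longrightarrow> f ` e \<in> edges H"
    and inv: "\<And>v. v \<in> verts G \<Longrightarrow> f (invol G v) = invol H (f v)"
  shows "z2_iso G H"
proof -
  note g = tight_onD(1)[OF G] and h = tight_onD(1)[OF H]
  have inj: "inj_on f (verts G)" using bij by (simp add: bij_betw_def)
  have inj': "inj_on ((`) f) (edges G)"
    using inj_on_image_eq_iff[OF inj] graph_on_subset[OF g] by (auto simp: inj_on_def)
  have "card (verts G) = card (verts H)" using bij by (rule bij_betw_same_card)
  hence "card (edges G) = card (edges H)"
    using slack_all[OF g] slack_all[OF h] tight_onD(3)[OF G] tight_onD(3)[OF H] by simp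
  hence "card ((`) f ` edges G) = card (edges H)" using inj' by (simp add: card_image)
  hence E: "(`) f ` edges G = edges H" using edge graph_on_finite[OF h] by (intro card_subset_eq) auto
  have "{u, v} \<in> edges G \<longleftrightarrow> {f u, f v} \<in> edges H" if uv: "u \<in> verts G" "v \<in> verts G" for u v
  proof
    show "{f u, f v} \<in> edges H" if "{u, v} \<in> edges G" using edge[OF that] by simp
    assume "{f u, f v} \<in> edges H"
    hence "f ` {u, v} \<in> (`) f ` edges G" using E by simp
    then obtain e where e: "e \<in> edges G" "f ` e = f ` {u, v}" by (metis imageE)
    hence "e = {u, v}" using inj_on_image_eq_iff[OF inj graph_on_subset[OF g e(1)], of "{u, v}"] uv by auto
    thus "{u, v} \<in> edges G" using e by simp
  qed
  thus ?thesis unfolding z2_iso_def using bij inv by blast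
qed

section \<open>Copies of F1, K4 and F2 around a vertex of degree three\<close>

context ci_graph begin

text \<open>In the order \<open>v\<close>, \<open>z\<close>, \<open>x\<close>,
  \<open>\<theta> x\<close>, \<open>\<theta> z\<close>, \<open>\<theta> v\<close> these are the
  vertices a, b, c, d, e, f of F1: \<open>x\<close> and \<open>\<theta> x\<close> are joined to the
  other four, and \<open>{v, z}\<close> and its image are the two remaining edges.\<close>

lemma F1_config:
  assumes v: "v \<in> V" "N v = {x, \<theta> x, z}" and e: "{x, z} \<in> E" "{\<theta> x, z} \<in> E"
  defines "Y \<equiv> {v, \<theta> v, z, \<theta> z, x, \<theta> x}"
  shows "block Y" "distinct [v, z, x, \<theta> x, \<theta> z, \<theta> v]"
    "{v, x} \<in> E" "{v, \<theta> x} \<in> E" "{v, z} \<in> E" "{\<theta> v, x} \<in> E" "{\<theta> v, \<theta> x} \<in> E" "{\<theta> v, \<theta> z} \<in> E"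
    "{x, \<theta> z} \<in> E" "{\<theta> x, \<theta> z} \<in> E"
proof -
  note e1 = ED[OF e(1)] and e2 = ED[OF e(2)]
  have xx: "\<theta> (\<theta> x) = x" "\<theta> (\<theta> z) = z" "\<theta> (\<theta> v) = v" using D(6) e1(2,3) v by auto
  show vE: "{v, x} \<in> E" "{v, \<theta> x} \<in> E" "{v, z} \<in> E" using v(2) N_E by auto
  show vE': "{\<theta> v, x} \<in> E" "{\<theta> v, \<theta> x} \<in> E" "{\<theta> v, \<theta> z} \<in> E"
    using ED(1)[OF vE(1)] ED(1)[OF vE(2)] ED(1)[OF vE(3)] xx by auto
  show zE: "{x, \<theta> z} \<in> E" "{\<theta> x, \<theta> z} \<in> E" using e1(1) e2(1) xx by auto
  show dis: "distinct [v, z, x, \<theta> x, \<theta> z, \<theta> v]"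
    using e1 e2 ED(4-6)[OF vE(1)] ED(4-6)[OF vE(2)] ED(4-6)[OF vE(3)] xx
      D(7)[OF v(1)] D(7)[OF e1(2)] D(7)[OF e1(3)] by auto
  have YV: "Y \<subseteq> V" using v e1 e2 D(5) by (auto simp: Y_def)
  have nb: "3 \<le> card (N y \<inter> Y)" if "{p, q, r} \<subseteq> Y" "distinct [p, q, r]" "{y, p} \<in> E" "{y, q} \<in> E" "{y, r} \<in> E"
    for y p q r
  proof -
    have "card {p, q, r} \<le> card (N y \<inter> Y)" using that NV(4) by (intro card_mono) (auto simp: N_def)
    thus ?thesis using that(2) by simp
  qed
  have nbs: "3 \<le> card (N y \<inter> Y)" if "y \<in> Y" for y
  proof -
    from that have "y \<in> {v, \<theta> v, z, \<theta> z, x, \<theta> x}" by (simp only: Y_def)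
    thus ?thesis
    proof (elim insertE emptyE)
      assume y: "y = v" show ?thesis using vE dis unfolding y by (intro nb[of x "\<theta> x" z]) (auto simp: Y_def)
    next
      assume y: "y = \<theta> v" show ?thesis using vE' dis unfolding y by (intro nb[of x "\<theta> x" "\<theta> z"]) (auto simp: Y_def)
    next
      assume y: "y = z" show ?thesis using vE e dis unfolding y
        by (intro nb[of x "\<theta> x" v]) (auto simp: Y_def insert_commute)
    next
      assume y: "y = \<theta> z" show ?thesis using vE' zE dis unfolding y
        by (intro nb[of x "\<theta> x" "\<theta> v"]) (auto simp: Y_def insert_commute)
    next
      assume y: "y = x" show ?thesis using vE vE' e dis unfolding y
        by (intro nb[of v "\<theta> v" z]) (auto simp: Y_def insert_commute)
    next
      assume y: "y = \<theta> x" show ?thesis using vE vE' e dis unfolding y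
        by (intro nb[of v "\<theta> v" z]) (auto simp: Y_def insert_commute)
    qed
  qed
  have Vs: "x \<in> V" "\<theta> x \<in> V" "z \<in> V" "\<theta> z \<in> V" "\<theta> v \<in> V" using YV by (auto simp: Y_def)
  \<comment> \<open>Adding \<open>z\<close>, \<open>v\<close>, \<open>\<theta> z\<close>,
    \<open>\<theta> v\<close> in this order, with 2, 3, 2, 3 known edges, takes the bound through 4,
    3, 3, 2.\<close>
  have "slack E {x, \<theta> x} \<le> 4" using dis by (simp add: slack_def)
  moreover have "slack E {z, x, \<theta> x} \<le> slack E {x, \<theta> x} + 2 - int (card {x, \<theta> x})"
    using Vs dis e by (intro slack_insert_bound) (auto simp: N_def insert_commute)
  moreover have "slack E {v, z, x, \<theta> x} \<le> slack E {z, x, \<theta> x} + 2 - int (card {z, x, \<theta> x})"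
    using Vs dis vE v(1) by (intro slack_insert_bound) (auto simp: N_def insert_commute)
  moreover have "slack E {\<theta> z, v, z, x, \<theta> x} \<le> slack E {v, z, x, \<theta> x} + 2 - int (card {x, \<theta> x})"
    using Vs dis zE v(1) by (intro slack_insert_bound) (auto simp: N_def insert_commute)
  moreover have "slack E {\<theta> v, \<theta> z, v, z, x, \<theta> x} \<le> slack E {\<theta> z, v, z, x, \<theta> x} + 2 - int (card {\<theta> z, x, \<theta> x})"
    using Vs dis vE' v(1) by (intro slack_insert_bound) (auto simp: N_def insert_commute)
  moreover have "card {x, \<theta> x} = 2" "card {z, x, \<theta> x} = 3" "card {\<theta> z, x, \<theta> x} = 3"
    using dis by auto
  ultimately have "slack E {\<theta> v, \<theta> z, v, z, x, \<theta> x} \<le> 2" by linarith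
  moreover have "{\<theta> v, \<theta> z, v, z, x, \<theta> x} = Y" by (auto simp: Y_def)
  ultimately have "tset Y" using YV by (intro tsetI) (auto simp: Y_def)
  moreover have "sset Y" using YV xx by (auto simp: sset_def Y_def)
  moreover have "card Y \<le> 8" using dis unfolding Y_def by (auto simp: card_insert_if)
  ultimately show "block Y" using nbs by (simp add: block_def)
qed

text \<open>Six edges on four vertices give slack at most 2. If \<open>K\<close> met its image, the
  intersection would be an invariant tight set with at most four vertices, and those have at least
  six.\<close>

lemma K4_tset:
  assumes v: "v \<in> V" "card (N v) = 3" and cl: "\<forall>x\<in>N v. \<forall>y\<in>N v. x \<noteq> y \<longrightarrow> {x, y} \<in> E"
  defines "K \<equiv> insert v (N v)"
  shows "clique K \<subseteq> E" "tset K" "card K = 4" "K \<inter> \<theta> ` K = {}" "\<theta> ` K \<subseteq> V" "tset (\<theta> ` K)"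
    "clique (\<theta> ` K) \<subseteq> E" "card (\<theta> ` K) = 4" "sset (K \<union> \<theta> ` K)"
proof -
  have KV: "K \<subseteq> V" using v NV(1) by (auto simp: K_def)
  show c4: "card K = 4" using v NV by (simp add: K_def)
  show clE: "clique K \<subseteq> E" using cl by (auto simp: clique_def K_def N_def insert_commute)
  have "clique K \<subseteq> ind E K" using clE by (auto simp: ind_def clique_def)
  hence "card (clique K) \<le> card (ind E K)" using D(4) by (intro card_mono) (auto simp: finite_ind)
  hence "slack E K \<le> 2" using c4 finite_sub[OF KV] by (simp add: card_clique slack_def choose_two)
  thus t: "tset K" using KV by (intro tsetI) (auto simp: K_def)
  show t': "tset (\<theta> ` K)" using tset_image[OF t] .
  thus "\<theta> ` K \<subseteq> V" by (simp add: tset_def)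
  show "card (\<theta> ` K) = 4" using c4 KV inj_\<theta> by (metis card_image inj_on_subset)
  show "clique (\<theta> ` K) \<subseteq> E"
  proof
    fix e assume "e \<in> clique (\<theta> ` K)"
    then obtain x y where "e = {\<theta> x, \<theta> y}" "x \<in> K" "y \<in> K" "x \<noteq> y" by (auto simp: clique_def)
    moreover from this have "{x, y} \<in> E" using clE by (auto simp: clique_def)
    ultimately show "e \<in> E" using ED(1) by simp
  qed
  show "sset (K \<union> \<theta> ` K)" using sset_Un_Int_image[OF KV] by simp
  show "K \<inter> \<theta> ` K = {}"
  proof (rule ccontr)
    assume "K \<inter> \<theta> ` K \<noteq> {}"
    hence "tset (K \<inter> \<theta> ` K)" using tset_Un_Int(2)[OF t t'] by simp
    hence "6 \<le> card (K \<inter> \<theta> ` K)" using sset_tset_card sset_Un_Int_image(2)[OF KV] by blast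
    moreover have "card (K \<inter> \<theta> ` K) \<le> card K" using finite_sub[OF KV] by (intro card_mono) auto
    ultimately show False using c4 by simp
  qed
qed

text \<open>Prepares the inverse vertex-to-C4 move: \<open>v\<close> and \<open>u\<close> share
  \<open>k1\<close> and \<open>k2\<close>, so \<open>v\<close> can be merged into \<open>u\<close>
  by inserting \<open>{u, t}\<close>. If \<open>u\<close> were in the image of \<open>K\<close>,
  three edges would run between \<open>K\<close> and its image; if \<open>{u, t}\<close> were an
  edge, \<open>insert u K\<close> would have slack at most 1. A tight set containing
  \<open>u\<close> and \<open>t\<close> but not \<open>v\<close> overlaps \<open>K\<close> in
  \<open>t\<close>, so it absorbs \<open>k1\<close> and \<open>k2\<close> and then contains
  \<open>N v\<close>.\<close>

lemma K4_two_nbrs: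
  assumes v: "v \<in> V" "card (N v) = 3" and cl: "\<forall>x\<in>N v. \<forall>y\<in>N v. x \<noteq> y \<longrightarrow> {x, y} \<in> E"
  defines "K \<equiv> insert v (N v)"
  assumes u: "u \<in> V - K" "k1 \<in> K" "k2 \<in> K" "k1 \<noteq> k2" "{k1, u} \<in> E" "{k2, u} \<in> E"
  shows "\<exists>t. N v = {k1, k2, t} \<and> t \<noteq> k1 \<and> t \<noteq> k2 \<and> u \<in> V - {v, \<theta> v} \<and> t \<in> V - {v, \<theta> v} \<and> u \<noteq> t
    \<and> {u, t} \<notin> E \<and> \<theta> u \<noteq> t \<and> \<not> blocked v u t"
proof -
  note K = K4_tset[OF v cl, folded K_def]
  have KV: "K \<subseteq> V" using K(2) by (simp add: tset_def)
  have "v \<notin> N u" using u(1) N_sym[of u v] by (auto simp: K_def)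
  hence k: "k1 \<in> N v" "k2 \<in> N v" using u by (auto simp: K_def N_def insert_commute)
  have "card (N v - {k1, k2}) = 1" using k v u(4) NV(4) by (simp add: card_Diff_subset)
  then obtain t where t: "N v - {k1, k2} = {t}" by (auto simp: card_1_singleton_iff)
  hence Nv: "N v = {k1, k2, t}" "t \<noteq> k1" "t \<noteq> k2" using k by auto
  have tK: "t \<in> K" "t \<noteq> v" "v \<in> K" using Nv NV(2)[of v] by (auto simp: K_def)
  have kv: "k1 \<noteq> v" "k2 \<noteq> v" using k NV(2) by auto
  have uK': "u \<notin> \<theta> ` K"
  proof
    assume a: "u \<in> \<theta> ` K"
    hence "\<theta> u \<in> K" using in_image[OF KV] u by auto
    have nK: "k1 \<notin> \<theta> ` K" "k2 \<notin> \<theta> ` K" "\<theta> k1 \<notin> K" "\<theta> k1 \<in> \<theta> ` K" "\<theta> u \<notin> \<theta> ` K"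
      using K(4) u \<open>\<theta> u \<in> K\<close> by auto
    have ne: "{k1, u} \<noteq> {k2, u}" "{\<theta> k1, \<theta> u} \<noteq> {k1, u}" "{\<theta> k1, \<theta> u} \<noteq> {k2, u}"
      using u(4) ED[OF u(5)] ED[OF u(6)] D(7)[of u] by (auto simp: doubleton_eq_iff)
    have "slack E (K \<union> \<theta> ` K) \<le> 4 - int (card {{k1, u}, {k2, u}, {\<theta> k1, \<theta> u}})"
    proof (rule slack_disjoint[OF K(2) K(6) K(4)])
      show "{{k1, u}, {k2, u}, {\<theta> k1, \<theta> u}} \<subseteq> E" using u ED(1)[OF u(5)] by simp
      fix e assume "e \<in> {{k1, u}, {k2, u}, {\<theta> k1, \<theta> u}}"
      thus "e \<subseteq> K \<union> \<theta> ` K \<and> \<not> e \<subseteq> K \<and> \<not> e \<subseteq> \<theta> ` K"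
        using a u nK \<open>\<theta> u \<in> K\<close> by (elim insertE emptyE) auto
    qed
    hence "slack E (K \<union> \<theta> ` K) \<le> 1" using ne by simp
    moreover have "2 \<le> slack E (K \<union> \<theta> ` K)" using KV K(5) tK by (intro slack_ge) auto
    ultimately show False by simp
  qed
  have ut: "{u, t} \<notin> E"
  proof
    assume "{u, t} \<in> E"
    hence "slack E (insert u K) \<le> slack E K + 2 - int (card {k1, k2, t})"
      using KV u tK by (intro slack_insert_bound) (auto simp: N_def insert_commute)
    hence "slack E (insert u K) \<le> 1" using K(2) Nv u(4) by (simp add: tset_def)
    moreover have "2 \<le> slack E (insert u K)" using KV u by (intro slack_ge) auto
    ultimately show False by simp
  qed
  have "\<not> blocked v u t"
  proof
    assume "blocked v u t"
    then obtain X where X: "tset X" "v \<notin> X" "u \<in> X" "t \<in> X" by (auto simp: blocked_def)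
    note UI = tset_Un_Int[OF X(1) K(2)]
    have ne: "X \<inter> K \<noteq> {}" using X tK by auto
    have "k1 \<in> X" using UI(3)[OF ne, of u k1] X u by (auto simp: insert_commute)
    moreover have "k2 \<in> X" using UI(3)[OF ne, of u k2] X u by (auto simp: insert_commute)
    ultimately show False using tset_nbrs[OF X(1) v X(2)] Nv X by auto
  qed
  moreover have "\<theta> v \<in> \<theta> ` K" using tK by auto
  hence "u \<noteq> \<theta> v" "t \<noteq> \<theta> v" using uK' tK K(4) by auto
  moreover have "u \<noteq> v" "u \<noteq> t" using u tK by auto
  moreover have "\<theta> u \<noteq> t" using uK' in_image[OF KV, of u] u tK by auto
  ultimately show ?thesis using Nv ut u tK KV by auto
qed

text \<open>The edge and its image are two distinct edges between disjoint tight sets, so the union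
  is tight. The inner degrees of at least 3 come from the two cliques, and \<open>p = q\<close>
  would make the edge fixed.\<close>

lemma F2_config:
  assumes v: "v \<in> V" "card (N v) = 3" and cl: "\<forall>x\<in>N v. \<forall>y\<in>N v. x \<noteq> y \<longrightarrow> {x, y} \<in> E"
  defines "K \<equiv> insert v (N v)"
  assumes pq: "p \<in> K" "q \<in> K" "{p, \<theta> q} \<in> E"
  shows "block (K \<union> \<theta> ` K)" "p \<noteq> q"
proof -
  note K = K4_tset[OF v cl, folded K_def]
  have KV: "K \<subseteq> V" using K(2) by (simp add: tset_def)
  have qq: "\<theta> (\<theta> q) = q" using D(6) KV pq by auto
  note e = ED[OF pq(3)]
  show "p \<noteq> q" using e by auto
  have in': "\<theta> q \<in> \<theta> ` K" "\<theta> p \<in> \<theta> ` K" "\<theta> q \<notin> K" "\<theta> p \<notin> K" "p \<notin> \<theta> ` K" "q \<notin> \<theta> ` K"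
    using pq K(4) by auto
  have "slack E (K \<union> \<theta> ` K) \<le> 4 - int (card {{p, \<theta> q}, {\<theta> p, q}})"
  proof (rule slack_disjoint[OF K(2) K(6) K(4)])
    show "{{p, \<theta> q}, {\<theta> p, q}} \<subseteq> E" using pq e(1) qq by simp
    fix f assume "f \<in> {{p, \<theta> q}, {\<theta> p, q}}"
    thus "f \<subseteq> K \<union> \<theta> ` K \<and> \<not> f \<subseteq> K \<and> \<not> f \<subseteq> \<theta> ` K" using in' pq by blast
  qed
  moreover have "{p, \<theta> q} \<noteq> {\<theta> p, q}" using in' pq e qq by (auto simp: doubleton_eq_iff)
  ultimately have "slack E (K \<union> \<theta> ` K) \<le> 2" by simp
  hence "tset (K \<union> \<theta> ` K)" using KV K(5) pq by (intro tsetI) auto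
  moreover have "card (K \<union> \<theta> ` K) = 8"
    using K finite_sub[OF KV] finite_sub[OF K(5)] by (simp add: card_Un_disjoint)
  moreover have "3 \<le> card (N y \<inter> (K \<union> \<theta> ` K))" if "y \<in> L" "L = K \<or> L = \<theta> ` K" for y L
  proof -
    have L: "card L = 4" "clique L \<subseteq> E" "finite L" using that K finite_sub[OF KV] finite_sub[OF K(5)] by auto
    have "L - {y} \<subseteq> N y" using L(2) that(1) by (auto simp: clique_def N_def)
    hence "card (L - {y}) \<le> card (N y \<inter> (K \<union> \<theta> ` K))" using that NV(4) by (intro card_mono) auto
    thus ?thesis using L that by simp
  qed
  ultimately show "block (K \<union> \<theta> ` K)" using K(9) unfolding block_def by (metis UnE order.refl)
qed

text \<open>\<open>K\<close> is contracted first and its image second. By \<open>no\<close> there is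
  no edge between them, so the first contraction leaves the image clique intact, and reflecting
  \<open>uniq\<close> shows that no edges merge in the second. \<open>v\<close> and
  \<open>\<theta> v\<close> remain as the contracted vertices.\<close>

lemma K4_contract:
  assumes v: "v \<in> V" "card (N v) = 3" and cl: "\<forall>x\<in>N v. \<forall>y\<in>N v. x \<noteq> y \<longrightarrow> {x, y} \<in> E"
  defines "K \<equiv> insert v (N v)"
  defines "M \<equiv> {u \<in> V - K. \<exists>k\<in>K. {k, u} \<in> E}"
  assumes uniq: "\<And>u k k'. u \<in> V - K \<Longrightarrow> k \<in> K \<Longrightarrow> k' \<in> K \<Longrightarrow> {k, u} \<in> E \<Longrightarrow> {k', u} \<in> E \<Longrightarrow> k = k'"
    and no: "\<And>p q. p \<in> K \<Longrightarrow> q \<in> \<theta> ` K \<Longrightarrow> {p, q} \<notin> E"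
  shows "ci_on (V - N v - \<theta> ` N v)
    ({e \<in> E. e \<inter> K = {} \<and> e \<inter> \<theta> ` K = {}} \<union> star v M \<union> star (\<theta> v) (\<theta> ` M)) \<theta>" (is "ci_on ?V ?E \<theta>")
    and "M \<inter> \<theta> ` K = {}" "\<theta> ` M \<inter> K = {}"
proof -
  note K = K4_tset[OF v cl, folded K_def]
  let ?K = "\<theta> ` K"
  have KV: "K \<subseteq> V" "v \<in> K" using K(2) by (auto simp: tset_def K_def)
  have v': "\<theta> v \<in> V" "\<theta> v \<noteq> v" "\<theta> (\<theta> v) = v" using D(5,6,7) v by auto
  have vK: "v \<notin> ?K" "\<theta> v \<in> ?K" "\<theta> v \<notin> K" using KV(2) K(4) by auto
  have KK: "x \<in> ?K \<longleftrightarrow> \<theta> x \<in> K" if "x \<in> V" for x using in_image[OF KV(1) that] .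
  have KK2: "x \<in> K \<longleftrightarrow> \<theta> x \<in> ?K" if "x \<in> V" for x using KK[OF D(5)[OF that]] D(6)[OF that] by simp
  show MK: "M \<inter> ?K = {}" using no by (auto simp: M_def)
  have MV: "M \<subseteq> V" "M \<inter> K = {}" by (auto simp: M_def)
  show MK': "\<theta> ` M \<inter> K = {}" using MK MV KK by blast
  have MKK: "\<theta> ` M \<inter> ?K = {}" using MV KK2 by blast
  define E1 where "E1 = {e \<in> E. e \<inter> K = {}} \<union> star v M"
  define V1 where "V1 = insert v (V - K)"
  have t1: "tight_on V1 E1" unfolding V1_def E1_def M_def
    using D(1) KV(1) K(3) K(1) KV(2) uniq by (rule tight_on_K4_contract)
  have E1D: "{k, u} \<in> E" "u \<notin> K" if "k \<in> ?K" "{k, u} \<in> E1" for k u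
  proof -
    have "{k, u} \<notin> star v M" using that(1) vK MK by (auto simp: star_def doubleton_eq_iff)
    thus "{k, u} \<in> E" "u \<notin> K" using that by (auto simp: E1_def)
  qed
  have E1I: "{k, u} \<in> E1" if "k \<in> ?K" "{k, u} \<in> E" "u \<notin> K" for k u
    using that K(4) by (auto simp: E1_def)
  \<comment> \<open>The attachments of the image clique after the first contraction; they turn out
    to be the images of those in \<open>M\<close>.\<close>
  define M' where "M' = {u \<in> V1 - ?K. \<exists>k\<in>?K. {k, u} \<in> E1}"
  have t2: "tight_on (insert (\<theta> v) (V1 - ?K)) ({e \<in> E1. e \<inter> ?K = {}} \<union> star (\<theta> v) M')"
    unfolding M'_def
  proof (rule tight_on_K4_contract[OF t1])
    show "?K \<subseteq> V1" using K(4,5) by (auto simp: V1_def)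
    show "clique ?K \<subseteq> E1"
    proof
      fix e assume e: "e \<in> clique ?K"
      hence "e \<subseteq> ?K" by (auto simp: clique_def)
      thus "e \<in> E1" using e K(4,7) unfolding E1_def by blast
    qed
    show "k = k'" if "u \<in> V1 - ?K" "k \<in> ?K" "k' \<in> ?K" "{k, u} \<in> E1" "{k', u} \<in> E1" for u k k'
    proof -
      note e = E1D[OF that(2,4)] E1D[OF that(3,5)]
      note ed = ED[OF e(1)] ED[OF e(3)]
      have "\<theta> u \<notin> K" using KK[OF ed(3)] that by simp
      moreover have "\<theta> k \<in> K" "\<theta> k' \<in> K" using KK ed that by auto
      ultimately have "\<theta> k = \<theta> k'" using uniq[of "\<theta> u" "\<theta> k" "\<theta> k'"] ed D(5) by auto
      thus ?thesis using D(6) ed by metis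
    qed
  qed (use K(8) vK in auto)
  have "M' = \<theta> ` M"
  proof (intro equalityI subsetI)
    fix u assume "u \<in> M'"
    then obtain k where k: "k \<in> ?K" "{k, u} \<in> E1" "u \<notin> ?K" by (auto simp: M'_def)
    note e = E1D[OF k(1,2)]
    note ed = ED[OF e(1)]
    have "\<theta> u \<in> V - K" "\<theta> k \<in> K" using KK[OF ed(2)] KK[OF ed(3)] k D(5) ed by auto
    hence "\<theta> u \<in> M" using ed by (auto simp: M_def)
    thus "u \<in> \<theta> ` M" using D(6)[OF ed(3)] by (metis imageI)
  next
    fix u assume "u \<in> \<theta> ` M"
    then obtain m k where m: "u = \<theta> m" "m \<in> M" "k \<in> K" "{k, m} \<in> E" by (auto simp: M_def)
    note ed = ED[OF m(4)]
    have "u \<notin> K" "u \<notin> ?K" using MK' MKK m by auto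
    moreover have "{\<theta> k, u} \<in> E1" using m ed \<open>u \<notin> K\<close> by (intro E1I) auto
    moreover have "u \<in> V" using ed m D(5) by auto
    ultimately show "u \<in> M'" using m by (auto simp: M'_def V1_def)
  qed
  moreover have "{e \<in> E1. e \<inter> ?K = {}} = {e \<in> E. e \<inter> K = {} \<and> e \<inter> ?K = {}} \<union> star v M"
  proof -
    have "e \<inter> ?K = {}" if "e \<in> star v M" for e using that MK vK by (auto simp: star_def)
    thus ?thesis unfolding E1_def by blast
  qed
  moreover have "insert (\<theta> v) (V1 - ?K) = ?V"
  proof -
    have "v \<notin> N v" "\<theta> v \<notin> N v" "\<theta> v \<notin> \<theta> ` N v" "v \<notin> \<theta> ` N v"
      using NV(1,2,3)[of v] in_image[OF NV(1)[of v] v(1)] in_image[OF NV(1)[of v] v'(1)] v' by auto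
    moreover have "?K = insert (\<theta> v) (\<theta> ` N v)" by (simp add: K_def)
    ultimately show ?thesis using v v' by (auto simp: V1_def K_def)
  qed
  ultimately have t: "tight_on ?V ?E" using t2 by simp
  have a: "\<theta> x \<in> ?V \<and> \<theta> (\<theta> x) = x \<and> \<theta> x \<noteq> x" if x: "x \<in> ?V" for x
  proof -
    have "x \<in> V" "\<theta> x \<in> V" using x D(5) by auto
    thus ?thesis using x in_image[OF NV(1)[of v], of x] in_image[OF NV(1)[of v], of "\<theta> x"] D(6,7)[of x] by auto
  qed
  have b: "\<theta> ` e \<in> ?E \<and> \<theta> ` e \<inter> e = {}" if e: "e \<in> ?E" for e
  proof (cases "e \<in> E")
    case True
    show ?thesis
    proof (cases "e \<in> star v M \<union> star (\<theta> v) (\<theta> ` M)")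
      case True
      thus ?thesis using D(9)[OF \<open>e \<in> E\<close>] image_star[of e v M \<theta>] image_star[of e "\<theta> v" "\<theta> ` M" \<theta>]
          \<theta>_\<theta>_set[OF MV(1)] v'(3) by auto
    next
      case False
      hence ek: "e \<inter> K = {}" "e \<inter> ?K = {}" using e by blast+
      have eV: "e \<subseteq> V" using D(10)[OF True] .
      have "\<theta> x \<notin> K \<and> \<theta> x \<notin> ?K" if "x \<in> e" for x using that ek KK[of x] KK2[of x] eV by blast
      hence "\<theta> ` e \<inter> K = {}" "\<theta> ` e \<inter> ?K = {}" by auto
      thus ?thesis using D(8,9)[OF True] by auto
    qed
  next
    case False
    then obtain m where m: "m \<in> M" "e = {v, m} \<or> e = {\<theta> v, \<theta> m}" using e by (auto simp: star_def)
    have "m \<in> V" "m \<notin> K" "m \<notin> ?K" "\<theta> m \<notin> K" "\<theta> m \<notin> ?K" using m(1) MV MK MK' MKK by blast+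
    hence "\<theta> (\<theta> m) = m" "\<theta> m \<noteq> m" "m \<noteq> v" "m \<noteq> \<theta> v" "\<theta> m \<noteq> v" "\<theta> m \<noteq> \<theta> v"
      using D(6,7) KV vK by auto
    hence "{\<theta> v, \<theta> m} \<inter> {v, m} = {}" using v'(2) by auto
    hence "\<theta> ` e \<inter> e = {}" using m(2) v'(3) \<open>\<theta> (\<theta> m) = m\<close> by (elim disjE) (simp_all add: Int_commute)
    moreover have "\<theta> ` e = {v, m} \<or> \<theta> ` e = {\<theta> v, \<theta> m}" using m(2) v' \<open>\<theta> (\<theta> m) = m\<close> by auto
    hence "\<theta> ` e \<in> ?E" using m(1) unfolding star_def by blast
    ultimately show ?thesis by simp
  qed
  show "ci_on ?V ?E \<theta>" unfolding ci_on_def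
  proof (intro conjI)
    show "tight_on ?V ?E" by (rule t)
    show "\<forall>x\<in>?V. \<theta> x \<in> ?V \<and> \<theta> (\<theta> x) = x \<and> \<theta> x \<noteq> x" by (intro ballI a)
    show "\<forall>e\<in>?E. \<theta> ` e \<in> ?E \<and> \<theta> ` e \<inter> e = {}" by (intro ballI b)
  qed
qed


section \<open>The inverse moves\<close>

abbreviation G :: zgraph where "G \<equiv> \<lparr>verts = V, edges = E, invol = \<theta>\<rparr>"

text \<open>The reduced graph keeps \<open>\<theta>\<close>, which still has its old values on the
  removed pair. Reinserting the pair therefore gives back the same function, and the move yields
  \<open>G\<close> itself rather than an isomorphic graph.\<close>

lemma upd_\<theta>: "v \<in> V \<Longrightarrow> \<theta>(v := \<theta> v, \<theta> v := v) = \<theta>"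
  using D(6) by (auto simp: fun_eq_iff)

lemma E_decomp:
  assumes "v \<in> V"
  shows "E = {e \<in> E. v \<notin> e \<and> \<theta> v \<notin> e} \<union> star v (N v) \<union> star (\<theta> v) (\<theta> ` N v)"
proof -
  have "E = {e \<in> E. v \<notin> e \<and> \<theta> v \<notin> e} \<union> {e \<in> E. v \<in> e} \<union> {e \<in> E. \<theta> v \<in> e}" by blast
  thus ?thesis by (simp only: edge_star N_\<theta>[OF assms])
qed

lemma V_decomp: "v \<in> V \<Longrightarrow> V = V - {v, \<theta> v} \<union> {v, \<theta> v}"
  using D(5) by auto

lemma card_less: "v \<in> V \<Longrightarrow> V' \<subseteq> V - {v} \<Longrightarrow> card V' < card V"
  using D(3) by (intro psubset_card_mono) auto

text \<open>For degree 2 the remaining slack is 2 * 2 - 2, so the rest is an invariant tight set and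
  no edge has to be inserted.\<close>

lemma undo_ext0:
  assumes v: "v \<in> V" "card (N v) = 2"
  shows "\<exists>V' E'. ci_on V' E' \<theta> \<and> card V' < card V
    \<and> sym_0ext \<lparr>verts = V', edges = E', invol = \<theta>\<rparr> G"
proof -
  let ?V = "V - {v, \<theta> v}" and ?E = "{e \<in> E. v \<notin> e \<and> \<theta> v \<notin> e}"
  note R = remove_pair[OF v(1)]
  obtain a b where ab: "N v = {a, b}" "a \<noteq> b" using v(2) by (auto simp: card_2_iff)
  have "tset ?V" using R(1,3) v ab by (auto simp: tset_def)
  moreover have "ind E ?V = ?E" using D(10) by (auto simp: ind_def)
  ultimately have "ci_on ?V ?E \<theta>" using restrict[OF R(2)] by simp
  moreover have "card ?V < card V" using v by (intro card_less) auto
  moreover have "sym_0ext \<lparr>verts = ?V, edges = ?E, invol = \<theta>\<rparr> G"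
    unfolding sym_0ext_def zgraph.simps
  proof (intro exI conjI)
    show "a \<in> ?V" "b \<in> ?V" "a \<noteq> b" "v \<notin> ?V" "\<theta> v \<notin> ?V" "v \<noteq> \<theta> v"
      using ab R(3) D(7)[OF v(1)] by auto
    have "E = ?E \<union> {{v, a}, {v, b}, {\<theta> v, \<theta> a}, {\<theta> v, \<theta> b}}"
      using E_decomp[OF v(1)] unfolding ab(1) by (simp add: star_insert insert_commute)
    thus "G = \<lparr>verts = ?V \<union> {v, \<theta> v}, edges = ?E \<union> {{v, a}, {v, b}, {\<theta> v, \<theta> a}, {\<theta> v, \<theta> b}},
        invol = \<theta>(v := \<theta> v, \<theta> v := v)\<rparr>"
      using V_decomp[OF v(1)] upd_\<theta>[OF v(1)] by simp
  qed
  ultimately show ?thesis by blast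
qed

text \<open>The complement of \<open>Y\<close> has slack \<open>card (cut Y) = 2\<close>, so it is
  tight as well. The two outgoing edges are images of each other because the cut is invariant and no
  edge is fixed.\<close>

lemma undo_join:
  assumes Y: "sset Y" "tset Y" "Y \<noteq> V" "card (cut Y) = 2"
  shows "\<exists>V1 E1 V2 E2. ci_on V1 E1 \<theta> \<and> card V1 < card V \<and> ci_on V2 E2 \<theta> \<and> card V2 < card V
    \<and> sym_join \<lparr>verts = V1, edges = E1, invol = \<theta>\<rparr> \<lparr>verts = V2, edges = E2, invol = \<theta>\<rparr> G"
proof -
  let ?Z = "V - Y"
  have YV: "Y \<subseteq> V" "Y \<noteq> {}" using Y by (auto simp: tset_def)
  have Z: "sset ?Z" "tset ?Z" using sset_Compl[OF Y(1)] cut_slack[OF Y(2)] Y YV by (auto simp: tset_def)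
  have inY: "\<theta> x \<in> Y \<longleftrightarrow> x \<in> Y" if "x \<in> V" for x using that Y(1) D(6)[OF that] by (metis sset_def)
  obtain e where e: "e \<in> cut Y" using Y(4) by fastforce
  hence "e \<in> E" by (simp add: cut_def)
  then obtain p q where "e = {p, q}" "p \<in> V" "q \<in> V" using graph_onD[OF D(2)] by blast
  hence "\<exists>x y. e = {x, y} \<and> x \<in> Y \<and> y \<in> ?Z" using e by (auto simp: cut_def)
  then obtain x y where xy: "e = {x, y}" "x \<in> Y" "y \<in> ?Z" by blast
  have xyE: "{x, y} \<in> E" using \<open>e \<in> E\<close> xy by simp
  note ed = ED[OF xyE]
  have "{\<theta> x, \<theta> y} \<in> cut Y" using ed(1) inY[OF ed(2)] inY[OF ed(3)] xy by (auto simp: cut_def)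
  moreover have "{\<theta> x, \<theta> y} \<noteq> {x, y}" using ed D(7)[OF ed(2)] by (auto simp: doubleton_eq_iff)
  ultimately have "cut Y = {{x, y}, {\<theta> x, \<theta> y}}"
    using e xy Y(4) D(4) by (intro card_subset_eq[symmetric]) (auto simp: cut_def)
  moreover have "E = ind E Y \<union> ind E ?Z \<union> cut Y" using D(10) by (auto simp: ind_def cut_def)
  ultimately have E: "E = ind E Y \<union> ind E ?Z \<union> {{x, y}, {\<theta> x, \<theta> y}}" by simp
  have "sym_join \<lparr>verts = Y, edges = ind E Y, invol = \<theta>\<rparr> \<lparr>verts = ?Z, edges = ind E ?Z, invol = \<theta>\<rparr> G"
    unfolding sym_join_def zgraph.simps
  proof (intro exI conjI)
    show "Y \<inter> ?Z = {}" "x \<in> Y" "y \<in> ?Z" using xy by auto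
    show "G = \<lparr>verts = Y \<union> ?Z, edges = ind E Y \<union> ind E ?Z \<union> {{x, y}, {\<theta> x, \<theta> y}},
        invol = \<lambda>v. if v \<in> Y then \<theta> v else \<theta> v\<rparr>"
      using E YV by (simp add: Un_absorb1)
  qed
  moreover have "card Y < card V" using YV Y D(3) by (intro psubset_card_mono) auto
  moreover have "card ?Z < card V" using YV D(3) by (intro psubset_card_mono) auto
  ultimately show ?thesis using restrict[OF Y(1,2)] restrict[OF Z] by blast
qed

lemma undo_ext1:
  assumes v: "v \<in> V" "card (N v) = 3"
    and ab: "a \<in> N v" "b \<in> N v" "a \<noteq> b" "{a, b} \<notin> E" "\<theta> a \<noteq> b" "\<not> blocked v a b"
  shows "\<exists>V' E'. ci_on V' E' \<theta> \<and> card V' < card V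
    \<and> sym_1ext \<lparr>verts = V', edges = E', invol = \<theta>\<rparr> G"
proof -
  let ?V = "V - {v, \<theta> v}" and ?E = "{e \<in> E. v \<notin> e \<and> \<theta> v \<notin> e}"
  note R = remove_pair[OF v(1)]
  have abV: "a \<in> ?V" "b \<in> ?V" using ab R(3) by auto
  have "card (N v - {a, b}) = 1" using ab v NV(4) by (simp add: card_Diff_subset)
  then obtain c where c: "N v - {a, b} = {c}" by (auto simp: card_1_singleton_iff)
  hence Nv: "N v = {a, b, c}" "c \<notin> {a, b}" using ab by auto
  have "ci_on ?V (?E \<union> {{a, b}, {\<theta> a, \<theta> b}}) \<theta>"
    using v abV ab(3,4,5) by (rule reduce_pair) (use ab(6) in \<open>auto simp: blocked_def\<close>)
  moreover have "card ?V < card V" using v by (intro card_less) auto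
  moreover have "sym_1ext \<lparr>verts = ?V, edges = ?E \<union> {{a, b}, {\<theta> a, \<theta> b}}, invol = \<theta>\<rparr> G"
    unfolding sym_1ext_def zgraph.simps
  proof (intro exI conjI)
    have ab': "a \<in> V" "b \<in> V" using abV by auto
    show "{a, b} \<in> ?E \<union> {{a, b}, {\<theta> a, \<theta> b}}" by simp
    show "{\<theta> a, \<theta> b} \<noteq> {a, b}" using ab(5) D(7)[OF ab'(1)] by (auto simp: doubleton_eq_iff)
    show "c \<in> ?V" using Nv(1) R(3) by blast
    show "c \<notin> {a, b}" by fact
    show "v \<notin> ?V" "\<theta> v \<notin> ?V" "v \<noteq> \<theta> v" using D(7)[OF v(1)] by auto
    \<comment> \<open>Neither inserted edge was present before, so deleting them in the move
      recovers exactly the surviving old edges.\<close>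
    have "{\<theta> a, \<theta> b} \<notin> E" using ED(1)[of "\<theta> a" "\<theta> b"] ab(4) D(6)[OF ab'(1)] D(6)[OF ab'(2)] by auto
    hence "?E \<union> {{a, b}, {\<theta> a, \<theta> b}} - {{a, b}, {\<theta> a, \<theta> b}} = ?E" using ab(4) by blast
    moreover have "E = ?E \<union> {{v, a}, {v, b}, {v, c}, {\<theta> v, \<theta> a}, {\<theta> v, \<theta> b}, {\<theta> v, \<theta> c}}"
      using E_decomp[OF v(1)] unfolding Nv(1) by (simp add: star_insert insert_commute)
    ultimately show "G = \<lparr>verts = ?V \<union> {v, \<theta> v},
        edges = ?E \<union> {{a, b}, {\<theta> a, \<theta> b}} - {{a, b}, {\<theta> a, \<theta> b}}
          \<union> {{v, a}, {v, b}, {v, c}, {\<theta> v, \<theta> a}, {\<theta> v, \<theta> b}, {\<theta> v, \<theta> c}},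
        invol = \<theta>(v := \<theta> v, \<theta> v := v)\<rparr>"
      using V_decomp[OF v(1)] upd_\<theta>[OF v(1)] by simp
  qed
  ultimately show ?thesis by blast
qed

text \<open>In the reduced graph \<open>u\<close> is the vertex to be split, \<open>v\<close>
  becomes its copy, \<open>x\<close> and \<open>y\<close> are the neighbours they share, and the
  inserted edge \<open>{u, t}\<close> is the only one that moves to \<open>v\<close>.\<close>

lemma undo_C4:
  assumes v: "v \<in> V" "card (N v) = 3" "N v = {x, y, t}" and xy: "x \<noteq> y" "t \<noteq> x" "t \<noteq> y"
    and u: "{x, u} \<in> E" "{y, u} \<in> E" "u \<in> V - {v, \<theta> v}" "t \<in> V - {v, \<theta> v}" "u \<noteq> t" "{u, t} \<notin> E" "\<theta> u \<noteq> t"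
      "\<not> blocked v u t"
  shows "\<exists>V' E'. ci_on V' E' \<theta> \<and> card V' < card V
    \<and> sym_C4 \<lparr>verts = V', edges = E', invol = \<theta>\<rparr> G"
proof -
  let ?V = "V - {v, \<theta> v}" and ?E = "{e \<in> E. v \<notin> e \<and> \<theta> v \<notin> e}"
  note R = remove_pair[OF v(1)]
  have "ci_on ?V (?E \<union> {{u, t}, {\<theta> u, \<theta> t}}) \<theta>"
    using v(1,2) u(3-7) by (rule reduce_pair) (use u(8) in \<open>auto simp: blocked_def\<close>)
  moreover have "card ?V < card V" using v by (intro card_less) auto
  moreover have "sym_C4 \<lparr>verts = ?V, edges = ?E \<union> {{u, t}, {\<theta> u, \<theta> t}}, invol = \<theta>\<rparr> G"
    unfolding sym_C4_def zgraph.simps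
  proof (intro exI conjI)
    have V: "u \<in> V" "t \<in> V" "x \<in> ?V" "y \<in> ?V" using u R(3) v by auto
    show "u \<in> ?V" "v \<notin> ?V" "\<theta> v \<notin> ?V" using u by auto
    show "\<theta> u \<noteq> u" using D(7)[OF V(1)] .
    show "x \<in> nbrs \<lparr>verts = ?V, edges = ?E \<union> {{u, t}, {\<theta> u, \<theta> t}}, invol = \<theta>\<rparr> u"
      "y \<in> nbrs \<lparr>verts = ?V, edges = ?E \<union> {{u, t}, {\<theta> u, \<theta> t}}, invol = \<theta>\<rparr> u"
      using u V by (auto simp: nbrs_def insert_commute)
    show "x \<noteq> y" by fact
    show "v \<noteq> \<theta> v" using D(7)[OF v(1)] by simp
    show "{t} \<subseteq> nbrs \<lparr>verts = ?V, edges = ?E \<union> {{u, t}, {\<theta> u, \<theta> t}}, invol = \<theta>\<rparr> u - {x, y}"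
      using xy by (simp add: nbrs_def)
    have "{\<theta> u, \<theta> t} \<notin> E" using ED(1)[of "\<theta> u" "\<theta> t"] u(6) D(6)[OF V(1)] D(6)[OF V(2)] by auto
    hence "?E \<union> {{u, t}, {\<theta> u, \<theta> t}} - {{u, z} |z. z \<in> {t}} - {{\<theta> u, \<theta> z} |z. z \<in> {t}} = ?E"
      using u(6) by auto
    moreover have "{t} \<union> {x, y} = N v" using v(3) by auto
    moreover have "{{v, z} |z. z \<in> N v} = star v (N v)" "{{\<theta> v, \<theta> z} |z. z \<in> N v} = star (\<theta> v) (\<theta> ` N v)"
      by (auto simp: star_def)
    ultimately show "G = \<lparr>verts = ?V \<union> {v, \<theta> v},
        edges = ?E \<union> {{u, t}, {\<theta> u, \<theta> t}} - {{u, z} |z. z \<in> {t}} - {{\<theta> u, \<theta> z} |z. z \<in> {t}}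
          \<union> {{v, z} |z. z \<in> {t} \<union> {x, y}} \<union> {{\<theta> v, \<theta> z} |z. z \<in> {t} \<union> {x, y}},
        invol = \<theta>(v := \<theta> v, \<theta> v := v)\<rparr>"
      using V_decomp[OF v(1)] upd_\<theta>[OF v(1)] E_decomp[OF v(1)] by simp
  qed
  ultimately show ?thesis by blast
qed

text \<open>Expanding the contracted vertex recovers \<open>G\<close> when \<open>d\<close> sends
  each vertex attached to the clique to its neighbour inside; by \<open>uniq\<close> there is only
  one.\<close>

lemma undo_K4:
  assumes v: "v \<in> V" "card (N v) = 3" and cl: "\<forall>x\<in>N v. \<forall>y\<in>N v. x \<noteq> y \<longrightarrow> {x, y} \<in> E"
  defines "K \<equiv> insert v (N v)"
  assumes uniq: "\<And>u k k'. u \<in> V - K \<Longrightarrow> k \<in> K \<Longrightarrow> k' \<in> K \<Longrightarrow> {k, u} \<in> E \<Longrightarrow> {k', u} \<in> E \<Longrightarrow> k = k'"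
    and no: "\<And>p q. p \<in> K \<Longrightarrow> q \<in> \<theta> ` K \<Longrightarrow> {p, q} \<notin> E"
  shows "\<exists>V' E'. ci_on V' E' \<theta> \<and> card V' < card V
    \<and> sym_K4 \<lparr>verts = V', edges = E', invol = \<theta>\<rparr> G"
proof -
  note K = K4_tset[OF v cl, folded K_def]
  define M where "M = {u \<in> V - K. \<exists>k\<in>K. {k, u} \<in> E}"
  let ?K = "\<theta> ` K"
  let ?V = "V - N v - \<theta> ` N v"
  define E0 where "E0 = {e \<in> E. e \<inter> K = {} \<and> e \<inter> ?K = {}}"
  let ?E = "E0 \<union> star v M \<union> star (\<theta> v) (\<theta> ` M)"
  let ?H = "\<lparr>verts = ?V, edges = ?E, invol = \<theta>\<rparr>"
  have C: "ci_on ?V ?E \<theta>" "M \<inter> ?K = {}" "\<theta> ` M \<inter> K = {}"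
    unfolding M_def E0_def
    by (rule K4_contract[OF v cl, folded K_def]; (erule (4) uniq | erule (1) no))+
  have vK: "v \<in> K" "v \<notin> ?K" "\<theta> v \<in> ?K" "\<theta> v \<notin> K" using K(4) by (auto simp: K_def)
  have KV: "K \<subseteq> V" using K(2) by (simp add: tset_def)
  have v': "\<theta> v \<in> V" "\<theta> v \<noteq> v" "\<theta> (\<theta> v) = v" using D(5,6,7) v by auto
  obtain a b c where abc: "N v = {a, b, c}" "a \<noteq> b" "a \<noteq> c" "b \<noteq> c" using v(2) by (auto simp: card_3_iff)
  have abcV: "a \<in> V" "b \<in> V" "c \<in> V" using abc NV(1)[of v] by auto
  have Kabc: "K = {v, a, b, c}" "?K = {\<theta> v, \<theta> a, \<theta> b, \<theta> c}" using abc by (auto simp: K_def)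
  define d where "d = (\<lambda>u. SOME k. k \<in> K \<and> {k, u} \<in> E)"
  have d: "d u \<in> K \<and> {d u, u} \<in> E" if "u \<in> M" for u
    unfolding d_def using that by (intro someI_ex[of "\<lambda>k. k \<in> K \<and> {k, u} \<in> E"]) (auto simp: M_def)
  have du: "d u = k" if "k \<in> K" "u \<in> V - K" "{k, u} \<in> E" for k u
  proof -
    have "u \<in> M" using that by (auto simp: M_def)
    thus ?thesis using uniq[of u "d u" k] d[of u] that by auto
  qed
  have E0v: "v \<notin> e \<and> \<theta> v \<notin> e" if "e \<in> E0" for e using that vK by (auto simp: E0_def)
  have nb: "nbrs ?H v = M"
  proof -
    have "{v, u} \<in> ?E \<longleftrightarrow> u \<in> M" for u
    proof
      assume "{v, u} \<in> ?E"
      moreover have "{v, u} \<notin> E0" using E0v[of "{v, u}"] by auto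
      moreover have "{v, u} \<notin> star (\<theta> v) (\<theta> ` M)"
        using C(3) vK by (auto simp: star_def doubleton_eq_iff)
      ultimately show "u \<in> M" by (auto simp: star_def doubleton_eq_iff)
    qed (auto simp: star_def)
    thus ?thesis by (simp add: nbrs_def)
  qed
  have E0eq: "{e \<in> ?E. v \<notin> e \<and> \<theta> v \<notin> e} = E0" using E0v by (auto simp: star_def)
  have E: "E = E0 \<union> clique K \<union> clique ?K \<union> {{d u, u} |u. u \<in> M} \<union> {{\<theta> (d u), \<theta> u} |u. u \<in> M}"
    (is "E = ?R")
  proof (intro equalityI subsetI)
    fix e assume e: "e \<in> E"
    obtain p q where pq: "e = {p, q}" "p \<noteq> q" "p \<in> V" "q \<in> V" using graph_onD[OF D(2) e] by blast
    have cross: "e \<in> ?R" if kx: "e = {k, x}" "k \<in> K" "x \<notin> K" for k x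
    proof -
      have "x \<in> V - K" using kx pq D(10)[OF e] by auto
      moreover from this have "x \<in> M" using kx e by (auto simp: M_def)
      ultimately have "e \<in> {{d u, u} |u. u \<in> M}" using du[of k x] kx e by auto
      thus ?thesis by blast
    qed
    \<comment> \<open>An edge leaving the image clique is the image of an edge leaving
      \<open>K\<close>, so the choice made at \<open>\<theta> x\<close> accounts for it.\<close>
    have cross': "e \<in> ?R" if kx: "e = {k, x}" "k \<in> ?K" "x \<notin> ?K" for k x
    proof -
      have kxV: "k \<in> V" "x \<in> V" using kx D(10)[OF e] by auto
      have kxE: "{\<theta> k, \<theta> x} \<in> E" using ED(1)[of k x] kx e by simp
      have "\<theta> k \<in> K" "\<theta> x \<in> V - K" using in_image[OF KV] kx kxV D(5) by auto
      hence "\<theta> x \<in> M" "d (\<theta> x) = \<theta> k" using kxE du[of "\<theta> k" "\<theta> x"] by (auto simp: M_def)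
      moreover have "\<theta> (\<theta> k) = k" "\<theta> (\<theta> x) = x" using D(6) kxV by auto
      ultimately have "e = {\<theta> (d (\<theta> x)), \<theta> (\<theta> x)}" using kx by simp
      thus ?thesis using \<open>\<theta> x \<in> M\<close> by blast
    qed
    consider "e \<inter> K = {} \<and> e \<inter> ?K = {}" | "p \<in> K" "q \<in> K" | "p \<in> K" "q \<notin> K" | "q \<in> K" "p \<notin> K"
      | "p \<in> ?K" "q \<in> ?K" | "p \<in> ?K" "q \<notin> ?K" | "q \<in> ?K" "p \<notin> ?K" using pq by auto
    thus "e \<in> ?R"
    proof cases
      case 1 thus ?thesis using e by (simp add: E0_def)
    next
      case 2
      hence "e \<in> clique K" using pq by (auto simp: clique_def)
      thus ?thesis by blast
    next
      case 3 thus ?thesis using cross pq by blast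
    next
      case 4 thus ?thesis using cross[of q p] pq by (simp add: insert_commute)
    next
      case 5
      hence "e \<in> clique ?K" unfolding clique_def using pq by blast
      thus ?thesis by blast
    next
      case 6 thus ?thesis using cross' pq by blast
    next
      case 7 thus ?thesis using cross'[of q p] pq by (simp add: insert_commute)
    qed
  next
    fix e assume "e \<in> ?R"
    thus "e \<in> E"
    proof (elim UnE)
      assume "e \<in> {{\<theta> (d u), \<theta> u} |u. u \<in> M}" thus ?thesis using d ED(1) by blast
    qed (use K d in \<open>auto simp: E0_def\<close>)
  qed
  have V': "?V \<union> {a, b, c, \<theta> a, \<theta> b, \<theta> c} = V" using abc abcV D(5) by auto
  have dis: "distinct [a, b, c, \<theta> a, \<theta> b, \<theta> c]"
  proof -
    have "\<theta> a \<noteq> \<theta> b" "\<theta> a \<noteq> \<theta> c" "\<theta> b \<noteq> \<theta> c" using abc abcV D(6) by metis+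
    moreover have "{a, b, c} \<inter> {\<theta> a, \<theta> b, \<theta> c} = {}" using K(4) Kabc by blast
    ultimately show ?thesis using abc(2-4) by auto
  qed
  have t: "\<theta>(a := \<theta> a, b := \<theta> b, c := \<theta> c, \<theta> a := a, \<theta> b := b, \<theta> c := c) = \<theta>"
    using D(6)[OF abcV(1)] D(6)[OF abcV(2)] D(6)[OF abcV(3)] by (auto simp: fun_eq_iff)
  have "sym_K4 ?H G" unfolding sym_K4_def
  proof (intro exI conjI)
    have vN: "v \<notin> N v" "v \<notin> \<theta> ` N v" using NV[of v] in_image[OF NV(1)[of v] v(1)] by auto
    show "v \<in> verts ?H" "invol ?H v \<noteq> v" using v vN v' by auto
    show "distinct [a, b, c, \<theta> a, \<theta> b, \<theta> c]" by (rule dis)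
    show "{a, b, c, \<theta> a, \<theta> b, \<theta> c} \<inter> verts ?H = {}" using abc by auto
    show "\<forall>u\<in>nbrs ?H v. d u \<in> {v, a, b, c}" using d Kabc nb by auto
    have "G = \<lparr>verts = ?V \<union> {a, b, c, \<theta> a, \<theta> b, \<theta> c},
        edges = E0 \<union> clique K \<union> clique ?K \<union> {{d u, u} |u. u \<in> M} \<union> {{\<theta> (d u), \<theta> u} |u. u \<in> M},
        invol = \<theta>\<rparr>"
      using V' E by simp
    thus "let t = (invol ?H)(a := \<theta> a, b := \<theta> b, c := \<theta> c, \<theta> a := a, \<theta> b := b, \<theta> c := c)
      in G = \<lparr>verts = verts ?H \<union> {a, b, c, \<theta> a, \<theta> b, \<theta> c},
          edges = {e \<in> edges ?H. v \<notin> e \<and> invol ?H v \<notin> e} \<union> clique {v, a, b, c}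
            \<union> clique {invol ?H v, \<theta> a, \<theta> b, \<theta> c} \<union> {{d u, u} |u. u \<in> nbrs ?H v}
            \<union> {{t (d u), invol ?H u} |u. u \<in> nbrs ?H v},
          invol = t\<rparr>"
      unfolding nb unfolding zgraph.simps t Let_def E0eq Kabc(2) unfolding Kabc(1) .
  qed
  moreover have "card ?V < card V" using abc abcV by (intro card_less[of a]) auto
  ultimately show ?thesis using C(1) by blast
qed

section \<open>Recognition of the base graphs, and the induction\<close>

lemma iso_F1:
  assumes v: "v \<in> V" "N v = {x, \<theta> x, z}" "{x, z} \<in> E" "{\<theta> x, z} \<in> E"
    and V: "{v, \<theta> v, z, \<theta> z, x, \<theta> x} = V"
  shows "z2_iso F1 G"
proof (rule z2_iso_embedding[OF tight_on_F1])
  note F = F1_config[OF v]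
  define f where "f = (\<lambda>i. [v, z, x, \<theta> x, \<theta> z, \<theta> v] ! i)"
  have f: "f 0 = v" "f 1 = z" "f (Suc 0) = z" "f 2 = x" "f 3 = \<theta> x" "f 4 = \<theta> z" "f 5 = \<theta> v"
    by (simp_all add: f_def)
  have xV: "x \<in> V" "z \<in> V" using V by auto
  show "tight_on (verts G) (edges G)" using D(1) by simp
  have "distinct (map f [0, 1, 2, 3, 4, 5])" using F(2) by (simp add: f)
  hence "inj_on f (verts F1)" by (simp only: distinct_map F1_verts list.set)
  moreover have "f ` verts F1 = verts G" using f V by (auto simp: F1_verts)
  ultimately show "bij_betw f (verts F1) (verts G)" by (simp add: bij_betw_def)
  show "f ` e \<in> edges G" if "e \<in> edges F1" for e
    using that F(3-10) v(3,4) f unfolding F1_edges by (elim insertE) (auto simp: insert_commute)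
  show "f (invol F1 i) = invol G (f i)" if "i \<in> verts F1" for i
  proof -
    have inv: "invol F1 0 = 5" "invol F1 1 = 4" "invol F1 2 = 3" "invol F1 3 = 2" "invol F1 4 = 1" "invol F1 5 = 0"
      by (simp_all add: F1_def)
    show ?thesis using that unfolding F1_verts
      by (elim insertE) (simp_all only: inv f zgraph.simps D(6)[OF v(1)] D(6)[OF xV(1)] D(6)[OF xV(2)], simp)
  qed
qed

lemma iso_F2:
  assumes v: "v \<in> V" "card (N v) = 3" and cl: "\<forall>x\<in>N v. \<forall>y\<in>N v. x \<noteq> y \<longrightarrow> {x, y} \<in> E"
  defines "K \<equiv> insert v (N v)"
  assumes pq: "p \<in> K" "q \<in> K" "{p, \<theta> q} \<in> E" and V: "K \<union> \<theta> ` K = V"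
  shows "z2_iso F2 G"
proof -
  note K = K4_tset[OF v cl, folded K_def]
  have ne: "p \<noteq> q" using F2_config(2)[OF v cl] pq by (simp add: K_def)
  have "card (K - {p, q}) = 2" using K(3) pq ne by (simp add: card_Diff_subset)
  then obtain r s where rs: "K - {p, q} = {r, s}" "r \<noteq> s" by (auto simp: card_2_iff)
  have Keq: "K = {r, s, p, q}" using rs pq by auto
  have KV: "K \<subseteq> V" using V by auto
  have dK: "distinct [r, s, p, q]" using rs ne by auto
  have inv: "\<theta> (\<theta> r) = r" "\<theta> (\<theta> s) = s" "\<theta> (\<theta> p) = p" "\<theta> (\<theta> q) = q" using D(6) KV Keq by auto
  have "distinct (map \<theta> [r, s, p, q])"
    using dK inj_on_subset[OF inj_\<theta> KV] unfolding Keq distinct_map by simp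
  hence dK': "distinct [\<theta> r, \<theta> s, \<theta> p, \<theta> q]" by simp
  have KK: "x \<noteq> \<theta> y" if "x \<in> {r, s, p, q}" "y \<in> {r, s, p, q}" for x y using that K(4) unfolding Keq by blast
  \<comment> \<open>In F2 the connecting edges join 2 to 6 and 3 to 7, whereas the involution swaps
    2 with 7 and 3 with 6. Hence \<open>\<theta> q\<close> stands before
    \<open>\<theta> p\<close>.\<close>
  define f where "f = (\<lambda>i. [r, s, p, q, \<theta> r, \<theta> s, \<theta> q, \<theta> p] ! i)"
  have f: "f 0 = r" "f 1 = s" "f (Suc 0) = s" "f 2 = p" "f 3 = q" "f 4 = \<theta> r" "f 5 = \<theta> s" "f 6 = \<theta> q" "f 7 = \<theta> p"
    by (simp_all add: f_def)
  have "distinct (map f [0, 1, 2, 3, 4, 5, 6, 7])"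
    using dK dK' KK by (simp add: f) metis
  hence "inj_on f (verts F2)" by (simp only: distinct_map F2_verts list.set)
  moreover have "f ` verts F2 = verts G" using f V unfolding Keq by (auto simp: F2_verts)
  ultimately have bij: "bij_betw f (verts F2) (verts G)" by (simp add: bij_betw_def)
  have cK: "{{r, s}, {r, p}, {r, q}, {s, p}, {s, q}, {p, q}} \<subseteq> E"
    using K(1) unfolding Keq by (simp add: clique4[OF dK])
  have cK': "{{\<theta> r, \<theta> s}, {\<theta> r, \<theta> p}, {\<theta> r, \<theta> q}, {\<theta> s, \<theta> p}, {\<theta> s, \<theta> q}, {\<theta> p, \<theta> q}} \<subseteq> E"
    using K(7) unfolding Keq by (simp add: clique4[OF dK'])
  have "{q, \<theta> p} \<in> E" using ED(1)[OF pq(3)] inv by (simp add: insert_commute)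
  hence "\<forall>e\<in>edges F2. f ` e \<in> edges G"
    using cK cK' pq(3) unfolding F2_edges by (simp add: f insert_commute)
  moreover have "f (invol F2 i) = invol G (f i)" if "i \<in> verts F2" for i
  proof -
    have i: "invol F2 0 = 4" "invol F2 1 = 5" "invol F2 2 = 7" "invol F2 3 = 6" "invol F2 4 = 0" "invol F2 5 = 1"
      "invol F2 6 = 3" "invol F2 7 = 2" by (simp_all add: F2_def)
    show ?thesis using that unfolding F2_verts
      by (elim insertE) (simp_all only: i f inv zgraph.simps, simp)
  qed
  ultimately show ?thesis using D(1) by (intro z2_iso_embedding[OF tight_on_F2 _ bij]) simp_all
qed

text \<open>The order of the cases supplies the hypotheses. Excluding degree 2 and joins is what
  \<open>exists_deg3\<close> asks for; as every block through the vertex found there is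
  \<open>V\<close>, an F1 or F2 configuration at it fills the whole graph. A K4 is contracted only
  once an outside vertex with two neighbours in it and an edge to its image have been ruled
  out.\<close>

lemma generated_step:
  assumes IH: "\<And>V' E' \<theta>'. ci_on V' E' \<theta>' \<Longrightarrow> card V' < card V \<Longrightarrow> generated \<lparr>verts = V', edges = E', invol = \<theta>'\<rparr>"
  shows "generated G"
proof (cases "\<exists>v\<in>V. card (N v) = 2")
  case True
  thus ?thesis using undo_ext0 IH generated.ext0 by metis
next
  case deg: False
  have z2: "z2_graph G" using ci ci_on_iff[of G] by simp
  show ?thesis
  proof (cases "\<exists>Y. sset Y \<and> tset Y \<and> Y \<noteq> V \<and> card (cut Y) = 2")
    case True
    then obtain V1 E1 V2 E2 where "ci_on V1 E1 \<theta>" "card V1 < card V" "ci_on V2 E2 \<theta>" "card V2 < card V"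
      "sym_join \<lparr>verts = V1, edges = E1, invol = \<theta>\<rparr> \<lparr>verts = V2, edges = E2, invol = \<theta>\<rparr> G"
      using undo_join by metis
    thus ?thesis using IH generated.join by metis
  next
    case nojoin: False
    obtain v where v: "v \<in> V" "card (N v) = 3" and blk: "\<And>Y. block Y \<Longrightarrow> v \<in> Y \<Longrightarrow> Y = V"
      using exists_deg3 deg nojoin by metis
    show ?thesis
    proof (cases "\<exists>a\<in>N v. \<exists>b\<in>N v. a \<noteq> b \<and> {a, b} \<notin> E \<and> \<theta> a \<noteq> b \<and> \<not> blocked v a b")
      case True
      then obtain a b where "a \<in> N v" "b \<in> N v" "a \<noteq> b" "{a, b} \<notin> E" "\<theta> a \<noteq> b" "\<not> blocked v a b" by blast
      from undo_ext1[OF v this] show ?thesis using IH generated.ext1 by metis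
    next
      case False
      hence "(\<forall>x\<in>N v. \<forall>y\<in>N v. x \<noteq> y \<longrightarrow> {x, y} \<in> E) \<or> (\<exists>x z. N v = {x, \<theta> x, z} \<and> {x, z} \<in> E \<and> {\<theta> x, z} \<in> E)"
        by (intro deg3_cases[OF v]) blast
      thus ?thesis
      proof (elim disjE exE conjE)
        fix x z assume xz: "N v = {x, \<theta> x, z}" "{x, z} \<in> E" "{\<theta> x, z} \<in> E"
        have "{v, \<theta> v, z, \<theta> z, x, \<theta> x} = V" using blk[OF F1_config(1)[OF v(1) xz]] by simp
        from iso_F1[OF v(1) xz this] show ?thesis using generated.base1 z2 generated.iso by blast
      next
        assume cl: "\<forall>x\<in>N v. \<forall>y\<in>N v. x \<noteq> y \<longrightarrow> {x, y} \<in> E"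
        let ?K = "insert v (N v)"
        show ?thesis
        proof (cases "\<exists>u k k'. u \<in> V - ?K \<and> k \<in> ?K \<and> k' \<in> ?K \<and> k \<noteq> k' \<and> {k, u} \<in> E \<and> {k', u} \<in> E")
          case True
          then obtain u k k' where u: "u \<in> V - ?K" "k \<in> ?K" "k' \<in> ?K" "k \<noteq> k'" "{k, u} \<in> E" "{k', u} \<in> E"
            by blast
          obtain t where t: "N v = {k, k', t}" "t \<noteq> k" "t \<noteq> k'" "u \<in> V - {v, \<theta> v}" "t \<in> V - {v, \<theta> v}" "u \<noteq> t"
            "{u, t} \<notin> E" "\<theta> u \<noteq> t" "\<not> blocked v u t"
            using K4_two_nbrs[OF v cl u] by blast
          from undo_C4[OF v t(1) u(4) t(2,3) u(5,6) t(4-9)] show ?thesis using IH generated.c4 by metis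
        next
          case uniq: False
          show ?thesis
          proof (cases "\<exists>p\<in>?K. \<exists>q\<in>?K. {p, \<theta> q} \<in> E")
            case True
            then obtain p q where pq: "p \<in> ?K" "q \<in> ?K" "{p, \<theta> q} \<in> E" by blast
            have "?K \<union> \<theta> ` ?K = V" using blk[OF F2_config(1)[OF v cl pq]] by simp
            from iso_F2[OF v cl pq this] show ?thesis using generated.base2 z2 generated.iso by blast
          next
            case False
            have "\<exists>V' E'. ci_on V' E' \<theta> \<and> card V' < card V \<and> sym_K4 \<lparr>verts = V', edges = E', invol = \<theta>\<rparr> G"
              using v cl by (rule undo_K4) (use uniq False in blast)+
            thus ?thesis using IH generated.k4 by metis
          qed
        qed
      qed
    qed
  qed
qed

end

text \<open>Strong induction on the number of vertices, since an inverse move removes two or six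
  vertices and a join splits into parts of arbitrary size.\<close>

lemma ci_on_generated: "ci_on (verts H) (edges H) (invol H) \<Longrightarrow> generated H"
proof (induction "card (verts H)" arbitrary: H rule: less_induct)
  case less
  interpret ci_graph "verts H" "edges H" "invol H" using less.prems by unfold_locales
  have "generated \<lparr>verts = verts H, edges = edges H, invol = invol H\<rparr>"
  proof (rule generated_step)
    fix V' E' \<theta>' assume "ci_on V' E' \<theta>'" "card V' < card (verts H)"
    thus "generated \<lparr>verts = V', edges = E', invol = \<theta>'\<rparr>"
      using less.hyps[of "\<lparr>verts = V', edges = E', invol = \<theta>'\<rparr>"] by simp
  qed
  moreover have "\<lparr>verts = verts H, edges = edges H, invol = invol H\<rparr> = H" by (rule zgraph.equality) simp_all
  ultimately show ?case by simp
qed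

theorem theorem5p10:
  fixes G :: zgraph
  assumes "z2_graph G"
  shows "ci_tight G \<longleftrightarrow> generated G"
proof
  assume "ci_tight G"
  thus "generated G" using assms ci_on_iff[of G] by (intro ci_on_generated) simp
next
  assume "generated G"
  hence "ci_on (verts G) (edges G) (invol G)"
  proof (induction rule: generated.induct)
    case base1
    have "invol F1 = (\<lambda>v. if v \<le> 5 then 5 - v else v)" by (simp add: F1_def)
    thus ?case using tight_on_F1 by (simp add: ci_on_def F1_edges F1_verts doubleton_eq_iff)
  next
    case base2
    have "invol F2 = (\<lambda>v. if v = 0 then 4 else if v = 4 then 0
        else if v = 1 then 5 else if v = 5 then 1 else if v = 2 then 7 else if v = 7 then 2
        else if v = 3 then 6 else if v = 6 then 3 else v)" by (simp add: F2_def)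
    thus ?case using tight_on_F2 by (simp add: ci_on_def F2_edges F2_verts doubleton_eq_iff)
  next
    case (iso G H)
    then obtain f where "bij_betw f (verts G) (verts H)"
      "\<forall>u\<in>verts G. \<forall>v\<in>verts G. {u, v} \<in> edges G \<longleftrightarrow> {f u, f v} \<in> edges H"
      "\<forall>v\<in>verts G. f (invol G v) = invol H (f v)" by (auto simp: z2_iso_def)
    thus ?case using iso by (intro ci_on_iso[OF iso.IH z2_graph_on]) auto
  next
    case (ext0 G H)
    then obtain a b v v' where *: "a \<in> verts G" "b \<in> verts G" "a \<noteq> b" "v \<notin> verts G" "v' \<notin> verts G" "v \<noteq> v'"
      "H = \<lparr> verts = verts G \<union> {v, v'},
               edges = edges G \<union> {{v, a}, {v, b}, {v', invol G a}, {v', invol G b}},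
               invol = (invol G)(v := v', v' := v) \<rparr>" 
      unfolding sym_0ext_def by blast
    show ?case unfolding *(7) zgraph.simps using ext0.IH *(4,5,6,1,2,3) by (rule ci_on_ext0)
  next
    case (ext1 G H)
    then obtain a b c v v' where *: "{a, b} \<in> edges G" "c \<in> verts G" "c \<notin> {a, b}"
      "v \<notin> verts G" "v' \<notin> verts G" "v \<noteq> v'"
      "H = \<lparr> verts = verts G \<union> {v, v'},
               edges = (edges G - {{a, b}, {invol G a, invol G b}})
                       \<union> {{v, a}, {v, b}, {v, c}, {v', invol G a}, {v', invol G b}, {v', invol G c}},
               invol = (invol G)(v := v', v' := v) \<rparr>" unfolding sym_1ext_def by blast
    show ?case unfolding *(7) zgraph.simps using ext1.IH *(4,5,6,1,2,3) by (rule ci_on_ext1)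
  next
    case (k4 G H)
    obtain w a b c a' b' c' d where *: "w \<in> verts G" "distinct [a, b, c, a', b', c']"
      "{a, b, c, a', b', c'} \<inter> verts G = {}" "\<forall>u\<in>nbrs G w. d u \<in> {w, a, b, c}"
      "let t = (invol G)(a := a', b := b', c := c', a' := a, b' := b, c' := c) in
          H = \<lparr> verts = verts G \<union> {a, b, c, a', b', c'},
                edges = {e \<in> edges G. w \<notin> e \<and> invol G w \<notin> e}
                        \<union> clique {w, a, b, c} \<union> clique {invol G w, a', b', c'}
                        \<union> {{d u, u} | u. u \<in> nbrs G w}
                        \<union> {{t (d u), invol G u} | u. u \<in> nbrs G w},
                invol = t \<rparr>"
      using k4.hyps(2) unfolding sym_K4_def by (elim exE conjE) (rule that)
    define t where "t = (invol G)(a := a', b := b', c := c', a' := a, b' := b, c' := c)"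
    have H: "H = \<lparr> verts = verts G \<union> {a, b, c, a', b', c'},
                edges = {e \<in> edges G. w \<notin> e \<and> invol G w \<notin> e}
                        \<union> clique {w, a, b, c} \<union> clique {invol G w, a', b', c'}
                        \<union> {{d u, u} | u. {w, u} \<in> edges G}
                        \<union> {{t (d u), invol G u} | u. {w, u} \<in> edges G},
                invol = t \<rparr>" using *(5) by (simp add: Let_def t_def nbrs_def)
    show ?case unfolding H zgraph.simps using k4.IH *(1,2,3)
      by (rule ci_on_K4) (use *(4) in \<open>auto simp: nbrs_def t_def\<close>)
  next
    case (c4 G H)
    then obtain w v1 v2 S u u' where *: "v1 \<in> nbrs G w" "v2 \<in> nbrs G w" "v1 \<noteq> v2"
      "S \<subseteq> nbrs G w - {v1, v2}" "u \<notin> verts G" "u' \<notin> verts G" "u \<noteq> u'"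
      "H = \<lparr> verts = verts G \<union> {u, u'},
               edges = (edges G - {{w, x} | x. x \<in> S} - {{invol G w, invol G x} | x. x \<in> S})
                       \<union> {{u, x} | x. x \<in> S \<union> {v1, v2}}
                       \<union> {{u', invol G x} | x. x \<in> S \<union> {v1, v2}},
               invol = (invol G)(u := u', u' := u) \<rparr>" unfolding sym_C4_def by blast
    have st: "{{y, invol G x} | x. x \<in> M} = star y (invol G ` M)" for y M by (auto simp: star_def)
    have H: "H = \<lparr> verts = verts G \<union> {u, u'},
               edges = edges G - star w S - star (invol G w) (invol G ` S)
                       \<union> star u (S \<union> {v1, v2}) \<union> star u' (invol G ` (S \<union> {v1, v2})),
               invol = (invol G)(u := u', u' := u) \<rparr>"
      unfolding *(8) st by (simp only: star_def)
    show ?case unfolding H zgraph.simps using c4.IH *(5,6,7)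
      by (rule ci_on_C4) (use * in \<open>auto simp: nbrs_def star_def\<close>)
  next
    case (join G1 G2 H)
    then obtain x y where *: "verts G1 \<inter> verts G2 = {}" "x \<in> verts G1" "y \<in> verts G2"
      "H = \<lparr> verts = verts G1 \<union> verts G2,
               edges = edges G1 \<union> edges G2 \<union> {{x, y}, {invol G1 x, invol G2 y}},
               invol = (\<lambda>v. if v \<in> verts G1 then invol G1 v else invol G2 v) \<rparr>"
      unfolding sym_join_def by blast
    show ?case unfolding *(4) zgraph.simps using join.IH *(1,2,3)
      by (rule ci_on_join) (use *(1) in auto)
  qed
  thus "ci_tight G" using ci_on_iff[of G] by simp
qed

end
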